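(* Let $A\in C^\omega(\mathbb{R}/\mathbb{Z},\mathbb{C}^{d\times d})$ and $\alpha\in\mathbb{R}/\mathbb{Z}$ be such that $L_1(\alpha,A)=-\infty$, in which case $L_k(\alpha,A)=-\infty$ for all $k=1,\ldots,d$. Then there exists $A'\in C^\omega(\mathbb{R}/\mathbb{Z},\mathbb{C}^{d\times d})$ such that for any $\varepsilon\in\mathbb{C}$, $\varepsilon\neq0$, all Lyapunov exponents $L_1,\dots,L_d$ of $(\alpha,A+\varepsilon A')$ are distinct. Hence, there are arbitrarily small analytic perturbations of $A$ with simple Lyapunov spectrum (i.e. all Lyapunov exponents different).
   Context: $C^\omega(\mathbb{R}/\mathbb{Z},Y)$ denotes real analytic (one-periodic) functions with values in $Y$. The one-frequency cocycle $(\alpha,A)$ is the linear cocycle over $f(x)=x+\alpha$ on $\mathbb{R}/\mathbb{Z}$ with Lebesgue measure. Iterates: $A_n(x)=A(x+(n-1)\alpha)\cdots A(x+\alpha)A(x)$ for $n\ge1$. Lyapunov exponents: with $\sigma_1(M)\ge\dots\ge\sigma_d(M)\ge0$ the singular values of $M\in\mathbb{C}^{d\times d}$, $L_k(\alpha,A)=\lim_{n\to\infty}\frac1n\int_0^1\ln(\sigma_k(A_n(x)))\,dx\in[-\infty,\infty)$, $k=1,\dots,d$, with $\ln0=-\infty$. *)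

theory Defs
  imports
    "HOL-Analysis.Analysis"
    "Jordan_Normal_Form.Schur_Decomposition"
begin

definition real_analytic :: "(real \<Rightarrow> complex) \<Rightarrow> bool" where
  "real_analytic f \<longleftrightarrow>
     (\<forall>x0. \<exists>r>0. \<exists>a :: nat \<Rightarrow> complex. \<forall>x. \<bar>x - x0\<bar> < r \<longrightarrow>
        (\<lambda>n. a n * of_real ((x - x0) ^ n)) sums f x)"

(* Functions on the circle R/Z are represented by one-periodic functions on the real line. *)
definition periodic_analytic :: "nat \<Rightarrow> (real \<Rightarrow> complex mat) \<Rightarrow> bool" where
  "periodic_analytic d A \<longleftrightarrow>
     (\<forall>x. A x \<in> carrier_mat d d) \<and> (\<forall>x. A (x + 1) = A x) \<and>
     (\<forall>i<d. \<forall>j<d. real_analytic (\<lambda>x. A x $$ (i, j)))"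

fun cocycle_iter :: "nat \<Rightarrow> real \<Rightarrow> (real \<Rightarrow> complex mat) \<Rightarrow> nat \<Rightarrow> real \<Rightarrow> complex mat" where
  "cocycle_iter d \<alpha> A 0 x = 1\<^sub>m d"
| "cocycle_iter d \<alpha> A (Suc n) x = A (x + real n * \<alpha>) * cocycle_iter d \<alpha> A n x"

(* Square roots of the eigenvalues of M* M, listed with algebraic multiplicity in decreasing
   order. The eigenvalues are real and nonnegative, so Re only changes the type. *)
definition singular_values :: "complex mat \<Rightarrow> real list" where
  "singular_values M =
     rev (sorted_list_of_multiset
       (image_mset (\<lambda>z. sqrt (Re z)) (proots (char_poly (mat_adjoint M * M)))))"

(* The indices k = 1, ..., d start at 1, as in the usual notation sigma_1 >= ... >= sigma_d. *)
definition singular_value :: "nat \<Rightarrow> complex mat \<Rightarrow> real" where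
  "singular_value k M = singular_values M ! (k - 1)"

(* ln 0 is minus infinity here, unlike for the library function ln on the reals. *)
definition eln :: "real \<Rightarrow> ereal" where
  "eln s = (if s = 0 then - \<infinity> else ereal (ln s))"

(* Lebesgue integral over [0, 1] of an extended-real function, as the difference of the integrals
   of its positive and negative parts (e2ennreal maps negative numbers to 0). For functions
   bounded above the first integral is finite and the value lies in [-infinity, infinity). *)
definition integral01 :: "(real \<Rightarrow> ereal) \<Rightarrow> ereal" where
  "integral01 f =
     enn2ereal (\<integral>\<^sup>+x\<in>{0..1}. e2ennreal (f x) \<partial>lborel)
   - enn2ereal (\<integral>\<^sup>+x\<in>{0..1}. e2ennreal (- f x) \<partial>lborel)"

(* L_k(alpha, A) = L. Stated as convergence rather than through lim, so that no arbitrary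
   value of lim at a divergent sequence is involved. *)
definition has_lyapunov_exponent ::
    "nat \<Rightarrow> real \<Rightarrow> (real \<Rightarrow> complex mat) \<Rightarrow> nat \<Rightarrow> ereal \<Rightarrow> bool" where
  "has_lyapunov_exponent d \<alpha> A k L \<longleftrightarrow>
     (\<lambda>n. ereal (1 / real n) * integral01 (\<lambda>x. eln (singular_value k (cocycle_iter d \<alpha> A n x))))
       \<longlonglongrightarrow> L"

definition simple_lyapunov_spectrum :: "nat \<Rightarrow> real \<Rightarrow> (real \<Rightarrow> complex mat) \<Rightarrow> bool" where
  "simple_lyapunov_spectrum d \<alpha> A \<longleftrightarrow>
     (\<exists>L. (\<forall>k\<in>{1..d}. has_lyapunov_exponent d \<alpha> A k (L k)) \<and> inj_on L {1..d})"

(* P extends to a one-periodic holomorphic function on the strip |Im z| < \<delta> whose entries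
   are bounded by \<eta> there. For fixed \<delta>, letting \<eta> tend to 0 gives convergence to 0 in the
   inductive limit topology on the real analytic functions on the circle. *)
definition small_on_strip :: "nat \<Rightarrow> real \<Rightarrow> real \<Rightarrow> (real \<Rightarrow> complex mat) \<Rightarrow> bool" where
  "small_on_strip d \<delta> \<eta> P \<longleftrightarrow>
     (\<exists>F :: complex \<Rightarrow> complex mat.
        (\<forall>x. F (of_real x) = P x) \<and>
        (\<forall>z. \<bar>Im z\<bar> < \<delta> \<longrightarrow> F z \<in> carrier_mat d d \<and> F (z + 1) = F z) \<and>
        (\<forall>i<d. \<forall>j<d. (\<lambda>z. F z $$ (i, j)) holomorphic_on {z. \<bar>Im z\<bar> < \<delta>}) \<and>
        (\<forall>z. \<bar>Im z\<bar> < \<delta> \<longrightarrow> (\<forall>i<d. \<forall>j<d. norm (F z $$ (i, j)) < \<eta>)))"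

end

theory Submission
  imports Defs "HOL-Complex_Analysis.Complex_Analysis"
begin

text \<open>
  One-periodic real analytic functions form an integral domain \<open>R\<close> on which the rotation by
  \<open>\<alpha>\<close> acts as a ring endomorphism \<open>\<sigma>\<close>, and a cocycle is a square matrix \<open>A\<close> over \<open>R\<close>. An
  invertible matrix \<open>U\<close> over \<open>R\<close> is a change of frame and turns \<open>A\<close> into
  \<open>\<sigma>(U\<inverse>) A U\<close>. Both \<open>U\<close> and \<open>U\<inverse>\<close> are bounded, so growth rates do not change. The proof
  brings \<open>A\<close> into a triangular form in which everything can be read off.

  Normal form. Two elements \<open>f\<close>, \<open>g\<close> of \<open>R\<close> have a greatest common divisor of the form
  \<open>f + c g\<close> with a constant \<open>c\<close>, since \<open>-f/g\<close> traces an analytic curve and hence misses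
  almost every point of the plane (\<open>circle_analytic_generic_gcd\<close>). If \<open>A\<close> is singular over
  \<open>R\<close>, a kernel vector divided by the greatest common divisor of its entries therefore becomes
  the first column of an invertible matrix, and in that frame the first column of \<open>A\<close> vanishes.
  Repeating this on the remaining block leaves a strictly upper triangular block, followed by a
  block \<open>B\<close> whose determinant is not the zero function (\<open>cocycle_block_triangularization\<close>).

  If \<open>B\<close> is not empty, it expands vectors at least by a constant multiple of \<open>|det B|\<close>, whose
  logarithm is integrable because analytic functions have zeros of finite order only. Summing
  along the orbit bounds the integral of \<open>ln \<sigma>\<^sub>1(A\<^sub>n)\<close> below by a multiple of \<open>-n\<close>, so
  \<open>L\<^sub>1\<close> is finite (\<open>top_exponent_finite_if_rank_survives\<close>).

  Hence \<open>L\<^sub>1 = -\<infinity>\<close> forces \<open>A = \<sigma>(U) N U\<inverse>\<close> with \<open>N\<close> strictly upper triangular. Then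
  \<open>A\<^sub>n = 0\<close> for \<open>n \<ge> d\<close>, which settles all exponents of \<open>A\<close>. The perturbation is
  \<open>A' = \<sigma>(U) diag(d, \<dots>, 1) U\<inverse>\<close>: in the frame \<open>U\<close>, the cocycle \<open>A + \<epsilon> A'\<close> is upper triangular
  with constant diagonal \<open>\<epsilon> d, \<dots>, \<epsilon>\<close>. Rescaling the basis vectors makes the part above the
  diagonal negligible, so the span of the first \<open>k\<close> of them is expanded at a rate arbitrarily
  close to \<open>|\<epsilon>| (d + 1 - k)\<close>. By the minimax principle this bounds \<open>\<sigma>\<^sub>k\<close> from below, and since
  the product of all singular values is the modulus of the determinant, the lower bounds leave no
  room: \<open>L\<^sub>k = ln (|\<epsilon>| (d + 1 - k))\<close> (\<open>has_exponents_of_diagonal\<close>).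
\<close>

section \<open>Unitary diagonalization of Hermitian matrices\<close>

(* the dollar sign and det refer to the vectors and matrices of Jordan_Normal_Form *)
unbundle no vec_syntax
hide_const (open) Determinants.det
no_notation fps_nth (infixl "$" 75)

lemma index_mat_adjoint:
  assumes "i < dim_col A" "j < dim_row A"
  shows "mat_adjoint A $$ (i, j) = conjugate (A $$ (j, i))"
  using assms by (simp add: mat_adjoint_def mat_of_rows_index)

lemma mat_adjoint_carrier [intro, simp]:
  "A \<in> carrier_mat m n \<Longrightarrow> mat_adjoint A \<in> carrier_mat n m"
  by (auto simp: mat_adjoint_def)

lemma dim_mat_adjoint [simp]:
  "dim_row (mat_adjoint A) = dim_col A" "dim_col (mat_adjoint A) = dim_row A"
  by (auto simp: mat_adjoint_def)

lemma mat_adjoint_mult: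
  fixes A B :: "complex mat"
  assumes "A \<in> carrier_mat m n" "B \<in> carrier_mat n k"
  shows "mat_adjoint (A * B) = mat_adjoint B * mat_adjoint A"
  using assms
  by (intro eq_matI) (auto simp: index_mat_adjoint scalar_prod_def mult.commute)

lemma mat_adjoint_mat_adjoint [simp]: "mat_adjoint (mat_adjoint A) = (A :: complex mat)"
  by (intro eq_matI) (auto simp: index_mat_adjoint)

lemma index_gram_matrix:
  assumes "A \<in> carrier_mat m n" "i < n" "j < n"
  shows "(mat_adjoint A * A) $$ (i, j) = (\<Sum>k<m. cnj (A $$ (k, i)) * A $$ (k, j))"
  using assms
  by (simp add: scalar_prod_def index_mat_adjoint lessThan_atLeast0)

definition sq_length :: "complex vec \<Rightarrow> real" where
  "sq_length v = (\<Sum>i<dim_vec v. (cmod (v $ i))\<^sup>2)"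

lemma sq_length_nonneg: "sq_length v \<ge> 0"
  by (simp add: sq_length_def sum_nonneg)

lemma sq_length_mult_mat_vec:
  assumes A: "A \<in> carrier_mat m n" and b: "b \<in> carrier_vec n"
  shows "of_real (sq_length (A *\<^sub>v b)) =
    (\<Sum>i<n. \<Sum>j<n. cnj (b $ i) * (mat_adjoint A * A) $$ (i, j) * b $ j)"
proof -
  have "of_real (sq_length (A *\<^sub>v b)) = (\<Sum>k<m. cnj ((A *\<^sub>v b) $ k) * (A *\<^sub>v b) $ k)"
    using A by (simp add: sq_length_def complex_norm_square mult.commute flip: of_real_power)
  also have "\<dots> = (\<Sum>k<m. \<Sum>i<n. \<Sum>j<n. cnj (b $ i) * (cnj (A $$ (k, i)) * A $$ (k, j)) * b $ j)"
    using A b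
    by (intro sum.cong refl)
       (simp add: scalar_prod_def lessThan_atLeast0, subst sum_product, simp add: mult_ac)
  also have "\<dots> = (\<Sum>i<n. \<Sum>j<n. \<Sum>k<m. cnj (b $ i) * (cnj (A $$ (k, i)) * A $$ (k, j)) * b $ j)"
    by (subst sum.swap) (intro sum.cong refl sum.swap)
  also have "\<dots> = (\<Sum>i<n. \<Sum>j<n. cnj (b $ i) * (mat_adjoint A * A) $$ (i, j) * b $ j)"
    using A by (intro sum.cong refl) (simp add: index_gram_matrix sum_distrib_left sum_distrib_right del: index_mult_mat)
  finally show ?thesis .
qed

definition diagonal_of :: "'a::zero list \<Rightarrow> 'a mat" where
  "diagonal_of es = mat (length es) (length es) (\<lambda>(i, j). if i = j then es ! i else 0)"

lemma diagonal_of_Cons: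
  "diagonal_of (e # es) =
     four_block_mat (mat 1 1 (\<lambda>_. e)) (0\<^sub>m 1 (length es)) (0\<^sub>m (length es) 1) (diagonal_of es)"
  by (intro eq_matI) (auto simp: diagonal_of_def nth_Cons')

lemma block_diagonal_mult:
  fixes A B C D :: "'a :: semiring_1 mat"
  assumes A: "A \<in> carrier_mat k k" "B \<in> carrier_mat k k"
    and C: "C \<in> carrier_mat n n" "D \<in> carrier_mat n n"
  shows "four_block_mat A (0\<^sub>m k n) (0\<^sub>m n k) C * four_block_mat B (0\<^sub>m k n) (0\<^sub>m n k) D =
    four_block_mat (A * B) (0\<^sub>m k n) (0\<^sub>m n k) (C * D)"
proof -
  have "A * B \<in> carrier_mat k k" "C * D \<in> carrier_mat n n"
    using A C mult_carrier_mat by blast+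
  then show ?thesis
    using A C
    by (subst mult_four_block_mat[OF A(1) _ _ C(1) A(2) _ _ C(2)]) 
       (simp_all add: right_add_zero_mat[of _ k k] left_add_zero_mat[of _ n n] 
          left_mult_zero_mat[of _ k n] left_mult_zero_mat[of _ n k] right_mult_zero_mat[of _ n n] right_mult_zero_mat[of _ k k])
qed

lemma complete_to_unitary:
  fixes v :: "complex vec"
  assumes v: "v \<in> carrier_vec n" "v \<noteq> 0\<^sub>v n"
  obtains W c where "W \<in> carrier_mat n n" "mat_adjoint W * W = 1\<^sub>m n" "col W 0 = c \<cdot>\<^sub>v v"
proof -
  interpret cof_vec_space n "TYPE(complex)" .
  from v have n0: "n > 0" by (cases n) auto
  define b where "b = basis_completion v"
  define ws where "ws = gram_schmidt n b"
  from basis_completion[OF v, folded b_def]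
  have span_b: "span (set b) = carrier_vec n" and dist_b: "distinct b"
    and indep: "\<not> lin_dep (set b)" and b: "set b \<subseteq> carrier_vec n" and hdb: "hd b = v"
    and len_b: "length b = n" by auto
  from hdb len_b n0 obtain vs where bv: "b = v # vs" by (cases b) auto
  from gram_schmidt_result[OF b dist_b indep refl, folded ws_def]
  have ws: "set ws \<subseteq> carrier_vec n" "corthogonal ws" "length ws = n"
    by (auto simp: len_b)
  have "hd ws = v" using gram_schmidt_hd[OF v(1), of vs] unfolding ws_def bv .
  then have ws0: "ws ! 0 = v" using ws(3) n0 by (cases ws) auto
  define N where "N j = complex_of_real (sqrt (sq_length (ws ! j)))" for j
  have dimw: "ws ! j \<in> carrier_vec n" if "j < n" for j
    using ws that by (auto simp: set_conv_nth)
  have inner: "ws ! j \<bullet>c ws ! i = (\<Sum>k<n. cnj (ws ! i $ k) * ws ! j $ k)" if "i < n" "j < n" for i j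
    using dimw[OF that(1)] dimw[OF that(2)]
    by (simp add: scalar_prod_def lessThan_atLeast0 mult.commute)
  have N2: "N j * N j = (\<Sum>k<n. cnj (ws ! j $ k) * ws ! j $ k)" if "j < n" for j
    using dimw[OF that] sq_length_nonneg[of "ws ! j"] unfolding N_def
    by (simp flip: of_real_mult) (simp add: sq_length_def complex_norm_square mult.commute flip: of_real_power)
  have N0: "N j \<noteq> 0" if "j < n" for j
    using N2[OF that] inner[OF that that] corthogonalD[OF ws(2), of j j] that ws(3) by auto
  have cnjN: "cnj (N j) = N j" for j by (simp add: N_def)
  define W where "W = mat n n (\<lambda>(i, j). ws ! j $ i / N j)"
  have "W \<in> carrier_mat n n" by (simp add: W_def)
  moreover have "mat_adjoint W * W = 1\<^sub>m n"
  proof (intro eq_matI)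
    fix i j assume "i < dim_row (1\<^sub>m n :: complex mat)" "j < dim_col (1\<^sub>m n :: complex mat)"
    then have ij: "i < n" "j < n" by auto
    have "(mat_adjoint W * W) $$ (i, j) = (\<Sum>k<n. cnj (ws ! i $ k) * ws ! j $ k) / (N i * N j)"
      using ij \<open>W \<in> carrier_mat n n\<close> 
      by (subst index_gram_matrix[where m=n and n=n]) (auto simp: W_def cnjN sum_divide_distrib)
    also have "\<dots> = (if i = j then 1 else 0)"
    proof (cases "i = j")
      case True
      then show ?thesis using N0[OF ij(1)] by (simp add: N2[OF ij(2), symmetric])
    next
      case False
      then show ?thesis using inner[OF ij] corthogonalD[OF ws(2), of j i] ij ws(3) by auto
    qed
    finally show "(mat_adjoint W * W) $$ (i, j) = 1\<^sub>m n $$ (i, j)" using ij by simp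
  qed (auto simp: W_def)
  moreover have "col W 0 = (1 / N 0) \<cdot>\<^sub>v v"
    using n0 v by (intro eq_vecI) (auto simp: W_def ws0)
  ultimately show ?thesis using that by blast
qed

lemma mult_mat_assoc4:
  fixes A B C D :: "'a :: semiring_1 mat"
  assumes "A \<in> carrier_mat n n" "B \<in> carrier_mat n n" "C \<in> carrier_mat n n" "D \<in> carrier_mat n n"
  shows "(A * B) * (C * D) = A * (B * C) * D"
  using assoc_mult_mat[OF mult_carrier_mat[OF assms(1,2)] assms(3,4)] assoc_mult_mat[OF assms(1-3)]
  by simp

lemma mult_mat_assoc5:
  fixes A B C D E :: "'a :: semiring_1 mat"
  assumes "A \<in> carrier_mat n n" "B \<in> carrier_mat n n" "C \<in> carrier_mat n n" "D \<in> carrier_mat n n"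
    "E \<in> carrier_mat n n"
  shows "(A * B) * C * (D * E) = A * (B * C * D) * E"
  using assoc_mult_mat[OF mult_carrier_mat[OF mult_carrier_mat[OF assms(1,2)] assms(3)] assms(4,5)]
    assoc_mult_mat[OF assms(1-3)]
    assoc_mult_mat[OF assms(1) mult_carrier_mat[OF assms(2,3)] assms(4)]
  by simp

lemma adjoint_conjugation_mult:
  fixes W F H :: "complex mat"
  assumes W: "W \<in> carrier_mat n n" and F: "F \<in> carrier_mat n n" and H: "H \<in> carrier_mat n n"
  shows "mat_adjoint (W * F) * H * (W * F) = mat_adjoint F * (mat_adjoint W * H * W) * F"
  unfolding mat_adjoint_mult[OF W F]
  by (rule mult_mat_assoc5[OF mat_adjoint_carrier[OF F] mat_adjoint_carrier[OF W] H W F])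

lemma hermitian_conjugation:
  fixes W H :: "complex mat"
  assumes W: "W \<in> carrier_mat n n" and H: "H \<in> carrier_mat n n" "mat_adjoint H = H"
  shows "mat_adjoint (mat_adjoint W * H * W) = mat_adjoint W * H * W"
proof -
  note W' = mat_adjoint_carrier[OF W]
  show ?thesis
    unfolding mat_adjoint_mult[OF mult_carrier_mat[OF W' H(1)] W] mat_adjoint_mult[OF W' H(1)]
    by (simp add: H(2) assoc_mult_mat[OF W' H(1) W])
qed

text \<open>
  The order of the eigenvalues in the list is respected; this matters when they are to appear in
  decreasing order. A unit eigenvector is completed to a unitary matrix; by symmetry, the first
  row and the first column of the conjugated matrix vanish off the diagonal, and the induction
  hypothesis applies to the remaining block.
\<close>

lemma hermitian_unitary_diagonalization:
  fixes H :: "complex mat"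
  assumes "H \<in> carrier_mat n n" "mat_adjoint H = H" "char_poly H = (\<Prod>e\<leftarrow>es. [:- e, 1:])"
  shows "\<exists>P \<in> carrier_mat n n. mat_adjoint P * P = 1\<^sub>m n \<and> mat_adjoint P * H * P = diagonal_of es"
  using assms
proof (induction es arbitrary: n H)
  case Nil
  then have "n = 0" using degree_monic_char_poly[of H n] by auto
  then show ?case
    using Nil by (intro bexI[of _ "1\<^sub>m 0"] conjI eq_matI) (auto simp: diagonal_of_def)
next
  case (Cons e es)
  note H = Cons.prems(1)
  let ?cp = "char_poly H"
  have cp: "?cp = [:- e, 1:] * (\<Prod>e\<leftarrow>es. [:- e, 1:])" using Cons.prems by simp
  have "degree ?cp = Suc (degree (\<Prod>e\<leftarrow>es. [:- e, 1:]))"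
    unfolding cp by (subst degree_mult_eq) (use monic_prod_list[of "map (\<lambda>e. [:- e, 1:]) es"] in auto)
  with degree_monic_char_poly[OF H] obtain n1 where n: "n = Suc n1" by (cases n) auto
  have "eigenvalue H e"
    unfolding eigenvalue_root_char_poly[OF H] cp by simp
  from find_eigenvector[OF H this] obtain v where v: "eigenvector H v e" by blast
  then have vc: "v \<in> carrier_vec n" "v \<noteq> 0\<^sub>v n" and Hv: "H *\<^sub>v v = e \<cdot>\<^sub>v v"
    using H unfolding eigenvector_def by auto
  obtain W c where W: "W \<in> carrier_mat n n" and WW: "mat_adjoint W * W = 1\<^sub>m n"
    and W0: "col W 0 = c \<cdot>\<^sub>v v"
    using complete_to_unitary[OF vc] .
  let ?W' = "mat_adjoint W"
  have W': "?W' \<in> carrier_mat n n" using W by simp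
  have WW2: "W * ?W' = 1\<^sub>m n" using mat_mult_left_right_inverse[OF W' W WW] .
  define K where "K = ?W' * H * W"
  have K: "K \<in> carrier_mat n n" unfolding K_def by (rule mult_carrier_mat[OF mult_carrier_mat[OF W' H] W])
  have Kh: "mat_adjoint K = K"
    unfolding K_def using hermitian_conjugation[OF W H Cons.prems(2)] .
  have HW0: "H *\<^sub>v col W 0 = e \<cdot>\<^sub>v col W 0"
    using H vc Hv unfolding W0 by (simp add: mult_mat_vec[of _ n n] smult_smult_assoc mult.commute)
  have "col K 0 = (?W' * H) *\<^sub>v col W 0" unfolding K_def
    using W W' H n by (intro col_mult2[of _ n n _ n]) auto
  also have "\<dots> = ?W' *\<^sub>v (H *\<^sub>v col W 0)"
    using W W' H n by (intro assoc_mult_mat_vec[of _ n n _ n]) (auto simp: col_def)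
  also have "\<dots> = e \<cdot>\<^sub>v (?W' *\<^sub>v col W 0)"
    unfolding HW0 using W W' by (intro mult_mat_vec) auto
  also have "?W' *\<^sub>v col W 0 = col (?W' * W) 0"
    using W W' n by (intro col_mult2[of _ n n _ n, symmetric]) auto
  finally have colK: "col K 0 = e \<cdot>\<^sub>v unit_vec n 0" using WW n by simp
  have K0: "K $$ (i, 0) = (if i = 0 then e else 0)" if "i < n" for i
  proof -
    have "K $$ (i, 0) = col K 0 $ i" using K that by auto
    then show ?thesis using that unfolding colK by (auto simp: unit_vec_def)
  qed
  have K0': "K $$ (0, i) = 0" if "i < n" "i \<noteq> 0" for i
  proof -
    have "K $$ (0, i) = mat_adjoint K $$ (0, i)" by (simp add: Kh)
    also have "\<dots> = conjugate (K $$ (i, 0))" using K that by (subst index_mat_adjoint) auto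
    finally show ?thesis using K0 that by simp
  qed
  define L where "L = mat n1 n1 (\<lambda>(i, j). K $$ (Suc i, Suc j))"
  have L: "L \<in> carrier_mat n1 n1" by (simp add: L_def)
  have Kblock: "K = four_block_mat (mat 1 1 (\<lambda>_. e)) (0\<^sub>m 1 n1) (0\<^sub>m n1 1) L"
    using K by (intro eq_matI) (auto simp: L_def n K0 K0')
  have Lh: "mat_adjoint L = L"
  proof (intro eq_matI)
    fix i j assume "i < dim_row L" "j < dim_col L"
    then have ij: "i < n1" "j < n1" using L by auto
    have "conjugate (K $$ (Suc j, Suc i)) = mat_adjoint K $$ (Suc i, Suc j)"
      using K ij n by (subst index_mat_adjoint) auto
    then show "mat_adjoint L $$ (i, j) = L $$ (i, j)"
      using ij L by (subst index_mat_adjoint) (auto simp: L_def Kh)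
  qed (use L in auto)
  have "similar_mat K H"
    unfolding similar_mat_def similar_mat_wit_def
    using K H W W' WW WW2 by (intro exI[of _ ?W'] exI[of _ W]) (auto simp: K_def Let_def)
  then have "?cp = char_poly K" using char_poly_similar by metis
  also have "\<dots> = char_poly (mat 1 1 (\<lambda>_. e)) * char_poly L"
    unfolding Kblock by (rule char_poly_four_block_zeros_col[OF _ _ L]) auto
  also have "char_poly (mat 1 1 (\<lambda>_. e)) = [:- e, 1:]"
    by (simp add: char_poly_defs det_def sign_def)
  finally have "char_poly L = (\<Prod>e\<leftarrow>es. [:- e, 1:])"
    unfolding cp by (metis mult_cancel_left pCons_eq_0_iff zero_neq_one)
  from Cons.IH[OF L Lh this] obtain P3 where P3: "P3 \<in> carrier_mat n1 n1"
    "mat_adjoint P3 * P3 = 1\<^sub>m n1" "mat_adjoint P3 * L * P3 = diagonal_of es" by blast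
  then have les: "length es = n1" by (auto simp: diagonal_of_def dest!: arg_cong[where f = dim_row])
  define F where "F = four_block_mat (1\<^sub>m 1) (0\<^sub>m 1 n1) (0\<^sub>m n1 1) P3"
  have F: "F \<in> carrier_mat n n" using P3 by (auto simp: F_def n)
  have F': "mat_adjoint F = four_block_mat (1\<^sub>m 1) (0\<^sub>m 1 n1) (0\<^sub>m n1 1) (mat_adjoint P3)"
    using P3 F by (intro eq_matI) (auto simp: index_mat_adjoint F_def n)
  have P3': "mat_adjoint P3 \<in> carrier_mat n1 n1" using P3 by simp
  have "mat_adjoint F * F = four_block_mat (1\<^sub>m 1 * 1\<^sub>m 1) (0\<^sub>m 1 n1) (0\<^sub>m n1 1) (1\<^sub>m n1)"
    unfolding F' unfolding F_def using P3(2) block_diagonal_mult[OF _ _ P3' P3(1), of "1\<^sub>m 1" 1 "1\<^sub>m 1"] by simp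
  also have "\<dots> = 1\<^sub>m n" by (simp add: n)
  finally have FF: "mat_adjoint F * F = 1\<^sub>m n" .
  have PL: "mat_adjoint P3 * L \<in> carrier_mat n1 n1" by (rule mult_carrier_mat[OF P3' L])
  let ?e = "mat 1 1 (\<lambda>_. e)"
  have "mat_adjoint F * K * F = four_block_mat (1\<^sub>m 1 * ?e) (0\<^sub>m 1 n1) (0\<^sub>m n1 1) (mat_adjoint P3 * L) * F"
    unfolding F' Kblock using P3' L by (subst block_diagonal_mult[of _ 1]) auto
  also have "\<dots> = four_block_mat (1\<^sub>m 1 * ?e * 1\<^sub>m 1) (0\<^sub>m 1 n1) (0\<^sub>m n1 1) (mat_adjoint P3 * L * P3)"
    unfolding F_def using P3 PL by (subst block_diagonal_mult[of _ 1]) auto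
  also have "\<dots> = diagonal_of (e # es)"
    using P3(3) by (simp add: diagonal_of_Cons les left_mult_one_mat[of _ 1 1] right_mult_one_mat[of _ 1 1])
  finally have "mat_adjoint F * K * F = diagonal_of (e # es)" .
  moreover have "mat_adjoint (W * F) * H * (W * F) = mat_adjoint F * K * F"
    unfolding K_def by (rule adjoint_conjugation_mult[OF W F H])
  moreover have "mat_adjoint (W * F) * (W * F) = 1\<^sub>m n"
    using adjoint_conjugation_mult[OF W F one_carrier_mat] W F W' WW FF
    by (simp add: mult_carrier_mat[of _ n n] right_mult_one_mat[of _ n n])
  ultimately show ?case using W F by (intro bexI[of _ "W * F"]) auto
qed

section \<open>Singular values\<close>
lemma index_mult_mat_vec_sum:
  assumes "A \<in> carrier_mat n m" "v \<in> carrier_vec m" "i < n"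
  shows "(A *\<^sub>v v) $ i = (\<Sum>j<m. A $$ (i, j) * v $ j)"
  using assms by (simp add: scalar_prod_def lessThan_atLeast0)

lemma index_mult_mat_sum:
  assumes "A \<in> carrier_mat n m" "B \<in> carrier_mat m k" "i < n" "j < k"
  shows "(A * B) $$ (i, j) = (\<Sum>l<m. A $$ (i, l) * B $$ (l, j))"
  using assms by (simp add: scalar_prod_def lessThan_atLeast0)

text \<open>
  The columns of \<open>P\<close> are orthonormal right singular vectors, in the order of the singular values.
\<close>

definition right_singular_basis :: "nat \<Rightarrow> complex mat \<Rightarrow> complex mat \<Rightarrow> bool" where
  "right_singular_basis d M P \<longleftrightarrow> P \<in> carrier_mat d d \<and> mat_adjoint P * P = 1\<^sub>m d \<and>
     mat_adjoint P * (mat_adjoint M * M) * P =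
       diagonal_of (map (\<lambda>s. of_real (s\<^sup>2)) (singular_values M))"

lemma singular_values_nonneg_decreasing_basis:
  assumes M: "M \<in> carrier_mat d d"
  shows "length (singular_values M) = d"
    and "sorted_wrt (\<ge>) (singular_values M)"
    and "\<forall>s \<in> set (singular_values M). s \<ge> 0"
    and "\<exists>P. right_singular_basis d M P"
proof -
  let ?H = "mat_adjoint M * M"
  have H: "?H \<in> carrier_mat d d" using mult_carrier_mat[OF mat_adjoint_carrier[OF M] M] .
  have Hh: "mat_adjoint ?H = ?H" using M by (simp add: mat_adjoint_mult[of _ d d])
  obtain es where es: "char_poly ?H = (\<Prod>e\<leftarrow>es. [:- e, 1:])" "length es = d"
    using char_poly_factorized[OF H] by blast
  have "proots (\<Prod>p\<leftarrow>map (\<lambda>e. [:- e, 1:]) es. p) = sum_list (map proots (map (\<lambda>e. [:- e, 1:]) es))"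
    by (intro proots_prod_list) auto
  also have "\<dots> = mset es" by (induction es) auto
  finally have roots: "proots (char_poly ?H) = mset es" unfolding es by simp
  \<comment> \<open>Diagonalizing with the eigenvalues in any order shows that they are real and nonnegative; only
      then can they be sorted and the diagonalization be repeated in that order.\<close>
  obtain P where P: "P \<in> carrier_mat d d" "mat_adjoint P * ?H * P = diagonal_of es"
    using hermitian_unitary_diagonalization[OF H Hh es(1)] by blast
  have real_eigenvalue: "e = of_real (Re e) \<and> Re e \<ge> 0" if "e \<in> set es" for e
  proof -
    from that obtain i where i: "i < d" "e = es ! i" using es by (auto simp: set_conv_nth)
    have MP: "M * P \<in> carrier_mat d d" using mult_carrier_mat[OF M P(1)] .
    have "mat_adjoint (M * P) * (M * P) = mat_adjoint P * ?H * P"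
      using adjoint_conjugation_mult[OF M P(1) one_carrier_mat] M P by (simp add: MP right_mult_one_mat[of _ d d])
    then have "e = (mat_adjoint (M * P) * (M * P)) $$ (i, i)"
      using P i es by (simp add: diagonal_of_def)
    also have "\<dots> = (\<Sum>k<d. of_real ((cmod ((M * P) $$ (k, i)))\<^sup>2))"
      using MP i by (subst index_gram_matrix[OF MP]) (auto simp: complex_norm_square mult.commute intro!: sum.cong simp flip: of_real_power)
    finally have "e = of_real (\<Sum>k<d. (cmod ((M * P) $$ (k, i)))\<^sup>2)" by simp
    then show ?thesis by (simp add: sum_nonneg)
  qed
  define rs where "rs = map (\<lambda>z. sqrt (Re z)) es"
  have sv: "singular_values M = rev (sort rs)"
    unfolding singular_values_def roots rs_def by (simp flip: mset_map)
  show "length (singular_values M) = d" by (simp add: sv rs_def es)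
  show "sorted_wrt (\<ge>) (singular_values M)"
    unfolding sv sorted_wrt_rev by simp
  show "\<forall>s \<in> set (singular_values M). s \<ge> 0"
    using real_eigenvalue by (auto simp: sv rs_def)
  let ?es = "map (\<lambda>s. complex_of_real (s\<^sup>2)) (singular_values M)"
  have "mset ?es = image_mset (\<lambda>s. complex_of_real (s\<^sup>2)) (mset rs)" by (simp add: sv)
  also have "\<dots> = image_mset (\<lambda>z. z) (mset es)"
    unfolding rs_def mset_map multiset.map_comp o_def
    using real_eigenvalue by (intro image_mset_cong) (auto simp: simp flip: of_real_power)
  finally have "mset ?es = mset es" by simp
  then have same: "mset es' = mset es" if "es' = ?es" for es' using that by blast
  have "prod_mset (image_mset (\<lambda>e. [:- e, 1:]) (mset es')) = (\<Prod>e\<leftarrow>es'. [:- e, 1:])" for es' :: "complex list"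
    by (simp flip: mset_map add: prod_mset_prod_list)
  then have "(\<Prod>e\<leftarrow>es'. [:- e, 1:]) = (\<Prod>e\<leftarrow>es. [:- e, 1:])" if "es' = ?es" for es'
    using same[OF that] by metis
  then have "char_poly ?H = (\<Prod>e\<leftarrow>?es. [:- e, 1:])" using es by simp
  from hermitian_unitary_diagonalization[OF H Hh this]
  show "\<exists>P. right_singular_basis d M P" unfolding right_singular_basis_def by blast
qed

lemma singular_value_nonneg:
  assumes "M \<in> carrier_mat d d" "1 \<le> k" "k \<le> d"
  shows "singular_value k M \<ge> 0"
  using singular_values_nonneg_decreasing_basis[OF assms(1)] assms
  by (auto simp: singular_value_def)

lemma singular_value_antimono:
  assumes "M \<in> carrier_mat d d" "1 \<le> k" "k \<le> l" "l \<le> d"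
  shows "singular_value l M \<le> singular_value k M"
  using singular_values_nonneg_decreasing_basis(1,2)[OF assms(1)] assms
  by (cases "k = l") (auto simp: singular_value_def sorted_wrt_iff_nth_less)

definition norm1 :: "complex vec \<Rightarrow> real" where
  "norm1 v = (\<Sum>i<dim_vec v. cmod (v $ i))"

lemma norm1_nonneg: "norm1 v \<ge> 0"
  by (simp add: norm1_def sum_nonneg)

lemma norm1_pos:
  assumes "v \<in> carrier_vec n" "v \<noteq> 0\<^sub>v n"
  shows "norm1 v > 0"
proof -
  obtain i where "i < n" "v $ i \<noteq> 0" using assms by (metis carrier_vecD eq_vecI index_zero_vec)
  then show ?thesis unfolding norm1_def using assms
    by (intro sum_pos2[where i = i]) auto
qed

lemma norm1_le_sqrt_sq_length: "norm1 v \<le> real (dim_vec v) * sqrt (sq_length v)"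
proof -
  have "norm1 v \<le> real (card {..<dim_vec v}) * sqrt (sq_length v)"
    unfolding norm1_def
  proof (rule sum_bounded_above)
    fix i assume "i \<in> {..<dim_vec v}"
    then have "(cmod (v $ i))\<^sup>2 \<le> sq_length v"
      unfolding sq_length_def by (intro member_le_sum) auto
    then show "cmod (v $ i) \<le> sqrt (sq_length v)" by (rule real_le_rsqrt)
  qed
  then show ?thesis by simp
qed

lemma sqrt_sq_length_le_norm1: "sqrt (sq_length v) \<le> norm1 v"
  using L2_set_le_sum[of "{..<dim_vec v}" "\<lambda>i. cmod (v $ i)"]
  by (simp add: L2_set_def sq_length_def norm1_def)

text \<open>
  One half of the minimax principle: on the orthogonal complement of the first \<open>k - 1\<close> right
  singular vectors, the matrix stretches by at most \<open>\<sigma>\<^sub>k\<close>.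
\<close>

lemma sq_length_mult_le_singular_value:
  assumes M: "M \<in> carrier_mat d d" and k: "1 \<le> k" "k \<le> d"
    and basis: "right_singular_basis d M P"
    and v: "v \<in> carrier_vec d" "\<And>i. i < k - 1 \<Longrightarrow> (mat_adjoint P *\<^sub>v v) $ i = 0"
  shows "sqrt (sq_length (M *\<^sub>v v)) \<le> singular_value k M * sqrt (sq_length v)"
proof -
  note P = basis[unfolded right_singular_basis_def, THEN conjunct1]
    basis[unfolded right_singular_basis_def, THEN conjunct2, THEN conjunct1]
    basis[unfolded right_singular_basis_def, THEN conjunct2, THEN conjunct2]
  define b where "b = mat_adjoint P *\<^sub>v v"
  define s where "s i = singular_values M ! i" for i
  have P': "mat_adjoint P \<in> carrier_mat d d" using P by simp
  have len: "length (singular_values M) = d" using singular_values_nonneg_decreasing_basis[OF M] by simp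
  have b: "b \<in> carrier_vec d" using P' v by (auto simp: b_def)
  have MP: "M * P \<in> carrier_mat d d" using mult_carrier_mat[OF M P(1)] .
  have MPMP: "mat_adjoint (M * P) * (M * P) = mat_adjoint P * (mat_adjoint M * M) * P"
    using adjoint_conjugation_mult[OF M P(1) one_carrier_mat] M P by (simp add: MP right_mult_one_mat[of _ d d])
  have "P * mat_adjoint P = 1\<^sub>m d" using mat_mult_left_right_inverse[OF P' P(1,2)] .
  then have Pb: "P *\<^sub>v b = v"
    unfolding b_def using assoc_mult_mat_vec[OF P(1) P' v(1)] v by simp
  have MPb: "(M * P) *\<^sub>v b = M *\<^sub>v v" using M P b by (simp add: Pb)
  have "of_real (sq_length v) = (\<Sum>i<d. \<Sum>j<d. cnj (b $ i) * 1\<^sub>m d $$ (i, j) * b $ j)"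
    using sq_length_mult_mat_vec[OF P(1) b] unfolding P(2) Pb .
  also have "\<dots> = (\<Sum>i<d. \<Sum>j<d. if j = i then cnj (b $ i) * b $ j else 0)"
    by (intro sum.cong refl) auto
  also have "\<dots> = (\<Sum>i<d. of_real ((cmod (b $ i))\<^sup>2))"
    by (simp add: sum.delta complex_norm_square mult.commute flip: of_real_power)
  finally have 1: "sq_length v = (\<Sum>i<d. (cmod (b $ i))\<^sup>2)"
    by (simp only: of_real_sum[symmetric] of_real_eq_iff)
  have "of_real (sq_length (M *\<^sub>v v)) =
     (\<Sum>i<d. \<Sum>j<d. cnj (b $ i) * diagonal_of (map (\<lambda>s. of_real (s\<^sup>2)) (singular_values M)) $$ (i, j) * b $ j)"
    using sq_length_mult_mat_vec[OF MP b] unfolding MPMP MPb P(3) .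
  also have "\<dots> = (\<Sum>i<d. \<Sum>j<d. if j = i then of_real ((s i)\<^sup>2) * (cnj (b $ i) * b $ j) else 0)"
    by (intro sum.cong refl) (auto simp: diagonal_of_def len s_def)
  also have "\<dots> = (\<Sum>i<d. of_real ((s i)\<^sup>2 * (cmod (b $ i))\<^sup>2))"
    by (simp add: sum.delta complex_norm_square mult.commute flip: of_real_power)
  finally have 2: "sq_length (M *\<^sub>v v) = (\<Sum>i<d. (s i)\<^sup>2 * (cmod (b $ i))\<^sup>2)"
    by (simp only: of_real_sum[symmetric] of_real_eq_iff)
  have "sq_length (M *\<^sub>v v) \<le> (\<Sum>i<d. (singular_value k M)\<^sup>2 * (cmod (b $ i))\<^sup>2)"
    unfolding 2
  proof (rule sum_mono)
    fix i assume i: "i \<in> {..<d}"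
    show "(s i)\<^sup>2 * (cmod (b $ i))\<^sup>2 \<le> (singular_value k M)\<^sup>2 * (cmod (b $ i))\<^sup>2"
    proof (cases "i < k - 1")
      case True
      then show ?thesis using v(2) by (simp add: b_def)
    next
      case False
      then have "s i \<le> singular_value k M"
        using singular_value_antimono[OF M, of k "Suc i"] k i by (simp add: s_def singular_value_def)
      moreover have "s i \<ge> 0"
        using singular_value_nonneg[OF M, of "Suc i"] i by (simp add: s_def singular_value_def)
      ultimately show ?thesis by (intro mult_right_mono power_mono) auto
    qed
  qed
  also have "\<dots> = (singular_value k M)\<^sup>2 * sq_length v" by (simp add: 1 sum_distrib_left)
  finally have "sqrt (sq_length (M *\<^sub>v v)) \<le> sqrt ((singular_value k M)\<^sup>2 * sq_length v)" by simp
  then show ?thesis using singular_value_nonneg[OF M k] by (simp add: real_sqrt_mult)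
qed

lemma norm1_mult_le_top_singular_value:
  assumes M: "M \<in> carrier_mat d d" and d: "d \<ge> 1" and v: "v \<in> carrier_vec d"
  shows "norm1 (M *\<^sub>v v) \<le> real d * singular_value 1 M * norm1 v"
proof -
  obtain P where P: "right_singular_basis d M P"
    using singular_values_nonneg_decreasing_basis(4)[OF M] by blast
  have "norm1 (M *\<^sub>v v) \<le> real d * sqrt (sq_length (M *\<^sub>v v))"
    using norm1_le_sqrt_sq_length[of "M *\<^sub>v v"] M by simp
  also have "\<dots> \<le> real d * (singular_value 1 M * sqrt (sq_length v))"
    using sq_length_mult_le_singular_value[OF M _ d P v] by (intro mult_left_mono) auto
  also have "\<dots> \<le> real d * (singular_value 1 M * norm1 v)"
    using singular_value_nonneg[OF M _ d] sqrt_sq_length_le_norm1 by (intro mult_left_mono) auto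
  finally show ?thesis by (simp add: mult.assoc)
qed

text \<open>
  The minimax lower bound for a \<open>k\<close>-dimensional space, given as the image under \<open>W\<close> of the
  vectors supported on the first \<open>k\<close> coordinates: it meets the orthogonal complement of the first
  \<open>k - 1\<close> right singular vectors in a nonzero vector. The factor \<open>d\<close> pays for measuring lengths
  in the sum norm, which is easier to estimate along a cocycle than the Euclidean one.
\<close>

lemma singular_value_lower_bound:
  assumes M: "M \<in> carrier_mat d d" and k: "1 \<le> k" "k \<le> d" and W: "W \<in> carrier_mat d d"
    and expand: "\<And>c. c \<in> carrier_vec d \<Longrightarrow> (\<And>i. k \<le> i \<Longrightarrow> i < d \<Longrightarrow> c $ i = 0) \<Longrightarrow>
       s * norm1 c \<le> norm1 (M *\<^sub>v (W *\<^sub>v c))"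
    and bound: "\<And>c. c \<in> carrier_vec d \<Longrightarrow> norm1 (W *\<^sub>v c) \<le> w * norm1 c"
  shows "s \<le> real d * w * singular_value k M"
proof -
  obtain P where basis: "right_singular_basis d M P" and P: "P \<in> carrier_mat d d"
    using singular_values_nonneg_decreasing_basis(4)[OF M] unfolding right_singular_basis_def by blast
  have P': "mat_adjoint P \<in> carrier_mat d d" using P by simp
  have PW: "mat_adjoint P * W \<in> carrier_mat d d" using mult_carrier_mat[OF P' W] .
  \<comment> \<open>The kernel of \<open>G\<close> consists of the \<open>c\<close> that are supported on the first \<open>k\<close> coordinates (rows
      from \<open>k\<close> on) and for which \<open>W c\<close> is orthogonal to the first \<open>k - 1\<close> singular vectors (rows
      below \<open>k - 1\<close>); row \<open>k - 1\<close> is zero, so there is a nonzero one.\<close>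
  define G where "G = mat d d (\<lambda>(i, j). if i < k - 1 then (mat_adjoint P * W) $$ (i, j)
     else if i = j \<and> k \<le> i then 1 else 0)"
  have G: "G \<in> carrier_mat d d" by (simp add: G_def)
  have "det G = (\<Sum>j<d. G $$ (k - 1, j) * cofactor G (k - 1) j)"
    using k by (intro laplace_expansion_row[OF G]) auto
  also have "\<dots> = 0" using k by (intro sum.neutral) (auto simp: G_def)
  finally have "det G = 0" .
  then obtain c where c: "c \<in> carrier_vec d" "c \<noteq> 0\<^sub>v d" "G *\<^sub>v c = 0\<^sub>v d"
    using det_0_iff_vec_prod_zero[OF G] by blast
  have Gc: "(\<Sum>j<d. G $$ (i, j) * c $ j) = 0" if "i < d" for i
  proof -
    have "(\<Sum>j<d. G $$ (i, j) * c $ j) = (G *\<^sub>v c) $ i"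
      using index_mult_mat_vec_sum[OF G c(1) that] by simp
    also have "\<dots> = 0" unfolding c(3) using that by simp
    finally show ?thesis .
  qed
  have supp: "c $ i = 0" if "k \<le> i" "i < d" for i
  proof -
    have "(\<Sum>j<d. G $$ (i, j) * c $ j) = (\<Sum>j<d. if j = i then c $ j else 0)"
      using that by (intro sum.cong refl) (auto simp: G_def)
    then show ?thesis using Gc[of i] that by simp
  qed
  have ortho: "(mat_adjoint P *\<^sub>v (W *\<^sub>v c)) $ i = 0" if "i < k - 1" for i
  proof -
    have "mat_adjoint P *\<^sub>v (W *\<^sub>v c) = (mat_adjoint P * W) *\<^sub>v c"
      using assoc_mult_mat_vec[OF P' W c(1)] by simp
    then have "(mat_adjoint P *\<^sub>v (W *\<^sub>v c)) $ i = (\<Sum>j<d. (mat_adjoint P * W) $$ (i, j) * c $ j)"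
      using index_mult_mat_vec_sum[OF PW c(1), of i] that k by simp
    also have "\<dots> = (\<Sum>j<d. G $$ (i, j) * c $ j)"
      using that k by (intro sum.cong refl) (auto simp: G_def)
    finally show ?thesis using Gc[of i] that k by simp
  qed
  have Wc: "W *\<^sub>v c \<in> carrier_vec d" using W c by auto
  have s0: "singular_value k M \<ge> 0" using singular_value_nonneg[OF M k] .
  have "s * norm1 c \<le> norm1 (M *\<^sub>v (W *\<^sub>v c))" using expand c supp by blast
  also have "\<dots> \<le> real d * sqrt (sq_length (M *\<^sub>v (W *\<^sub>v c)))"
    using norm1_le_sqrt_sq_length[of "M *\<^sub>v (W *\<^sub>v c)"] M by simp
  also have "\<dots> \<le> real d * (singular_value k M * sqrt (sq_length (W *\<^sub>v c)))"
    using sq_length_mult_le_singular_value[OF M k basis Wc ortho] by (intro mult_left_mono) auto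
  also have "\<dots> \<le> real d * (singular_value k M * (w * norm1 c))"
    using s0 order_trans[OF sqrt_sq_length_le_norm1 bound[OF c(1)]] by (intro mult_left_mono) auto
  finally have "s * norm1 c \<le> (real d * w * singular_value k M) * norm1 c" by (simp add: mult_ac)
  then show ?thesis using norm1_pos[OF c(1,2)] by simp
qed

lemma det_mat_adjoint:
  fixes M :: "complex mat"
  assumes "M \<in> carrier_mat d d"
  shows "det (mat_adjoint M) = cnj (det M)"
proof -
  interpret cnj: comm_ring_hom cnj by unfold_locales auto
  have "mat_adjoint M = transpose_mat (map_mat cnj M)"
    using assms by (intro eq_matI) (auto simp: index_mat_adjoint)
  then show ?thesis using assms det_transpose[of "map_mat cnj M" d] by simp
qed

lemma prod_singular_values:
  assumes M: "M \<in> carrier_mat d d"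
  shows "(\<Prod>k=1..d. singular_value k M) = cmod (det M)"
proof -
  obtain P where P: "P \<in> carrier_mat d d" "mat_adjoint P * P = 1\<^sub>m d"
      "mat_adjoint P * (mat_adjoint M * M) * P =
         diagonal_of (map (\<lambda>s. of_real (s\<^sup>2)) (singular_values M))"
    using singular_values_nonneg_decreasing_basis(4)[OF M] unfolding right_singular_basis_def by blast
  have len: "length (singular_values M) = d" using singular_values_nonneg_decreasing_basis[OF M] by simp
  let ?D = "diagonal_of (map (\<lambda>s. complex_of_real (s\<^sup>2)) (singular_values M))"
  have P': "mat_adjoint P \<in> carrier_mat d d" and M': "mat_adjoint M \<in> carrier_mat d d" using P M by auto
  have D: "?D \<in> carrier_mat d d" by (auto simp: diagonal_of_def len)
  have "det ?D = prod_list (diag_mat ?D)"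
    using D by (intro det_upper_triangular[of _ d]) (auto simp: diagonal_of_def upper_triangular_def)
  also have "diag_mat ?D = map (\<lambda>s. complex_of_real (s\<^sup>2)) (singular_values M)"
    by (intro nth_equalityI) (auto simp: diag_mat_def diagonal_of_def)
  also have "prod_list \<dots> = (\<Prod>i<d. of_real ((singular_values M ! i)\<^sup>2))"
    by (simp add: prod.list_conv_set_nth len lessThan_atLeast0)
  also have "\<dots> = of_real ((\<Prod>i<d. singular_values M ! i)\<^sup>2)" by (simp add: prod_power_distrib)
  also have "(\<Prod>i<d. singular_values M ! i) = (\<Prod>k=1..d. singular_value k M)"
    by (rule prod.reindex_bij_witness[of _ "\<lambda>k. k - 1" Suc]) (auto simp: singular_value_def)
  finally have 1: "det ?D = of_real ((\<Prod>k=1..d. singular_value k M)\<^sup>2)" .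
  have "det ?D = det (mat_adjoint P * (mat_adjoint M * M) * P)" by (simp only: P(3))
  also have "\<dots> = (det (mat_adjoint P) * det P) * (det (mat_adjoint M) * det M)"
    by (simp only: det_mult[OF mult_carrier_mat[OF P' mult_carrier_mat[OF M' M]] P(1)]
        det_mult[OF P' mult_carrier_mat[OF M' M]] det_mult[OF M' M] mult_ac)
  also have "det (mat_adjoint P) * det P = 1"
    using det_mult[OF P' P(1)] P(2) by simp
  also have "det (mat_adjoint M) * det M = of_real ((cmod (det M))\<^sup>2)"
    unfolding det_mat_adjoint[OF M] by (simp add: complex_norm_square mult.commute flip: of_real_power)
  finally have "(cmod (det M))\<^sup>2 = (\<Prod>k=1..d. singular_value k M)\<^sup>2"
    unfolding 1 by (simp only: mult_1_left of_real_eq_iff)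
  moreover have "(\<Prod>k=1..d. singular_value k M) \<ge> 0"
    using singular_value_nonneg[OF M] by (intro prod_nonneg) auto
  ultimately show ?thesis by (simp add: power2_eq_iff_nonneg)
qed

lemma singular_value_0_mat:
  assumes "1 \<le> k" "k \<le> d"
  shows "singular_value k (0\<^sub>m d d) = 0"
proof -
  let ?M = "0\<^sub>m d d :: complex mat"
  have M: "?M \<in> carrier_mat d d" by simp
  obtain P where P: "P \<in> carrier_mat d d"
      "mat_adjoint P * (mat_adjoint ?M * ?M) * P =
         diagonal_of (map (\<lambda>s. of_real (s\<^sup>2)) (singular_values ?M))"
    using singular_values_nonneg_decreasing_basis(4)[OF M] unfolding right_singular_basis_def by blast
  have len: "length (singular_values ?M) = d" using singular_values_nonneg_decreasing_basis[OF M] by simp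
  have P': "mat_adjoint P \<in> carrier_mat d d" and M': "mat_adjoint ?M \<in> carrier_mat d d" using P M by auto
  have "mat_adjoint P * (mat_adjoint ?M * ?M) * P = 0\<^sub>m d d"
    by (simp add: right_mult_zero_mat[OF M'] right_mult_zero_mat[OF P'] left_mult_zero_mat[OF P(1)])
  then have "diagonal_of (map (\<lambda>s. complex_of_real (s\<^sup>2)) (singular_values ?M)) $$ (k - 1, k - 1) = 0"
    using P(2) assms by simp
  then show ?thesis using assms by (simp add: diagonal_of_def len singular_value_def)
qed

section \<open>Triangular form of a cocycle over a Bezout domain\<close>
definition transvection :: "nat \<Rightarrow> (nat \<Rightarrow> 'a) \<Rightarrow> (nat \<Rightarrow> 'a) \<Rightarrow> 'a :: comm_ring_1 mat" where
  "transvection d a b = mat d d (\<lambda>(i, j). (if i = j then 1 else 0) + a i * b j)"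

lemma transvection_carrier [simp]: "transvection d a b \<in> carrier_mat d d"
  by (simp add: transvection_def)

lemma transvection_mult_inverse:
  fixes a b :: "nat \<Rightarrow> 'a :: comm_ring_1"
  assumes "(\<Sum>i<d. b i * a i) = 0"
  shows "transvection d a b * transvection d (\<lambda>i. - a i) b = 1\<^sub>m d"
    and "transvection d (\<lambda>i. - a i) b * transvection d a b = 1\<^sub>m d"
proof -
  have *: "transvection d f b * transvection d g b = 1\<^sub>m d"
    if fg: "\<And>i. f i + g i = 0" and bg: "(\<Sum>i<d. b i * g i) = 0" for f g
  proof (intro eq_matI)
    fix i j assume "i < dim_row (1\<^sub>m d :: 'a mat)" "j < dim_col (1\<^sub>m d :: 'a mat)"
    then have ij: "i < d" "j < d" by auto
    have "(transvection d f b * transvection d g b) $$ (i, j) =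
        (\<Sum>l<d. ((if i = l then 1 else 0) + f i * b l) * ((if l = j then 1 else 0) + g l * b j))"
      using ij by (subst index_mult_mat_sum[of _ d d _ d]) (auto simp: transvection_def)
    also have "\<dots> = (\<Sum>l<d. if l = i then (if l = j then 1 else 0) + g l * b j else 0)
        + (\<Sum>l<d. if l = j then f i * b l else 0) + f i * (\<Sum>l<d. b l * g l) * b j"
      unfolding sum_distrib_left sum_distrib_right sum.distrib[symmetric]
      by (intro sum.cong refl) (auto simp: algebra_simps)
    also have "\<dots> = (if i = j then 1 else 0) + (f i + g i) * b j"
      using ij bg by (simp add: algebra_simps)
    finally show "(transvection d f b * transvection d g b) $$ (i, j) = 1\<^sub>m d $$ (i, j)"
      using ij by (simp add: fg)
  qed (auto simp: transvection_def)
  show "transvection d a b * transvection d (\<lambda>i. - a i) b = 1\<^sub>m d"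
    by (rule *) (use assms in \<open>simp_all add: sum_negf\<close>)
  show "transvection d (\<lambda>i. - a i) b * transvection d a b = 1\<^sub>m d"
    by (rule *) (use assms in simp_all)
qed

definition strictly_triangular_upto :: "nat \<Rightarrow> nat \<Rightarrow> 'a :: zero mat \<Rightarrow> bool" where
  "strictly_triangular_upto d m T \<longleftrightarrow> (\<forall>j<m. \<forall>i. j \<le> i \<and> i < d \<longrightarrow> T $$ (i, j) = 0)"

text \<open>
  The determinant of this matrix is that of the lower right block of \<open>T\<close>, and its kernel is the
  kernel of that block, padded with zeros. This avoids passing to smaller matrices.
\<close>

definition identity_rows :: "nat \<Rightarrow> nat \<Rightarrow> 'a :: zero_neq_one mat \<Rightarrow> 'a mat" where
  "identity_rows d m T = mat d d (\<lambda>(i, j). if i < m then (if i = j then 1 else 0) else T $$ (i, j))"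

text \<open>
  Bezout domains of stable rank one, with a ring endomorphism. The shape \<open>f + c g\<close> of the greatest
  common divisor keeps the coefficient of \<open>f\<close> equal to 1, so that the matrices which complete a
  primitive vector below are explicit products of two transvections.
\<close>

locale skew_bezout_domain = comm_ring_hom \<sigma> for \<sigma> :: "'a::idom \<Rightarrow> 'a" +
  assumes bezout: "\<exists>c::'a. (f + c * g) dvd f \<and> (f + c * g) dvd g"
begin

lemma combination_dividing_all:
  assumes "m < d"
  shows "\<exists>c :: nat \<Rightarrow> 'a. c m = 1 \<and> (\<forall>i\<in>{m..<d}. (\<Sum>j\<in>{m..<d}. c j * v j) dvd v i)"
  using assms
proof (induction d)
  case (Suc d)
  show ?case
  proof (cases "m = d")
    case True
    then show ?thesis by (intro exI[of _ "\<lambda>_. 1"]) auto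
  next
    case False
    then have "m < d" using Suc.prems by simp
    from Suc.IH[OF this] obtain c
      where c: "c m = 1" "\<And>i. i \<in> {m..<d} \<Longrightarrow> (\<Sum>j\<in>{m..<d}. c j * v j) dvd v i"
      by auto
    define s where "s = (\<Sum>j\<in>{m..<d}. c j * v j)"
    obtain b where b: "(s + b * v d) dvd s" "(s + b * v d) dvd v d" using bezout by blast
    have sum: "(\<Sum>j\<in>{m..<Suc d}. (c(d := b)) j * v j) = s + b * v d"
      using Suc.prems False by (simp add: s_def)
    have "(s + b * v d) dvd v i" if "i \<in> {m..<Suc d}" for i
      using that b c(2)[of i] dvd_trans[OF b(1), of "v i"] by (cases "i = d") (auto simp: s_def)
    then show ?thesis
      using c(1) False by (intro exI[of _ "c(d := b)"] conjI) (simp, unfold sum, blast)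
  qed
qed simp

lemma primitive_kernel_vector:
  assumes T: "T \<in> carrier_mat d d" and m: "m < d"
    and det: "det (identity_rows d m T) = 0"
  obtains c w :: "nat \<Rightarrow> 'a" where "c m = 1" "\<And>i. i < m \<Longrightarrow> w i = 0"
    "(\<Sum>j\<in>{m..<d}. c j * w j) = 1" "\<And>i. m \<le> i \<Longrightarrow> i < d \<Longrightarrow> (\<Sum>j<d. T $$ (i, j) * w j) = 0"
proof -
  let ?T = "identity_rows d m T"
  have T': "?T \<in> carrier_mat d d" by (simp add: identity_rows_def)
  from det obtain v where v: "v \<in> carrier_vec d" "v \<noteq> 0\<^sub>v d" "?T *\<^sub>v v = 0\<^sub>v d"
    using det_0_iff_vec_prod_zero[OF T'] by blast
  have ker: "(\<Sum>j<d. ?T $$ (i, j) * v $ j) = 0" if "i < d" for i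
    using index_mult_mat_vec_sum[OF T' v(1) that] that unfolding v(3) by simp
  have v0: "v $ i = 0" if "i < m" for i
  proof -
    have "(\<Sum>j<d. ?T $$ (i, j) * v $ j) = (\<Sum>j<d. if j = i then v $ j else 0)"
      using that m by (intro sum.cong refl) (auto simp: identity_rows_def)
    then show ?thesis using ker[of i] that m by simp
  qed
  obtain c where c: "c m = 1" and dvd: "\<And>i. i \<in> {m..<d} \<Longrightarrow> (\<Sum>j\<in>{m..<d}. c j * v $ j) dvd v $ i"
    using combination_dividing_all[OF m, of "\<lambda>i. v $ i"] by blast
  define s where "s = (\<Sum>j\<in>{m..<d}. c j * v $ j)"
  have "\<forall>i. \<exists>q. i < d \<longrightarrow> (i < m \<longrightarrow> q = 0) \<and> v $ i = s * q"
    using v0 dvd unfolding s_def dvd_def by (metis atLeastLessThan_iff mult_zero_right not_less)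
  then obtain w' where w': "\<And>i. i < d \<Longrightarrow> (i < m \<longrightarrow> w' i = 0) \<and> v $ i = s * w' i" by metis
  obtain i where i: "i < d" "v $ i \<noteq> 0" using v(1,2) by (metis carrier_vecD eq_vecI index_zero_vec)
  have s0: "s \<noteq> 0"
  proof
    assume "s = 0"
    moreover have "v $ i = s * w' i" using w'[OF i(1)] by (rule conjunct2)
    ultimately have "v $ i = 0" by (simp only: mult_zero_left)
    with i(2) show False by (rule notE)
  qed
  show ?thesis
  proof (rule that[of c w'])
    have "s * (\<Sum>j\<in>{m..<d}. c j * w' j) = (\<Sum>j\<in>{m..<d}. c j * (s * w' j))"
      by (simp add: sum_distrib_left mult_ac)
    also have "\<dots> = (\<Sum>j\<in>{m..<d}. c j * v $ j)"
      using w' by (intro sum.cong refl) (metis atLeastLessThan_iff)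
    finally have "s * (\<Sum>j\<in>{m..<d}. c j * w' j) = s * 1" by (simp add: s_def)
    then show "(\<Sum>j\<in>{m..<d}. c j * w' j) = 1" using s0 by simp
    fix i assume i: "m \<le> i" "i < d"
    have "s * (\<Sum>j<d. T $$ (i, j) * w' j) = (\<Sum>j<d. T $$ (i, j) * (s * w' j))"
      by (simp add: sum_distrib_left mult_ac)
    also have "\<dots> = (\<Sum>j<d. ?T $$ (i, j) * v $ j)"
      using w' i by (intro sum.cong refl) (simp add: identity_rows_def)
    finally have "s * (\<Sum>j<d. T $$ (i, j) * w' j) = (\<Sum>j<d. ?T $$ (i, j) * v $ j)" .
    then show "(\<Sum>j<d. T $$ (i, j) * w' j) = 0" using ker[OF i(2)] s0 by simp
  qed (use c w' m in auto)
qed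

text \<open>
  With a kernel vector \<open>w\<close> of the lower right block and \<open>c w = 1\<close>, \<open>c\<^sub>m = 1\<close>, the matrix \<open>U\<close> below has
  \<open>w\<close> as its column \<open>m\<close> and agrees with the identity in the columns before it.
\<close>

lemma extend_strict_triangularity:
  assumes T: "T \<in> carrier_mat d d" and m: "m < d" and tri: "strictly_triangular_upto d m T"
    and det: "det (identity_rows d m T) = 0"
  obtains U V where "U \<in> carrier_mat d d" "V \<in> carrier_mat d d" "U * V = 1\<^sub>m d"
    "strictly_triangular_upto d (Suc m) (map_mat \<sigma> V * T * U)"
proof -
  obtain c w where c: "c m = 1" and w0: "\<And>i. i < m \<Longrightarrow> w i = 0"
    and cw: "(\<Sum>j\<in>{m..<d}. c j * w j) = 1"
    and Tw: "\<And>i. m \<le> i \<Longrightarrow> i < d \<Longrightarrow> (\<Sum>j<d. T $$ (i, j) * w j) = 0"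
    using primitive_kernel_vector[OF T m det] by blast
  \<comment> \<open>The transvection \<open>C\<close> replaces coordinate \<open>m\<close> by the value of \<open>c\<close>, so it maps \<open>w\<close> to a vector
      with entry 1 there; \<open>W\<close> has that vector as its column \<open>m\<close>.\<close>
  define \<beta> where "\<beta> j = (if m < j then c j else 0)" for j
  define \<gamma> where "\<gamma> j = (if m < j then w j else 0)" for j
  define e where "e j = (if j = m then 1 else 0 :: 'a)" for j
  let ?C = "transvection d e \<beta>" and ?C' = "transvection d (\<lambda>i. - e i) \<beta>"
  let ?W = "transvection d \<gamma> e" and ?W' = "transvection d (\<lambda>i. - \<gamma> i) e"
  have CC: "?C' * ?C = 1\<^sub>m d" and WW: "?W * ?W' = 1\<^sub>m d"
    by (intro transvection_mult_inverse sum.neutral; simp add: \<beta>_def \<gamma>_def e_def)+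
  define U where "U = ?C' * ?W"
  define V where "V = ?W' * ?C"
  have U: "U \<in> carrier_mat d d" and V: "V \<in> carrier_mat d d"
    unfolding U_def V_def by (rule mult_carrier_mat[of _ d d]; simp)+
  have "U * V = ?C' * (?W * ?W') * ?C"
    unfolding U_def V_def by (rule mult_mat_assoc4[of _ d]) auto
  then have UV: "U * V = 1\<^sub>m d" by (simp add: WW CC right_mult_one_mat[of _ d d])
  have unit_cols: "(transvection d a b * transvection d a' b') $$ (i, j) = (if i = j then 1 else 0)"
    if "b j = 0" "b' j = 0" "i < d" "j < d" for a b a' b' i j
  proof -
    have "(transvection d a b * transvection d a' b') $$ (i, j) =
      (\<Sum>l<d. if l = j then transvection d a b $$ (i, l) else 0)"
      unfolding index_mult_mat_sum[OF transvection_carrier transvection_carrier that(3,4)]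
      using that by (intro sum.cong refl) (simp add: transvection_def)
    then show ?thesis using that by (simp add: transvection_def)
  qed
  have Ucol: "U $$ (i, j) = (if i = j then 1 else 0)" and Vcol: "V $$ (i, j) = (if i = j then 1 else 0)"
    if "i < d" "j < m" for i j
    using that m by (simp_all add: U_def V_def unit_cols \<beta>_def e_def)
  have Um: "U $$ (i, m) = w i" if i: "i < d" for i
  proof -
    have "U $$ (i, m) = (\<Sum>l<d. ((if i = l then 1 else 0) - e i * \<beta> l) * ((if l = m then 1 else 0) + \<gamma> l))"
      unfolding U_def using i m
      by (subst index_mult_mat_sum[of _ d d _ d]) (auto simp: transvection_def e_def)
    also have "\<dots> = (\<Sum>l<d. if l = i then (if l = m then 1 else 0) + \<gamma> l else 0)
       - e i * ((\<Sum>l<d. if l = m then \<beta> l else 0) + (\<Sum>l<d. \<beta> l * \<gamma> l))"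
      unfolding sum_distrib_left sum.distrib[symmetric] sum_subtractf[symmetric]
      by (intro sum.cong refl) (auto simp: algebra_simps)
    also have "\<dots> = e i + \<gamma> i - e i * (\<Sum>l<d. \<beta> l * \<gamma> l)"
      using i m by (simp add: e_def \<beta>_def)
    also have "(\<Sum>l<d. \<beta> l * \<gamma> l) = (\<Sum>l\<in>{Suc m..<d}. c l * w l)"
      by (intro sum.mono_neutral_cong_right) (auto simp: \<beta>_def \<gamma>_def)
    also have "\<dots> = 1 - w m"
      using cw m c by (simp add: sum.atLeast_Suc_lessThan algebra_simps)
    finally show ?thesis using w0[of i] by (cases i m rule: linorder_cases) (auto simp: e_def \<gamma>_def)
  qed
  have "strictly_triangular_upto d (Suc m) (map_mat \<sigma> V * T * U)"
    unfolding strictly_triangular_upto_def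
  proof (intro allI impI, elim conjE)
    fix i j assume j: "j < Suc m" and i: "j \<le> i" "i < d"
    have V': "map_mat \<sigma> V \<in> carrier_mat d d" using V by simp
    have TU: "T * U \<in> carrier_mat d d" using T U by (rule mult_carrier_mat)
    have TUj: "(T * U) $$ (k, j) = 0" if "j \<le> k" "k < d" for k
    proof (cases "j = m")
      case True
      then show ?thesis
        using that m Um Tw[of k] by (subst index_mult_mat_sum[OF T U]) auto
    next
      case False
      then have "j < m" using j by simp
      then have "(T * U) $$ (k, j) = (\<Sum>l<d. T $$ (k, l) * U $$ (l, j))"
        using that m by (intro index_mult_mat_sum[OF T U]) auto
      also have "\<dots> = (\<Sum>l<d. if l = j then T $$ (k, l) else 0)"
        using Ucol \<open>j < m\<close> by (intro sum.cong refl) simp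
      also have "\<dots> = T $$ (k, j)" using that by simp
      also have "\<dots> = 0" using tri that \<open>j < m\<close> by (simp add: strictly_triangular_upto_def)
      finally show ?thesis .
    qed
    have "(map_mat \<sigma> V * T * U) $$ (i, j) = (map_mat \<sigma> V * (T * U)) $$ (i, j)"
      using assoc_mult_mat[OF V' T U] by simp
    also have "\<dots> = (\<Sum>l<d. \<sigma> (V $$ (i, l)) * (T * U) $$ (l, j))"
      using i m j V by (subst index_mult_mat_sum[OF V' TU]) auto
    also have "\<dots> = 0"
    proof (intro sum.neutral ballI)
      fix l assume "l \<in> {..<d}"
      then show "\<sigma> (V $$ (i, l)) * (T * U) $$ (l, j) = 0"
        using TUj[of l] Vcol[of i l] i j by (cases "j \<le> l") auto
    qed
    finally show "(map_mat \<sigma> V * T * U) $$ (i, j) = 0" .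
  qed
  then show ?thesis using that U V UV by blast
qed

text \<open>
  The frame is taken with as many strictly triangular columns as possible; a singular remaining
  block would allow one more.
\<close>

theorem cocycle_block_triangularization:
  assumes A: "A \<in> carrier_mat d d"
  obtains m U V where "m \<le> d" "U \<in> carrier_mat d d" "V \<in> carrier_mat d d" "U * V = 1\<^sub>m d"
    "strictly_triangular_upto d m (map_mat \<sigma> V * A * U)"
    "m = d \<or> det (identity_rows d m (map_mat \<sigma> V * A * U)) \<noteq> 0"
proof -
  define Q where "Q m U V \<longleftrightarrow> U \<in> carrier_mat d d \<and> V \<in> carrier_mat d d \<and> U * V = 1\<^sub>m d \<and>
    strictly_triangular_upto d m (map_mat \<sigma> V * A * U)" for m U V
  have ex0: "\<exists>U V. 0 \<le> d \<and> Q 0 U V"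
    by (intro exI[of _ "1\<^sub>m d"]) (auto simp: Q_def strictly_triangular_upto_def)
  define m where "m = (GREATEST m. \<exists>U V. m \<le> d \<and> Q m U V)"
  have "\<exists>U V. m \<le> d \<and> Q m U V"
    unfolding m_def
    by (rule GreatestI_nat[where P = "\<lambda>m. \<exists>U V. m \<le> d \<and> Q m U V" and k = 0 and b = d, OF ex0]) auto
  then obtain U V where UV: "m \<le> d" "Q m U V" by blast
  let ?T = "map_mat \<sigma> V * A * U"
  have T: "?T \<in> carrier_mat d d" using UV A by (auto simp: Q_def)
  have "det (identity_rows d m ?T) \<noteq> 0" if md: "m < d"
  proof
    assume "det (identity_rows d m ?T) = 0"
    then obtain U' V' where 1: "U' \<in> carrier_mat d d" "V' \<in> carrier_mat d d" "U' * V' = 1\<^sub>m d"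
      "strictly_triangular_upto d (Suc m) (map_mat \<sigma> V' * ?T * U')"
      using extend_strict_triangularity[OF T md] UV by (auto simp: Q_def)
    have c: "U \<in> carrier_mat d d" "V \<in> carrier_mat d d" "U * V = 1\<^sub>m d" using UV by (auto simp: Q_def)
    have "map_mat \<sigma> (V' * V) = map_mat \<sigma> V' * map_mat \<sigma> V"
      using mat_hom_mult[OF 1(2) c(2)] .
    then have "map_mat \<sigma> (V' * V) * A * (U * U') = map_mat \<sigma> V' * ?T * U'"
      using mult_mat_assoc5[of "map_mat \<sigma> V'" d "map_mat \<sigma> V" A U U'] c 1 A by simp
    moreover have "(U * U') * (V' * V) = U * (U' * V') * V"
      by (rule mult_mat_assoc4[OF c(1) 1(1,2) c(2)])
    then have "(U * U') * (V' * V) = 1\<^sub>m d" using c 1 by (simp add: right_mult_one_mat[of _ d d])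
    ultimately have "Q (Suc m) (U * U') (V' * V)"
      using 1 c by (auto simp: Q_def intro: mult_carrier_mat)
    then have "\<exists>U V. Suc m \<le> d \<and> Q (Suc m) U V" using md by (intro exI conjI) auto
    then have "Suc m \<le> m"
      unfolding m_def
      by (rule Greatest_le_nat[where P = "\<lambda>m. \<exists>U V. m \<le> d \<and> Q m U V" and b = d]) auto
    then show False by simp
  qed
  then have "m = d \<or> det (identity_rows d m ?T) \<noteq> 0" using UV(1) by linarith
  then show ?thesis using that[of m U V] UV by (auto simp: Q_def)
qed

end

section \<open>Real analytic functions on the line\<close>
definition local_extension :: "(real \<Rightarrow> complex) \<Rightarrow> real \<Rightarrow> real \<Rightarrow> (complex \<Rightarrow> complex) \<Rightarrow> bool" where
  "local_extension f x0 r G \<longleftrightarrow> r > 0 \<and> G holomorphic_on ball (of_real x0) r \<and>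
     (\<forall>x. \<bar>x - x0\<bar> < r \<longrightarrow> G (of_real x) = f x)"

lemma of_real_in_ball_iff: "complex_of_real x \<in> ball (of_real x0) r \<longleftrightarrow> \<bar>x - x0\<bar> < r"
  by (simp add: dist_real_def abs_minus_commute flip: of_real_diff)

lemma local_extension_of_real_in_ball:
  "local_extension f x0 r G \<Longrightarrow> \<bar>x - x0\<bar> < r \<Longrightarrow> G (of_real x) = f x"
  by (simp add: local_extension_def)

text \<open>
  Holomorphic functions on discs are easier to add, multiply and divide than power series; this
  equivalence makes every closure property below a statement about holomorphic functions.
\<close>

lemma real_analytic_iff_local_extension:
  "real_analytic f \<longleftrightarrow> (\<forall>x0. \<exists>r G. local_extension f x0 r G)"
proof
  assume f: "real_analytic f"
  show "\<forall>x0. \<exists>r G. local_extension f x0 r G"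
  proof
    fix x0
    obtain r a where r: "r > 0" and a: "\<And>x. \<bar>x - x0\<bar> < r \<Longrightarrow> (\<lambda>n. a n * of_real ((x - x0) ^ n)) sums f x"
      using f unfolding real_analytic_def by blast
    define G where "G z = (\<Sum>n. a n * (z - of_real x0) ^ n)" for z :: complex
    have "(\<lambda>n. a n * (w - of_real x0) ^ n) sums G w" if "w \<in> ball (of_real x0) r" for w
    proof -
      have "cmod (w - of_real x0) < r" using that by (simp add: dist_norm norm_minus_commute)
      then obtain t where t: "cmod (w - of_real x0) < t" "t < r" using dense by blast
      then have "t > 0" using norm_ge_zero[of "w - of_real x0"] by linarith
      then have "summable (\<lambda>n. a n * of_real t ^ n)"
        using sums_summable[OF a[of "x0 + t"]] t by simp
      then have "summable (\<lambda>n. a n * (w - of_real x0) ^ n)"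
        using powser_inside t(1) \<open>t > 0\<close> by force
      then show ?thesis unfolding G_def by (rule summable_sums)
    qed
    then have "G holomorphic_on ball (of_real x0) r" by (rule power_series_holomorphic)
    moreover have "G (of_real x) = f x" if "\<bar>x - x0\<bar> < r" for x
      using sums_unique[OF a[OF that]] unfolding G_def by simp
    ultimately show "\<exists>r G. local_extension f x0 r G" using r unfolding local_extension_def by blast
  qed
next
  assume ext: "\<forall>x0. \<exists>r G. local_extension f x0 r G"
  show "real_analytic f"
    unfolding real_analytic_def
  proof
    fix x0
    obtain r G where G: "local_extension f x0 r G" using ext by blast
    define a where "a n = (deriv ^^ n) G (of_real x0) / fact n" for n
    have "(\<lambda>n. a n * of_real ((x - x0) ^ n)) sums f x" if "\<bar>x - x0\<bar> < r" for x
      using holomorphic_power_series[of G "of_real x0" r "of_real x"] G that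
      unfolding a_def local_extension_def by (simp add: dist_real_def abs_minus_commute flip: of_real_diff)
    then show "\<exists>r>0. \<exists>a. \<forall>x. \<bar>x - x0\<bar> < r \<longrightarrow> (\<lambda>n. a n * of_real ((x - x0) ^ n)) sums f x"
      using G unfolding local_extension_def by blast
  qed
qed

lemma local_extension_shrink:
  "local_extension f x0 r G \<Longrightarrow> 0 < s \<Longrightarrow> s \<le> r \<Longrightarrow> local_extension f x0 s G"
  unfolding local_extension_def by (auto intro: holomorphic_on_subset)

lemma real_analytic_const: "real_analytic (\<lambda>_. c)"
  unfolding real_analytic_iff_local_extension local_extension_def
  by (intro allI exI[of _ 1] exI[of _ "\<lambda>_. c"]) auto

lemma real_analytic_binop:
  assumes f: "real_analytic f" and g: "real_analytic g"
    and h: "\<And>S F G. F holomorphic_on S \<Longrightarrow> G holomorphic_on S \<Longrightarrow> (\<lambda>z. h (F z) (G z)) holomorphic_on S"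
  shows "real_analytic (\<lambda>x. h (f x) (g x))"
  unfolding real_analytic_iff_local_extension
proof
  fix x0
  obtain r F s G where "local_extension f x0 r F" "local_extension g x0 s G"
    using f g unfolding real_analytic_iff_local_extension by meson
  then have *: "local_extension f x0 (min r s) F" "local_extension g x0 (min r s) G"
    by (auto intro!: local_extension_shrink simp: local_extension_def)
  then have "local_extension (\<lambda>x. h (f x) (g x)) x0 (min r s) (\<lambda>z. h (F z) (G z))"
    unfolding local_extension_def using h by auto
  then show "\<exists>r G. local_extension (\<lambda>x. h (f x) (g x)) x0 r G" by blast
qed

lemma real_analytic_shift:
  assumes f: "real_analytic f"
  shows "real_analytic (\<lambda>x. f (x + \<alpha>))"
  unfolding real_analytic_iff_local_extension
proof
  fix x0
  obtain r F where F: "local_extension f (x0 + \<alpha>) r F"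
    using f unfolding real_analytic_iff_local_extension by meson
  have "(F \<circ> (\<lambda>z. z + of_real \<alpha>)) holomorphic_on ball (of_real x0) r"
  proof (rule holomorphic_on_compose_gen)
    show "F holomorphic_on ball (of_real (x0 + \<alpha>)) r" using F by (simp add: local_extension_def)
    show "(\<lambda>z. z + complex_of_real \<alpha>) ` ball (of_real x0) r \<subseteq> ball (of_real (x0 + \<alpha>)) r"
      by (auto simp: dist_norm)
  qed (intro holomorphic_intros)
  moreover have "F (of_real x + of_real \<alpha>) = f (x + \<alpha>)" if "\<bar>x - x0\<bar> < r" for x
    using local_extension_of_real_in_ball[OF F, of "x + \<alpha>"] that by simp
  ultimately have "local_extension (\<lambda>x. f (x + \<alpha>)) x0 r (\<lambda>z. F (z + of_real \<alpha>))"
    using F by (simp add: local_extension_def o_def)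
  then show "\<exists>r G. local_extension (\<lambda>x. f (x + \<alpha>)) x0 r G" by blast
qed

lemma local_extension_zero:
  assumes F: "local_extension f x0 r F" and y: "\<bar>y - x0\<bar> < r" and e: "e > 0" "\<And>x. \<bar>x - y\<bar> < e \<Longrightarrow> f x = 0"
    and w: "w \<in> ball (of_real x0) r"
  shows "F w = 0"
proof (rule analytic_continuation[where f = F and S = "ball (of_real x0) r" and \<xi> = "of_real y"
      and U = "of_real ` {x. \<bar>x - y\<bar> < e \<and> \<bar>x - x0\<bar> < r}"])
  show "complex_of_real y islimpt of_real ` {x. \<bar>x - y\<bar> < e \<and> \<bar>x - x0\<bar> < r}"
    unfolding islimpt_approachable
  proof (intro allI impI)
    fix d :: real assume "d > 0"
    define t where "t = min (min d e) (r - \<bar>y - x0\<bar>) / 2"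
    have t: "0 < t" "t < d" "t < e" "t < r - \<bar>y - x0\<bar>" using \<open>d > 0\<close> e y unfolding t_def by (auto simp: min_def)
    then show "\<exists>x'\<in>of_real ` {x. \<bar>x - y\<bar> < e \<and> \<bar>x - x0\<bar> < r}. x' \<noteq> complex_of_real y \<and> dist x' (of_real y) < d"
      by (intro bexI[of _ "of_real (y + t)"] conjI imageI) (auto simp: dist_norm)
  qed
  show "F z = 0" if "z \<in> of_real ` {x. \<bar>x - y\<bar> < e \<and> \<bar>x - x0\<bar> < r}" for z
    using that e(2) local_extension_of_real_in_ball[OF F] by auto
qed (use F y w in \<open>auto simp: local_extension_def dist_real_def abs_minus_commute simp flip: of_real_diff\<close>)

text \<open>
  The set of points near which the function vanishes identically is open, closed and nonempty.
\<close>

lemma real_analytic_eq_0_of_locally_0: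
  assumes f: "real_analytic f" and r: "r > 0" "\<And>x. \<bar>x - x0\<bar> < r \<Longrightarrow> f x = 0"
  shows "f x = 0"
proof -
  define S where "S = {x0. \<exists>r>0. \<forall>x. \<bar>x - x0\<bar> < r \<longrightarrow> f x = 0}"
  have "open S"
    unfolding open_dist
  proof
    fix y assume "y \<in> S"
    then obtain e where e: "e > 0" "\<And>x. \<bar>x - y\<bar> < e \<Longrightarrow> f x = 0" by (auto simp: S_def)
    have "z \<in> S" if "dist z y < e" for z
    proof -
      have "f x = 0" if "\<bar>x - z\<bar> < e - dist z y" for x
        using that e(2)[of x] by (simp add: dist_real_def)
      then show ?thesis using that unfolding S_def by (auto intro!: exI[of _ "e - dist z y"])
    qed
    then show "\<exists>e>0. \<forall>z. dist z y < e \<longrightarrow> z \<in> S" using e(1) by blast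
  qed
  moreover have "closed S"
    unfolding closed_limpt
  proof (intro allI impI)
    fix y assume y: "y islimpt S"
    obtain s F where F: "local_extension f y s F"
      using f unfolding real_analytic_iff_local_extension by meson
    then have "s > 0" by (simp add: local_extension_def)
    then obtain z where z: "z \<in> S" "dist z y < s" using y unfolding islimpt_approachable by blast
    then obtain e where e: "e > 0" "\<And>x. \<bar>x - z\<bar> < e \<Longrightarrow> f x = 0" by (auto simp: S_def)
    have "f x = 0" if "\<bar>x - y\<bar> < s" for x
    proof -
      have "F (of_real x) = 0"
        by (rule local_extension_zero[where y = z, OF F _ e(1)])
           (use z e(2) that in \<open>auto simp: dist_real_def abs_minus_commute\<close>)
      then show ?thesis using local_extension_of_real_in_ball[OF F that] by simp
    qed
    then show "y \<in> S" using \<open>s > 0\<close> by (auto simp: S_def)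
  qed
  moreover have "x0 \<in> S" using r by (auto simp: S_def)
  ultimately have "S = UNIV" using clopen[of S] by blast
  then have "x \<in> S" by simp
  then show ?thesis by (auto simp: S_def)
qed

lemma real_analytic_local_factorization:
  assumes f: "real_analytic f" and nz: "f y \<noteq> 0"
  obtains m r g where "r > 0" "g holomorphic_on ball (of_real x0) r"
    "\<And>z. z \<in> ball (of_real x0) r \<Longrightarrow> g z \<noteq> 0"
    "\<And>x. \<bar>x - x0\<bar> < r \<Longrightarrow> f x = of_real (x - x0) ^ m * g (of_real x)"
proof -
  obtain r F where F: "local_extension f x0 r F"
    using f unfolding real_analytic_iff_local_extension by meson
  then have r: "r > 0" and hol: "F holomorphic_on ball (of_real x0) r" by (auto simp: local_extension_def)
  show thesis
  proof (cases "F (of_real x0) = 0")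
    case False
    have "continuous_on (ball (of_real x0) r) F" using hol by (rule holomorphic_on_imp_continuous_on)
    then have "continuous (at (of_real x0)) F"
      using r by (simp add: continuous_on_eq_continuous_at)
    from continuous_at_avoid[OF this False] obtain e where e: "e > 0" "\<And>z. dist (of_real x0) z < e \<Longrightarrow> F z \<noteq> 0"
      by blast
    show thesis
    proof (rule that[of "min r e" F 0])
      show "F holomorphic_on ball (of_real x0) (min r e)" using hol by (rule holomorphic_on_subset) auto
      show "f x = of_real (x - x0) ^ 0 * F (of_real x)" if "\<bar>x - x0\<bar> < min r e" for x
        using local_extension_of_real_in_ball[OF F] that by simp
    qed (use r e in auto)
  next
    case True
    have nc: "\<not> F constant_on ball (of_real x0) r"
    proof
      assume "F constant_on ball (of_real x0) r"
      then have "F z = 0" if "z \<in> ball (of_real x0) r" for z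
        using that True r unfolding constant_on_def by (metis centre_in_ball)
      then have "f x = 0" if "\<bar>x - x0\<bar> < r" for x
        using local_extension_of_real_in_ball[OF F that] that
        by (metis of_real_in_ball_iff)
      then show False using real_analytic_eq_0_of_locally_0[OF f r, of x0 y] nz by blast
    qed
    have "complex_of_real x0 \<in> ball (of_real x0) r" using r by simp
    then show thesis
    proof (rule holomorphic_factor_zero_nonconstant[OF hol open_ball connected_ball _ True nc])
      fix g s and n :: nat
      assume g: "0 < n" "0 < s" "ball (complex_of_real x0) s \<subseteq> ball (of_real x0) r"
        "g holomorphic_on ball (of_real x0) s"
        "\<And>w. w \<in> ball (of_real x0) s \<Longrightarrow> F w = (w - of_real x0) ^ n * g w"
        "\<And>w. w \<in> ball (of_real x0) s \<Longrightarrow> g w \<noteq> 0"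
      show thesis
      proof (rule that[of s g n])
        fix x assume x: "\<bar>x - x0\<bar> < s"
        then have xs: "complex_of_real x \<in> ball (of_real x0) s" by (simp only: of_real_in_ball_iff)
        with g(3) have "complex_of_real x \<in> ball (of_real x0) r" by (rule subsetD)
        then have "\<bar>x - x0\<bar> < r" by (simp only: of_real_in_ball_iff)
        then show "f x = of_real (x - x0) ^ n * g (of_real x)"
          using local_extension_of_real_in_ball[OF F] g(5)[OF xs] by simp
      qed (use g in auto)
    qed
  qed
qed

lemma real_analytic_continuous:
  assumes "real_analytic f"
  shows "continuous_on UNIV f"
proof -
  have "isCont f x0" for x0
  proof -
    obtain r F where F: "local_extension f x0 r F"
      using assms unfolding real_analytic_iff_local_extension by meson
    then have r: "r > 0" and "continuous_on (ball (of_real x0) r) F"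
      by (auto simp: local_extension_def holomorphic_on_imp_continuous_on)
    then have "isCont F (of_real x0)"
      by (simp add: continuous_on_eq_continuous_at)
    then have "isCont (\<lambda>x. F (of_real x)) x0"
      using continuous_at_compose[of x0 complex_of_real F] by (simp add: o_def)
    moreover have "eventually (\<lambda>x. F (of_real x) = f x) (nhds x0)"
      unfolding eventually_nhds_metric
      using r local_extension_of_real_in_ball[OF F] by (auto simp: dist_real_def)
    ultimately show ?thesis by (simp add: isCont_cong)
  qed
  then show ?thesis by (simp add: continuous_on_eq_continuous_at)
qed

section \<open>The ring of analytic functions on the circle\<close>
text \<open>
  The functions form a type of their own, so that determinants, adjugates and kernel vectors of
  matrices over them come from linear algebra over integral domains.
\<close>

typedef circle_analytic = "{f. real_analytic f \<and> (\<forall>x. f (x + 1) = f x)}"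
  morphisms at_point Circle_Analytic
  by (intro exI[of _ "\<lambda>_. 0"]) (simp add: real_analytic_const)

setup_lifting type_definition_circle_analytic

lemma real_analytic_at_point: "real_analytic (at_point f)"
  using at_point[of f] by simp

lemma at_point_periodic: "at_point f (x + 1) = at_point f x"
  using at_point[of f] by simp

lemma real_analytic_add: "real_analytic f \<Longrightarrow> real_analytic g \<Longrightarrow> real_analytic (\<lambda>x. f x + g x)"
  and real_analytic_diff: "real_analytic f \<Longrightarrow> real_analytic g \<Longrightarrow> real_analytic (\<lambda>x. f x - g x)"
  and real_analytic_mult: "real_analytic f \<Longrightarrow> real_analytic g \<Longrightarrow> real_analytic (\<lambda>x. f x * g x)"
  using real_analytic_binop[of f g "(+)"] real_analytic_binop[of f g "(-)"] real_analytic_binop[of f g "(*)"]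
  by (simp_all add: holomorphic_on_add holomorphic_on_diff holomorphic_on_mult)

instantiation circle_analytic :: comm_ring_1
begin

lift_definition zero_circle_analytic :: circle_analytic is "\<lambda>_. 0"
  by (simp add: real_analytic_const)

lift_definition one_circle_analytic :: circle_analytic is "\<lambda>_. 1"
  by (simp add: real_analytic_const)

lift_definition plus_circle_analytic :: "circle_analytic \<Rightarrow> circle_analytic \<Rightarrow> circle_analytic"
  is "\<lambda>f g x. f x + g x"
  by (simp add: real_analytic_add)

lift_definition minus_circle_analytic :: "circle_analytic \<Rightarrow> circle_analytic \<Rightarrow> circle_analytic"
  is "\<lambda>f g x. f x - g x"
  by (simp add: real_analytic_diff)

lift_definition times_circle_analytic :: "circle_analytic \<Rightarrow> circle_analytic \<Rightarrow> circle_analytic"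
  is "\<lambda>f g x. f x * g x"
  by (simp add: real_analytic_mult)

lift_definition uminus_circle_analytic :: "circle_analytic \<Rightarrow> circle_analytic"
  is "\<lambda>f x. - f x"
  using real_analytic_diff[OF real_analytic_const[of 0]] by simp

instance
  by standard (transfer; auto simp: algebra_simps fun_eq_iff)+

end

lift_definition rotate_circle :: "real \<Rightarrow> circle_analytic \<Rightarrow> circle_analytic"
  is "\<lambda>\<alpha> f x. f (x + \<alpha>)"
proof (safe intro!: real_analytic_shift)
  fix \<alpha> x :: real and f :: "real \<Rightarrow> complex"
  assume "\<forall>x. f (x + 1) = f x"
  then have "f (x + \<alpha> + 1) = f (x + \<alpha>)" by blast
  then show "f (x + 1 + \<alpha>) = f (x + \<alpha>)" by (simp add: add_ac)
qed

lift_definition constant_function :: "complex \<Rightarrow> circle_analytic" is "\<lambda>c _. c"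
  by (simp add: real_analytic_const)

lemma at_point_simps [simp]:
  "at_point 0 x = 0" "at_point 1 x = 1"
  "at_point (f + g) x = at_point f x + at_point g x"
  "at_point (f - g) x = at_point f x - at_point g x"
  "at_point (f * g) x = at_point f x * at_point g x"
  "at_point (- f) x = - at_point f x"
  "at_point (rotate_circle \<alpha> f) x = at_point f (x + \<alpha>)"
  "at_point (constant_function c) x = c"
  by (transfer, simp)+

lemma circle_analytic_eqI: "(\<And>x. at_point f x = at_point g x) \<Longrightarrow> f = g"
  by (metis at_point_inject ext)

lemma nonzero_at_some_point: "f \<noteq> 0 \<Longrightarrow> \<exists>x. at_point f x \<noteq> 0"
  using circle_analytic_eqI[of f 0] by auto

lemma circle_analytic_local_factorization:
  assumes "f \<noteq> 0"
  obtains m r g where "r > 0" "g holomorphic_on ball (complex_of_real x0) r"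
    "\<And>z. z \<in> ball (complex_of_real x0) r \<Longrightarrow> g z \<noteq> 0"
    "\<And>x. \<bar>x - x0\<bar> < r \<Longrightarrow> at_point f x = of_real (x - x0) ^ m * g (complex_of_real x)"
proof -
  obtain y where "at_point f y \<noteq> 0" using nonzero_at_some_point[OF assms] by blast
  then show thesis by (rule real_analytic_local_factorization[OF real_analytic_at_point, where ?x0.0 = x0]) (rule that)
qed

lemma eventually_at_point_nonzero:
  assumes "f \<noteq> 0"
  shows "eventually (\<lambda>x. at_point f x \<noteq> 0) (at x0)"
proof -
  obtain m r g where g: "r > 0" "\<And>z. z \<in> ball (complex_of_real x0) r \<Longrightarrow> g z \<noteq> 0"
    "\<And>x. \<bar>x - x0\<bar> < r \<Longrightarrow> at_point f x = of_real (x - x0) ^ m * g (complex_of_real x)"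
    by (rule circle_analytic_local_factorization[OF assms, of x0]) (rule that)
  have "at_point f x \<noteq> 0" if "x \<noteq> x0" "dist x x0 < r" for x
    using g(3)[of x] g(2)[of "complex_of_real x"] that by (simp add: of_real_in_ball_iff dist_real_def)
  then show ?thesis unfolding eventually_at using g(1) by blast
qed

instance circle_analytic :: idom
proof
  fix f g :: circle_analytic
  assume fg: "f \<noteq> 0" "g \<noteq> 0"
  have "eventually (\<lambda>x. at_point f x \<noteq> 0 \<and> at_point g x \<noteq> 0) (at 0)"
    using fg by (intro eventually_conj eventually_at_point_nonzero)
  then obtain x where "at_point f x \<noteq> 0" "at_point g x \<noteq> 0"
    using eventually_happens by fastforce
  then have "at_point (f * g) x \<noteq> at_point 0 x" by simp
  then show "f * g \<noteq> 0" by metis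
qed

definition divides_locally :: "circle_analytic \<Rightarrow> circle_analytic \<Rightarrow> real \<Rightarrow> bool" where
  "divides_locally h f y \<longleftrightarrow> (\<exists>r>0. \<exists>p. p holomorphic_on ball (complex_of_real y) r \<and>
       (\<forall>x. \<bar>x - y\<bar> < r \<longrightarrow> at_point f x = p (complex_of_real x) * at_point h x))"

text \<open>
  The quotient is defined as the limit of \<open>f/h\<close> at every point, zeros of \<open>h\<close> included; this agrees with
  every local quotient because the zeros of \<open>h\<close> are isolated.
\<close>

lemma dvd_if_divides_locally:
  assumes h: "h \<noteq> 0" and "\<And>y. divides_locally h f y"
  shows "h dvd f"
proof -
  have loc: "\<exists>r>0. \<exists>p. p holomorphic_on ball (complex_of_real y) r \<and>
       (\<forall>x. \<bar>x - y\<bar> < r \<longrightarrow> at_point f x = p (complex_of_real x) * at_point h x)" for y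
    using assms(2) unfolding divides_locally_def .
  define quot where "quot x = at_point f x / at_point h x" for x
  define q where "q y = Lim (at y) quot" for y
  have q_eq: "(quot \<longlongrightarrow> p (complex_of_real x)) (at x)"
    if p: "r > 0" "p holomorphic_on ball (complex_of_real y) r"
      "\<And>x. \<bar>x - y\<bar> < r \<Longrightarrow> at_point f x = p (complex_of_real x) * at_point h x"
      and x: "\<bar>x - y\<bar> < r" for p y r x
  proof -
    have "isCont p (complex_of_real x)"
      using holomorphic_on_imp_continuous_on[OF p(2)] x
      by (simp add: continuous_on_eq_continuous_at dist_real_def abs_minus_commute)
    then have "isCont (\<lambda>t. p (of_real t)) x"
      using continuous_at_compose[of x complex_of_real p] by (simp add: o_def)
    then have "((\<lambda>t. p (of_real t)) \<longlongrightarrow> p (complex_of_real x)) (at x)" by (simp add: isCont_def)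
    moreover have "eventually (\<lambda>t. \<bar>t - y\<bar> < r) (at x)"
      unfolding eventually_at using x by (intro exI[of _ "r - \<bar>x - y\<bar>"]) (auto simp: dist_real_def)
    then have "eventually (\<lambda>t. p (of_real t) = quot t) (at x)"
      using eventually_at_point_nonzero[OF h, of x] by eventually_elim (simp add: p(3) quot_def)
    ultimately show ?thesis by (rule Lim_transform_eventually)
  qed
  have q: "q x = p (complex_of_real x)"
    if "r > 0" "p holomorphic_on ball (complex_of_real y) r"
      "\<And>x. \<bar>x - y\<bar> < r \<Longrightarrow> at_point f x = p (complex_of_real x) * at_point h x"
      "\<bar>x - y\<bar> < r" for p y r x
    unfolding q_def using q_eq[OF that] by (intro tendsto_Lim) auto
  have "real_analytic q"
    unfolding real_analytic_iff_local_extension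
  proof
    fix y
    obtain r p where "r > 0" "p holomorphic_on ball (complex_of_real y) r"
       "\<And>x. \<bar>x - y\<bar> < r \<Longrightarrow> at_point f x = p (complex_of_real x) * at_point h x"
      using loc by blast
    then have "local_extension q y r p" using q unfolding local_extension_def by simp
    then show "\<exists>r G. local_extension q y r G" by blast
  qed
  moreover have "q (y + 1) = q y" for y
  proof -
    obtain r p where p: "r > 0" "p holomorphic_on ball (complex_of_real y) r"
       "\<And>x. \<bar>x - y\<bar> < r \<Longrightarrow> at_point f x = p (complex_of_real x) * at_point h x"
      using loc by blast
    have "(quot \<longlongrightarrow> p (complex_of_real y)) (at y)" using q_eq[OF p, of y] p(1) by simp
    then have "((\<lambda>x. quot (x - 1)) \<longlongrightarrow> p (complex_of_real y)) (at (y + 1))"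
      using LIM_offset[of quot "p (complex_of_real y)" y "-1"] by simp
    moreover have "quot (x - 1) = quot x" for x
      using at_point_periodic[of f "x - 1"] at_point_periodic[of h "x - 1"] by (simp add: quot_def)
    ultimately have "(quot \<longlongrightarrow> p (complex_of_real y)) (at (y + 1))" by simp
    then have "q (y + 1) = p (complex_of_real y)" unfolding q_def by (intro tendsto_Lim) auto
    then show ?thesis using q[OF p, of y] p(1) by simp
  qed
  ultimately have at_q: "at_point (Circle_Analytic q) = q" by (simp add: Circle_Analytic_inverse)
  have "f = h * Circle_Analytic q"
  proof (rule circle_analytic_eqI)
    fix y
    obtain r p where p: "r > 0" "p holomorphic_on ball (complex_of_real y) r"
       "\<And>x. \<bar>x - y\<bar> < r \<Longrightarrow> at_point f x = p (complex_of_real x) * at_point h x"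
      using loc by blast
    then show "at_point f y = at_point (h * Circle_Analytic q) y"
      using q[OF p, of y] by (simp add: at_q mult.commute)
  qed
  then show ?thesis by (rule dvdI)
qed

text \<open>
  The excluded constants are values of \<open>-F/G\<close> on a real segment: a differentiable image of a
  one-dimensional set in the plane, hence a null set.
\<close>

lemma ratio_avoids_generic_constant:
  assumes F: "F holomorphic_on ball (complex_of_real x0) r" and G: "G holomorphic_on ball (complex_of_real x0) r"
    and FG: "\<And>z. z \<in> ball (complex_of_real x0) r \<Longrightarrow> F z \<noteq> 0 \<or> G z \<noteq> 0"
  shows "negligible {c :: complex. \<exists>x. \<bar>x - x0\<bar> < r \<and> F (of_real x) + c * G (of_real x) = 0}"
proof -
  define S where "S = {x. \<bar>x - x0\<bar> < r \<and> G (of_real x) \<noteq> 0}"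
  have "(\<lambda>x. - F (of_real x) / G (of_real x)) differentiable_on S"
    unfolding differentiable_on_def
  proof
    fix x assume x: "x \<in> S"
    then have "complex_of_real x \<in> ball (of_real x0) r" by (simp only: S_def of_real_in_ball_iff mem_Collect_eq)
    then have "F field_differentiable at (of_real x)" "G field_differentiable at (of_real x)"
      using F G holomorphic_on_imp_differentiable_at open_ball by blast+
    then have "(\<lambda>z. - F z / G z) field_differentiable at (of_real x)"
      using x by (intro field_differentiable_divide field_differentiable_minus) (auto simp: S_def)
    then have "(\<lambda>z. - F z / G z) differentiable at (of_real x)"
      by (rule field_differentiable_imp_differentiable)
    moreover have "complex_of_real differentiable at x"
      by (simp add: bounded_linear_imp_differentiable bounded_linear_of_real)
    ultimately have "((\<lambda>z. - F z / G z) \<circ> complex_of_real) differentiable at x"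
      by (rule differentiable_chain_at[rotated])
    then show "(\<lambda>x. - F (of_real x) / G (of_real x)) differentiable at x within S"
      by (simp add: o_def differentiable_at_withinI)
  qed
  then have "negligible ((\<lambda>x. - F (of_real x) / G (of_real x)) ` S)"
    by (intro negligible_differentiable_image_lowdim) simp_all
  moreover have "{c. \<exists>x. \<bar>x - x0\<bar> < r \<and> F (of_real x) + c * G (of_real x) = 0}
      \<subseteq> (\<lambda>x. - F (of_real x) / G (of_real x)) ` S"
  proof safe
    fix c x assume x: "\<bar>x - x0\<bar> < r" "F (of_real x) + c * G (of_real x) = 0"
    then have "G (of_real x) \<noteq> 0" using FG[of "of_real x"] by (auto simp: dist_real_def abs_minus_commute)
    moreover from x(2) have "c * G (of_real x) = - F (of_real x)" by (simp add: eq_neg_iff_add_eq_0 add.commute)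
    ultimately have "c = - F (of_real x) / G (of_real x)" by (metis nonzero_mult_div_cancel_right)
    then show "c \<in> (\<lambda>x. - F (of_real x) / G (of_real x)) ` S"
      using x(1) \<open>G (of_real x) \<noteq> 0\<close> by (intro image_eqI[of _ _ x]) (simp_all add: S_def)
  qed
  ultimately show ?thesis by (rule negligible_subset)
qed

text \<open>
  Near a point, the common power of \<open>x - x0\<close> is split off; the cofactors have no common zero, and for
  almost every \<open>c\<close> their combination has no zero at all.
\<close>

lemma locally_generic_gcd:
  assumes f: "f \<noteq> 0" and g: "g \<noteq> 0"
  shows "\<exists>r>0. \<exists>N. negligible N \<and> (\<forall>c. c \<notin> N \<longrightarrow> (\<forall>y. \<bar>y - x0\<bar> < r \<longrightarrow>
      divides_locally (f + constant_function c * g) f y \<and>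
      divides_locally (f + constant_function c * g) g y))"
proof -
  let ?x = "complex_of_real x0"
  obtain a r1 f1 where f1: "r1 > 0" "f1 holomorphic_on ball ?x r1"
    "\<And>z. z \<in> ball ?x r1 \<Longrightarrow> f1 z \<noteq> 0"
    "\<And>x. \<bar>x - x0\<bar> < r1 \<Longrightarrow> at_point f x = of_real (x - x0) ^ a * f1 (of_real x)"
    by (rule circle_analytic_local_factorization[OF f, of x0]) (rule that)
  obtain b r2 g1 where g1: "r2 > 0" "g1 holomorphic_on ball ?x r2"
    "\<And>z. z \<in> ball ?x r2 \<Longrightarrow> g1 z \<noteq> 0"
    "\<And>x. \<bar>x - x0\<bar> < r2 \<Longrightarrow> at_point g x = of_real (x - x0) ^ b * g1 (of_real x)"
    by (rule circle_analytic_local_factorization[OF g, of x0]) (rule that)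
  define r m where "r = min r1 r2" and "m = min a b"
  define F G where "F z = (z - ?x) ^ (a - m) * f1 z" and "G z = (z - ?x) ^ (b - m) * g1 z" for z
  have r: "r > 0" using f1 g1 by (simp add: r_def)
  have sub: "ball ?x r \<subseteq> ball ?x r1" "ball ?x r \<subseteq> ball ?x r2" by (auto simp: r_def)
  have F: "F holomorphic_on ball ?x r" and G: "G holomorphic_on ball ?x r"
    unfolding F_def G_def
    by (intro holomorphic_intros holomorphic_on_subset[OF f1(2) sub(1)] holomorphic_on_subset[OF g1(2) sub(2)])+
  have FG: "F z \<noteq> 0 \<or> G z \<noteq> 0" if "z \<in> ball ?x r" for z
  proof -
    have "f1 z \<noteq> 0" "g1 z \<noteq> 0" using f1(3) g1(3) that sub by blast+
    then show ?thesis unfolding F_def G_def m_def by (cases "a \<le> b") (auto simp: min_def)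
  qed
  have fF: "at_point f x = of_real (x - x0) ^ m * F (of_real x)"
    and gG: "at_point g x = of_real (x - x0) ^ m * G (of_real x)" if "\<bar>x - x0\<bar> < r" for x
    using f1(4)[of x] g1(4)[of x] that
    by (simp_all add: F_def G_def r_def m_def flip: power_add mult.assoc)
  let ?N = "{c. \<exists>x. \<bar>x - x0\<bar> < r \<and> F (of_real x) + c * G (of_real x) = 0}"
  have "divides_locally (f + constant_function c * g) f y \<and> divides_locally (f + constant_function c * g) g y"
    if c: "c \<notin> ?N" and y: "\<bar>y - x0\<bar> < r" for c y
  proof -
    define H where "H z = F z + c * G z" for z
    have H: "H holomorphic_on ball ?x r" unfolding H_def by (intro holomorphic_intros F G)
    have yb: "complex_of_real y \<in> ball ?x r" using y by (simp only: of_real_in_ball_iff)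
    have "H (of_real y) \<noteq> 0" using c y by (auto simp: H_def)
    moreover have "continuous (at (of_real y)) H"
      using holomorphic_on_imp_continuous_on[OF H] yb by (simp add: continuous_on_eq_continuous_at)
    ultimately obtain e where e: "e > 0" "\<And>z. dist (of_real y) z < e \<Longrightarrow> H z \<noteq> 0"
      using continuous_at_avoid by blast
    define s where "s = min e (r - \<bar>y - x0\<bar>)"
    have s: "s > 0" using e y by (simp add: s_def)
    have ysub: "ball (complex_of_real y) s \<subseteq> ball ?x r"
    proof
      fix z assume "z \<in> ball (complex_of_real y) s"
      then have "dist (complex_of_real y) z < r - \<bar>y - x0\<bar>" by (simp add: s_def)
      moreover have "dist ?x (complex_of_real y) = \<bar>y - x0\<bar>" by (simp add: dist_real_def abs_minus_commute)
      ultimately show "z \<in> ball ?x r" using dist_triangle[of ?x z "complex_of_real y"] by simp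
    qed
    have nz: "H z \<noteq> 0" if "z \<in> ball (complex_of_real y) s" for z using e(2) that by (simp add: s_def)
    have dvd: "divides_locally (f + constant_function c * g) k y"
      if K: "K holomorphic_on ball ?x r"
        and kK: "\<And>x. \<bar>x - x0\<bar> < r \<Longrightarrow> at_point k x = of_real (x - x0) ^ m * K (of_real x)" for k K
      unfolding divides_locally_def
    proof (intro exI[of _ s] exI[of _ "\<lambda>z. K z / H z"] conjI allI impI)
      show "(\<lambda>z. K z / H z) holomorphic_on ball (complex_of_real y) s"
        using nz by (intro holomorphic_intros holomorphic_on_subset[OF K ysub] holomorphic_on_subset[OF H ysub]) auto
      fix x assume xy: "\<bar>x - y\<bar> < s"
      then have x: "\<bar>x - x0\<bar> < r" unfolding s_def by linarith
      have "H (of_real x) \<noteq> 0" using nz xy by (simp add: dist_real_def abs_minus_commute)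
      moreover have "at_point (f + constant_function c * g) x = of_real (x - x0) ^ m * H (of_real x)"
        using fF[OF x] gG[OF x] by (simp add: H_def algebra_simps)
      ultimately show "at_point k x = K (of_real x) / H (of_real x) * at_point (f + constant_function c * g) x"
        using kK[OF x] by simp
    qed (use s in simp)
    show ?thesis using dvd[OF F fF] dvd[OF G gG] by blast
  qed
  moreover have "negligible ?N" by (rule ratio_avoids_generic_constant[OF F G FG])
  ultimately show ?thesis using r by blast
qed

text \<open>
  Countably many of the neighbourhoods cover the line, and a countable union of null sets does not
  exhaust the plane, so one constant works at all points.
\<close>

theorem circle_analytic_generic_gcd:
  fixes f g :: circle_analytic
  shows "\<exists>c. (f + c * g) dvd f \<and> (f + c * g) dvd g"
proof -
  consider "g = 0" | "f = 0" | "f \<noteq> 0" "g \<noteq> 0" by blast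
  then show ?thesis
  proof cases
    case 1
    then show ?thesis by (intro exI[of _ 0]) simp
  next
    case 2
    then show ?thesis by (intro exI[of _ 1]) simp
  next
    case 3
    define P where "P x r N \<longleftrightarrow> r > 0 \<and> negligible N \<and> (\<forall>c. c \<notin> N \<longrightarrow> (\<forall>y. \<bar>y - x\<bar> < r \<longrightarrow>
        divides_locally (f + constant_function c * g) f y \<and>
        divides_locally (f + constant_function c * g) g y))" for x r N
    have "\<forall>x. \<exists>r N. P x r N" using locally_generic_gcd[OF 3] unfolding P_def by blast
    then obtain r N where rN: "\<And>x. P x (r x) (N x)" by metis
    have r: "r x > 0" and N: "negligible (N x)" for x using rN[of x] by (simp_all add: P_def)
    have dvd: "divides_locally (f + constant_function c * g) f y \<and>
        divides_locally (f + constant_function c * g) g y" if "c \<notin> N x" "\<bar>y - x\<bar> < r x" for x c y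
      using rN[of x] that by (simp add: P_def)
    obtain F' where F': "F' \<subseteq> (\<lambda>x. ball x (r x)) ` UNIV" "countable F'"
        "\<Union>F' = \<Union>((\<lambda>x. ball x (r x)) ` UNIV)"
      by (rule Lindelof[of "(\<lambda>x. ball x (r x)) ` UNIV"]) auto
    obtain X where X: "countable X" "F' = (\<lambda>x. ball x (r x)) ` X"
      using F'(1,2) countable_subset_image[of F' "\<lambda>x. ball x (r x)" UNIV] by blast
    have "negligible (\<Union>x\<in>X. N x)"
      using X(1) N by (intro negligible_countable_Union) auto
    then obtain c where c: "c \<notin> (\<Union>x\<in>X. N x)"
      using non_negligible_UNIV by (metis UNIV_eq_I)
    let ?h = "f + constant_function c * g"
    have loc: "divides_locally ?h f y \<and> divides_locally ?h g y" for y
    proof -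
      have "y \<in> ball y (r y)" using r by simp
      then have "y \<in> (\<Union>x. ball x (r x))" by blast
      then obtain x where "x \<in> X" "y \<in> ball x (r x)" using F'(3) X(2) by blast
      then show ?thesis using dvd[of c x y] c by (auto simp: dist_real_def abs_minus_commute)
    qed
    have "?h \<noteq> 0"
    proof
      assume h0: "?h = 0"
      have "at_point f y = 0" for y
        using loc[of y] unfolding divides_locally_def h0 by auto
      then show False using nonzero_at_some_point[OF 3(1)] by blast
    qed
    then show ?thesis using loc dvd_if_divides_locally by blast
  qed
qed

lemma comm_ring_hom_at_point: "comm_ring_hom (\<lambda>f. at_point f x)"
  by unfold_locales auto

lemma skew_bezout_domain_rotate_circle: "skew_bezout_domain (rotate_circle \<alpha>)"
proof unfold_locales
  show "\<exists>c. (f + c * g) dvd f \<and> (f + c * g) dvd g" for f g :: circle_analytic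
    by (rule circle_analytic_generic_gcd)
qed (auto intro: circle_analytic_eqI)

lemma at_point_shift_int:
  "at_point f (x + of_int k) = at_point f x"
proof -
  have nat: "at_point f (y + real n) = at_point f y" for n y
  proof (induction n)
    case (Suc n)
    then show ?case using at_point_periodic[of f "y + real n"] by (simp add: add_ac)
  qed simp
  show ?thesis
  proof (cases "k \<ge> 0")
    case True
    then show ?thesis using nat[of x "nat k"] by simp
  next
    case False
    then show ?thesis using nat[of "x + of_int k" "nat (- k)"] by simp
  qed
qed

lemma circle_analytic_bounded: "\<exists>K. \<forall>x. cmod (at_point f x) \<le> K"
proof -
  have "compact (at_point f ` {0..1})"
    using continuous_on_subset[OF real_analytic_continuous[OF real_analytic_at_point] subset_UNIV]
    by (rule compact_continuous_image) simp
  from compact_imp_bounded[OF this] obtain K where K: "\<And>x. x \<in> {0..1} \<Longrightarrow> cmod (at_point f x) \<le> K"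
    unfolding bounded_iff by blast
  have "cmod (at_point f x) \<le> K" for x
  proof -
    have "frac x + of_int \<lfloor>x\<rfloor> = x" by (simp add: frac_def)
    then have "at_point f (frac x) = at_point f x"
      using at_point_shift_int[of f "frac x" "\<lfloor>x\<rfloor>"] by simp
    then show ?thesis using K[of "frac x"] frac_ge_0[of x] frac_lt_1[of x] by simp
  qed
  then show ?thesis by blast
qed

section \<open>Integrability of logarithms\<close>
text \<open>
  The negative part of the logarithm of the modulus, infinite at the zeros.
\<close>

definition log_defect :: "circle_analytic \<Rightarrow> real \<Rightarrow> ennreal" where
  "log_defect f x = e2ennreal (- eln (cmod (at_point f x)))"

lemma log_defect_measurable [measurable]: "log_defect f \<in> borel_measurable borel"
proof -
  have [measurable]: "at_point f \<in> borel_measurable borel"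
    by (rule borel_measurable_continuous_onI[OF real_analytic_continuous[OF real_analytic_at_point]])
  show ?thesis unfolding log_defect_def eln_def by measurable
qed

lemma inverse_sqrt_nn_integral_finite:
  fixes r :: real
  assumes r: "r > 0"
  shows "(\<integral>\<^sup>+x. ennreal (\<bar>x - x0\<bar> powr (- 1/2)) * indicator {x0 - r..x0 + r} x \<partial>lborel) < \<infinity>"
proof -
  obtain I where I: "((\<lambda>x. x powr (- 1/2)) has_integral I) {0..r}"
    using has_integral_powr_from_0[of "- 1/2" r] r by auto
  have 1: "((\<lambda>x. \<bar>x\<bar> powr (- 1/2)) has_integral I) {0..r}"
    by (rule has_integral_eq[OF _ I]) auto
  have "((\<lambda>x. \<bar>- x\<bar> powr (- 1/2)) has_integral I) {- r..- 0}"
    using 1 by (subst has_integral_reflect_real) auto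
  then have "((\<lambda>x. \<bar>x\<bar> powr (- 1/2)) has_integral (I + I)) {- r..r}"
    using has_integral_combine[of "- r" 0 r "\<lambda>x. \<bar>x\<bar> powr (- 1/2)" I I] 1 r by simp
  then have "(\<integral>\<^sup>+x. ennreal (indicator {- r..r} x * \<bar>x\<bar> powr (- 1/2)) \<partial>lborel) = ennreal (I + I)"
    by (intro nn_integral_has_integral_lebesgue) auto
  also have "(\<integral>\<^sup>+x. ennreal (indicator {- r..r} x * \<bar>x\<bar> powr (- 1/2)) \<partial>lborel)
     = (\<integral>\<^sup>+x. ennreal (indicator {- r..r} (- x0 + 1 * x) * \<bar>- x0 + 1 * x\<bar> powr (- 1/2)) \<partial>lborel)"
    by (subst nn_integral_real_affine[of _ 1 "- x0"]) auto
  also have "\<dots> = (\<integral>\<^sup>+x. ennreal (\<bar>x - x0\<bar> powr (- 1/2)) * indicator {x0 - r..x0 + r} x \<partial>lborel)"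
    by (intro nn_integral_cong) (auto simp: indicator_def)
  finally show ?thesis by simp
qed

lemma minus_ln_le_inverse_sqrt:
  fixes s :: real
  assumes "s > 0"
  shows "- ln s \<le> 2 * s powr (- 1/2)"
proof -
  have "ln (s powr (- 1/2)) \<le> s powr (- 1/2) - 1" using assms by (intro ln_le_minus_one) simp
  then show ?thesis using assms by (simp add: ln_powr)
qed

text \<open>
  Near a zero of order \<open>m\<close> the defect is at most \<open>- m ln \<bar>x - x0\<bar>\<close> plus a constant, and
  \<open>- ln s \<le> 2 s powr (- 1/2)\<close> is integrable at 0.
\<close>

lemma log_defect_locally_integrable:
  assumes "f \<noteq> 0"
  shows "\<exists>r>0. (\<integral>\<^sup>+x. log_defect f x * indicator {x0 - r..x0 + r} x \<partial>lborel) < \<infinity>"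
proof -
  obtain m s g where s: "s > 0" and g: "g holomorphic_on ball (complex_of_real x0) s"
    "\<And>z. z \<in> ball (complex_of_real x0) s \<Longrightarrow> g z \<noteq> 0"
    "\<And>x. \<bar>x - x0\<bar> < s \<Longrightarrow> at_point f x = of_real (x - x0) ^ m * g (of_real x)"
    by (rule circle_analytic_local_factorization[OF assms, of x0]) (rule that)
  define r where "r = s / 2"
  have r: "r > 0" "r < s" using s by (auto simp: r_def)
  have inb: "complex_of_real x \<in> ball (of_real x0) s" if "x \<in> {x0 - r..x0 + r}" for x
    using that r unfolding of_real_in_ball_iff by auto
  have "continuous_on {x0 - r..x0 + r} (\<lambda>x. ln (cmod (g (of_real x))))"
    using inb g(2)
    by (intro continuous_intros continuous_on_compose2[OF holomorphic_on_imp_continuous_on[OF g(1)]]) auto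
  then have "bounded ((\<lambda>x. ln (cmod (g (of_real x)))) ` {x0 - r..x0 + r})"
    by (intro compact_imp_bounded compact_continuous_image) auto
  then obtain L where "\<And>y. y \<in> (\<lambda>x. ln (cmod (g (of_real x)))) ` {x0 - r..x0 + r} \<Longrightarrow> norm y \<le> L"
    unfolding bounded_iff by blast
  from this[OF imageI]
  have L: "\<bar>ln (cmod (g (of_real x)))\<bar> \<le> L" if "x \<in> {x0 - r..x0 + r}" for x using that by simp
  have L0: "L \<ge> 0" using L[of x0] r by auto
  let ?J = "{x0 - r..x0 + r}"
  have bound: "log_defect f x \<le> ennreal (2 * real m) * ennreal (\<bar>x - x0\<bar> powr (- 1/2)) + ennreal L"
    if x: "x \<in> ?J" "x \<noteq> x0" for x
  proof -
    have fx: "cmod (at_point f x) = \<bar>x - x0\<bar> ^ m * cmod (g (of_real x))"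
    proof -
      have "\<bar>x - x0\<bar> < s" using x(1) r by (simp only: atLeastAtMost_iff) linarith
      then show ?thesis by (simp add: g(3) norm_mult norm_power flip: of_real_diff)
    qed
    have gx: "cmod (g (of_real x)) > 0" using g(2)[OF inb[OF x(1)]] by simp
    have "- ln (cmod (at_point f x)) = real m * (- ln \<bar>x - x0\<bar>) - ln (cmod (g (of_real x)))"
      using gx x(2) by (simp add: fx ln_mult ln_realpow)
    also have "\<dots> \<le> real m * (2 * \<bar>x - x0\<bar> powr (- 1/2)) + L"
      using minus_ln_le_inverse_sqrt[of "\<bar>x - x0\<bar>"] L[OF x(1)] x(2)
      by (intro add_mono[of _ _ "- ln (cmod (g (of_real x)))" L, simplified] mult_left_mono) auto
    finally have le: "- ln (cmod (at_point f x)) \<le> 2 * real m * \<bar>x - x0\<bar> powr (- 1/2) + L" by simp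
    have "cmod (at_point f x) \<noteq> 0" using gx x(2) by (simp add: fx)
    then have "log_defect f x = ennreal (- ln (cmod (at_point f x)))"
      by (simp add: log_defect_def eln_def)
    also have "\<dots> \<le> ennreal (2 * real m * \<bar>x - x0\<bar> powr (- 1/2) + L)" using le by (rule ennreal_leI)
    also have "\<dots> = ennreal (2 * real m) * ennreal (\<bar>x - x0\<bar> powr (- 1/2)) + ennreal L"
      using L0 by (simp add: ennreal_plus ennreal_mult)
    finally show ?thesis .
  qed
  have "(\<integral>\<^sup>+x. log_defect f x * indicator ?J x \<partial>lborel) \<le>
    (\<integral>\<^sup>+x. ennreal (2 * real m) * (ennreal (\<bar>x - x0\<bar> powr (- 1/2)) * indicator ?J x) + ennreal L * indicator ?J x \<partial>lborel)"
    using AE_lborel_singleton[of x0] bound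
    by (intro nn_integral_mono_AE) (auto elim!: eventually_mono simp: indicator_def)
  also have "\<dots> = ennreal (2 * real m) * (\<integral>\<^sup>+x. ennreal (\<bar>x - x0\<bar> powr (- 1/2)) * indicator ?J x \<partial>lborel)
      + ennreal L * emeasure lborel ?J"
    by (simp add: nn_integral_add nn_integral_cmult)
  also have "\<dots> < \<infinity>"
    using inverse_sqrt_nn_integral_finite[OF r(1), of x0] r(1)
    by (simp add: ennreal_mult_less_top)
  finally show ?thesis using r(1) by blast
qed

lemma log_defect_integrable_on_compact:
  assumes "f \<noteq> 0" and "compact S"
  shows "(\<integral>\<^sup>+x. log_defect f x * indicator S x \<partial>lborel) < \<infinity>"
proof -
  define P where "P x r \<longleftrightarrow> r > 0 \<and> (\<integral>\<^sup>+y. log_defect f y * indicator {x - r..x + r} y \<partial>lborel) < \<infinity>" for x r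
  have "\<forall>x. \<exists>r. P x r" using log_defect_locally_integrable[OF assms(1)] unfolding P_def by blast
  then obtain r where "\<And>x. P x (r x)" by metis
  then have r: "\<And>x. r x > 0" "\<And>x. (\<integral>\<^sup>+y. log_defect f y * indicator {x - r x..x + r x} y \<partial>lborel) < \<infinity>"
    by (auto simp: P_def)
  have "S \<subseteq> (\<Union>x\<in>S. ball x (r x))" using r(1) by force
  from compactE_image[OF assms(2) _ this]
  obtain X where X: "X \<subseteq> S" "finite X" "S \<subseteq> (\<Union>x\<in>X. ball x (r x))" by (metis open_ball)
  have "(\<integral>\<^sup>+y. log_defect f y * indicator S y \<partial>lborel) \<le>
     (\<integral>\<^sup>+y. (\<Sum>x\<in>X. log_defect f y * indicator {x - r x..x + r x} y) \<partial>lborel)"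
  proof (rule nn_integral_mono)
    fix y
    show "log_defect f y * indicator S y \<le> (\<Sum>x\<in>X. log_defect f y * indicator {x - r x..x + r x} y)"
    proof (cases "y \<in> S")
      case True
      then obtain x where x: "x \<in> X" "y \<in> ball x (r x)" using X(3) by blast
      then have "y \<in> {x - r x..x + r x}" by (auto simp: dist_real_def abs_less_iff)
      then have "log_defect f y * indicator S y \<le> log_defect f y * indicator {x - r x..x + r x} y"
        using True by simp
      also have "\<dots> \<le> (\<Sum>x\<in>X. log_defect f y * indicator {x - r x..x + r x} y)"
        using x(1) X(2) by (intro member_le_sum) auto
      finally show ?thesis .
    qed simp
  qed
  also have "\<dots> = (\<Sum>x\<in>X. \<integral>\<^sup>+y. log_defect f y * indicator {x - r x..x + r x} y \<partial>lborel)"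
    by (intro nn_integral_sum) measurable
  also have "\<dots> < \<infinity>" using X(2)
  proof (induction X rule: finite_induct)
    case (insert x X)
    then show ?case using r(2)[of x] by simp
  qed simp
  finally show ?thesis .
qed

text \<open>
  Uniformity in the translation \<open>t\<close> is what makes the estimate along an orbit linear in its length.
  By periodicity \<open>t\<close> may be taken in the unit interval, and the interval from 0 to 2 contains all
  translates.
\<close>

lemma log_defect_uniformly_integrable:
  assumes "f \<noteq> 0"
  obtains C :: real where "C \<ge> 0" "\<And>t. (\<integral>\<^sup>+x. log_defect f (x + t) * indicator {0..1} x \<partial>lborel) \<le> ennreal C"
proof -
  let ?I = "\<integral>\<^sup>+x. log_defect f x * indicator {0..2} x \<partial>lborel"
  have "?I < \<infinity>" using assms by (intro log_defect_integrable_on_compact) auto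
  then obtain C where C: "C \<ge> 0" "?I = ennreal C" by (cases ?I) auto
  have "(\<integral>\<^sup>+x. log_defect f (x + t) * indicator {0..1} x \<partial>lborel) \<le> ennreal C" for t
  proof -
    have "x + t = (x + frac t) + of_int \<lfloor>t\<rfloor>" for x by (simp add: frac_def)
    then have per: "log_defect f (x + t) = log_defect f (x + frac t)" for x
      unfolding log_defect_def by (metis at_point_shift_int)
    have "(\<integral>\<^sup>+x. log_defect f (x + t) * indicator {0..1} x \<partial>lborel)
       = (\<integral>\<^sup>+x. log_defect f (frac t + 1 * x) * indicator {frac t..frac t + 1} (frac t + 1 * x) \<partial>lborel)"
      by (intro nn_integral_cong) (auto simp: per add.commute indicator_def)
    also have "\<dots> = (\<integral>\<^sup>+x. log_defect f x * indicator {frac t..frac t + 1} x \<partial>lborel)"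
      using nn_integral_real_affine[of "\<lambda>x. log_defect f x * indicator {frac t..frac t + 1} x" 1 "frac t"] by simp
    also have "\<dots> \<le> ?I"
    proof (rule nn_integral_mono)
      fix x
      have "x \<in> {0..2}" if "x \<in> {frac t..frac t + 1}"
        using that frac_ge_0[of t] frac_lt_1[of t] unfolding atLeastAtMost_iff by linarith
      then show "log_defect f x * indicator {frac t..frac t + 1} x \<le> log_defect f x * indicator {0..2} x"
        by (auto simp: indicator_def)
    qed
    finally show ?thesis using C by simp
  qed
  then show thesis using that C by blast
qed

section \<open>Extension to a strip\<close>

text \<open>
  The local extensions of an analytic function are glued together through this relation. It is
  single valued: the balls are centred on the real line, so two of them that meet have a connected
  intersection which contains a real segment, and there both extensions agree.
\<close>

definition extension_value :: "(real \<Rightarrow> complex) \<Rightarrow> complex \<Rightarrow> complex \<Rightarrow> bool" where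
  "extension_value f z v \<longleftrightarrow> (\<exists>x r G. local_extension f x r G \<and> z \<in> ball (of_real x) r \<and> v = G z)"

lemma Re_in_ball:
  assumes "z \<in> ball (complex_of_real x) r"
  shows "complex_of_real (Re z) \<in> ball (complex_of_real x) r"
proof -
  have "\<bar>Re (z - of_real x)\<bar> \<le> cmod (z - of_real x)" by (rule abs_Re_le_cmod)
  then show ?thesis using assms unfolding of_real_in_ball_iff by (simp add: dist_norm norm_minus_commute)
qed

lemma extension_value_unique:
  assumes "extension_value f z v" "extension_value f z w"
  shows "v = w"
proof -
  obtain x r G where G: "local_extension f x r G" "z \<in> ball (of_real x) r" "v = G z"
    using assms(1) unfolding extension_value_def by blast
  obtain y s H where H: "local_extension f y s H" "z \<in> ball (of_real y) s" "w = H z"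
    using assms(2) unfolding extension_value_def by blast
  define S where "S = ball (complex_of_real x) r \<inter> ball (complex_of_real y) s"
  have S: "open S" "connected S" "z \<in> S"
    using G H by (auto simp: S_def intro!: convex_connected convex_Int)
  have Re: "complex_of_real (Re z) \<in> S" using Re_in_ball G(2) H(2) by (auto simp: S_def)
  have "(\<lambda>u. G u - H u) z = 0"
  proof (rule analytic_continuation[of "\<lambda>u. G u - H u" S "complex_of_real ` {t. complex_of_real t \<in> S}" "of_real (Re z)"])
    show "(\<lambda>u. G u - H u) holomorphic_on S"
      using G(1) H(1) unfolding local_extension_def S_def
      by (intro holomorphic_on_diff) (auto intro: holomorphic_on_subset)
    show "complex_of_real (Re z) islimpt complex_of_real ` {t. complex_of_real t \<in> S}"
      unfolding islimpt_approachable
    proof (intro allI impI)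
      fix e :: real assume e: "e > 0"
      obtain d where d: "d > 0" "ball (complex_of_real (Re z)) d \<subseteq> S"
        using S(1) Re open_contains_ball by blast
      define t where "t = Re z + min e d / 2"
      have "dist (complex_of_real (Re z)) (of_real t) = min e d / 2"
        unfolding dist_of_real t_def dist_real_def using e d(1) by simp
      then have t: "complex_of_real t \<in> S" "dist (complex_of_real t) (of_real (Re z)) < e"
        using d e by (auto simp: dist_commute subset_iff)
      have "t \<noteq> Re z" using e d(1) by (simp add: t_def)
      then show "\<exists>x'\<in>complex_of_real ` {t. complex_of_real t \<in> S}. x' \<noteq> of_real (Re z) \<and> dist x' (of_real (Re z)) < e"
        using t by (intro bexI[of _ "of_real t"]) auto
    qed
    fix u assume "u \<in> complex_of_real ` {t. complex_of_real t \<in> S}"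
    then obtain t where t: "u = of_real t" "complex_of_real t \<in> S" by blast
    then have "\<bar>t - x\<bar> < r" "\<bar>t - y\<bar> < s" unfolding S_def by (auto simp: dist_real_def abs_minus_commute)
    then show "G u - H u = 0"
      using local_extension_of_real_in_ball[OF G(1)] local_extension_of_real_in_ball[OF H(1)] t(1) by simp
  qed (use S Re in auto)
  then show ?thesis using G(3) H(3) by simp
qed

lemma extension_value_shift_int:
  assumes v: "extension_value (at_point f) z v"
  shows "extension_value (at_point f) (z + of_int n) v"
proof -
  obtain x r G where G: "local_extension (at_point f) x r G" "z \<in> ball (of_real x) r" "v = G z"
    using v unfolding extension_value_def by blast
  have "(G \<circ> (\<lambda>w. w - of_int n)) holomorphic_on ball (of_real (x + of_int n)) r"
  proof (rule holomorphic_on_compose_gen)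
    show "G holomorphic_on ball (of_real x) r" using G(1) by (simp add: local_extension_def)
    show "(\<lambda>w. w - of_int n) ` ball (complex_of_real (x + of_int n)) r \<subseteq> ball (of_real x) r"
      by (auto simp: dist_norm algebra_simps)
  qed (intro holomorphic_intros)
  moreover have "G (of_real t - of_int n) = at_point f t" if "\<bar>t - (x + of_int n)\<bar> < r" for t
    using local_extension_of_real_in_ball[OF G(1), of "t - of_int n"] that
      at_point_shift_int[of f "t - of_int n" n] by (simp add: algebra_simps)
  ultimately have "local_extension (at_point f) (x + of_int n) r (\<lambda>w. G (w - of_int n))"
    using G(1) by (simp add: local_extension_def o_def)
  moreover have "z + of_int n \<in> ball (of_real (x + of_int n)) r" using G(2) by (simp add: dist_norm)
  ultimately show ?thesis
    unfolding extension_value_def using G(3)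
    by (intro exI[of _ "x + of_int n"] exI[of _ r] exI[of _ "\<lambda>w. G (w - of_int n)"]) simp
qed

text \<open>
  Compactness of one period makes the width of the strip positive; halving it bounds the extension.
\<close>

lemma circle_analytic_strip_extension:
  obtains \<delta> M F where "\<delta> > 0" "F holomorphic_on {z. \<bar>Im z\<bar> < \<delta>}"
    "\<And>z. \<bar>Im z\<bar> < \<delta> \<Longrightarrow> F (z + 1) = F z"
    "\<And>z. \<bar>Im z\<bar> < \<delta> \<Longrightarrow> cmod (F z) \<le> M"
    "\<And>x. F (of_real x) = at_point f x"
proof -
  define F where "F z = (SOME v. extension_value (at_point f) z v)" for z
  have F: "F z = v" if "extension_value (at_point f) z v" for z v
    unfolding F_def using that extension_value_unique by (intro some_equality)
  have ext: "\<forall>x. \<exists>r G. local_extension (at_point f) x r G"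
    using real_analytic_at_point unfolding real_analytic_iff_local_extension .
  then obtain r where r: "\<And>x. \<exists>G. local_extension (at_point f) x (r x) G" by metis
  have r0: "r x > 0" for x using r[of x] unfolding local_extension_def by blast
  have "{0..1} \<subseteq> (\<Union>x\<in>{0..1}. ball x (r x / 2))" using r0 by force
  from compactE_image[OF compact_Icc _ this]
  obtain X where X: "X \<subseteq> {0..1}" "finite X" "{0..1} \<subseteq> (\<Union>x\<in>X. ball x (r x / 2))" by (metis open_ball)
  have Xne: "X \<noteq> {}" using X(3) by force
  define \<delta> where "\<delta> = Min ((\<lambda>x. r x / 2) ` X)"
  have \<delta>0: "\<delta> > 0" unfolding \<delta>_def using X(2) Xne r0 by (subst Min_gr_iff) auto
  have exv01: "\<exists>v. extension_value (at_point f) z v" if z: "Re z \<in> {0..1}" "\<bar>Im z\<bar> < \<delta>" for z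
  proof -
    obtain x where x: "x \<in> X" "Re z \<in> ball x (r x / 2)" using X(3) z(1) by blast
    have "\<delta> \<le> r x / 2" unfolding \<delta>_def using x X(2) by (intro Min_le) auto
    then have "\<bar>Re (z - of_real x)\<bar> + \<bar>Im (z - of_real x)\<bar> < r x"
      using x(2) z(2) by (simp add: dist_real_def abs_minus_commute)
    then have "z \<in> ball (of_real x) (r x)"
      using cmod_le[of "z - of_real x"] by (simp add: dist_norm norm_minus_commute)
    then show ?thesis using r[of x] unfolding extension_value_def by blast
  qed
  have exv: "\<exists>v. extension_value (at_point f) z v" if z: "\<bar>Im z\<bar> < \<delta>" for z
  proof -
    define w where "w = z + of_int (- \<lfloor>Re z\<rfloor>)"
    have "Re w = frac (Re z)" by (simp add: w_def frac_def)
    then have "Re w \<in> {0..1}" using frac_ge_0[of "Re z"] frac_lt_1[of "Re z"] by simp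
    moreover have "\<bar>Im w\<bar> < \<delta>" using z by (simp add: w_def)
    ultimately obtain v where "extension_value (at_point f) w v" using exv01 by blast
    from extension_value_shift_int[OF this, of "\<lfloor>Re z\<rfloor>"] show ?thesis by (auto simp: w_def)
  qed
  have shift: "F (z + of_int n) = F z" if z: "\<bar>Im z\<bar> < \<delta>" for z n
  proof -
    obtain v where v: "extension_value (at_point f) z v" using exv[OF z] by blast
    show ?thesis using F[OF v] F[OF extension_value_shift_int[OF v, of n]] by simp
  qed
  have real: "F (of_real x) = at_point f x" for x
  proof -
    obtain r G where G: "local_extension (at_point f) x r G" using ext by blast
    then have "r > 0" "G (of_real x) = at_point f x" by (auto simp: local_extension_def)
    then have "extension_value (at_point f) (of_real x) (at_point f x)"
      unfolding extension_value_def using G by (intro exI[of _ x] exI[of _ r] exI[of _ G]) simp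
    then show ?thesis by (rule F)
  qed
  have hol: "F holomorphic_on {z. \<bar>Im z\<bar> < \<delta>}"
    unfolding holomorphic_on_def
  proof
    fix z assume "z \<in> {z. \<bar>Im z\<bar> < \<delta>}"
    then obtain v where "extension_value (at_point f) z v" using exv by blast
    then obtain x r G where G: "local_extension (at_point f) x r G" "z \<in> ball (of_real x) r"
      unfolding extension_value_def by blast
    have "F w = G w" if "w \<in> ball (of_real x) r" for w
      using G(1) that by (intro F) (auto simp: extension_value_def)
    moreover have "G holomorphic_on ball (of_real x) r" using G(1) by (simp add: local_extension_def)
    ultimately have "F holomorphic_on ball (of_real x) r"
      by (metis (no_types, lifting) holomorphic_transform)
    then have "F field_differentiable at z"
      using G(2) holomorphic_on_imp_differentiable_at open_ball by blast
    then show "F field_differentiable at z within {z. \<bar>Im z\<bar> < \<delta>}"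
      by (rule field_differentiable_at_within)
  qed
  define K where "K = cbox (Complex 0 (- (\<delta> / 2))) (Complex 1 (\<delta> / 2))"
  have Kiff: "z \<in> K \<longleftrightarrow> Re z \<in> {0..1} \<and> \<bar>Im z\<bar> \<le> \<delta> / 2" for z
    by (auto simp: K_def in_cbox_complex_iff)
  have "continuous_on K F"
    using \<delta>0 by (intro continuous_on_subset[OF holomorphic_on_imp_continuous_on[OF hol]]) (auto simp: Kiff)
  then have "bounded (F ` K)"
    by (intro compact_imp_bounded compact_continuous_image) (simp_all add: K_def)
  then obtain M where "\<And>y. y \<in> F ` K \<Longrightarrow> norm y \<le> M" unfolding bounded_iff by blast
  from this[OF imageI] have M: "cmod (F z) \<le> M" if "z \<in> K" for z using that .
  show thesis
  proof (rule that[of "\<delta> / 2" F M])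
    show "F holomorphic_on {z. \<bar>Im z\<bar> < \<delta> / 2}" using hol by (rule holomorphic_on_subset) (use \<delta>0 in auto)
    fix z assume z: "\<bar>Im z\<bar> < \<delta> / 2"
    then have z': "\<bar>Im z\<bar> < \<delta>" using \<delta>0 by simp
    show "F (z + 1) = F z" using shift[OF z', of 1] by simp
    have "Re (z + of_int (- \<lfloor>Re z\<rfloor>)) = frac (Re z)" by (simp add: frac_def)
    then have "z + of_int (- \<lfloor>Re z\<rfloor>) \<in> K"
      unfolding Kiff using frac_ge_0[of "Re z"] frac_lt_1[of "Re z"] z by simp
    then show "cmod (F z) \<le> M" using M shift[OF z', of "- \<lfloor>Re z\<rfloor>"] by metis
  qed (use \<delta>0 real in auto)
qed

section \<open>Cocycles as matrices over the ring of analytic functions\<close>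
definition eval_mat :: "circle_analytic mat \<Rightarrow> real \<Rightarrow> complex mat" where
  "eval_mat M x = map_mat (\<lambda>f. at_point f x) M"

lemma eval_mat_carrier [simp]: "eval_mat M x \<in> carrier_mat n m \<longleftrightarrow> M \<in> carrier_mat n m"
  by (simp add: eval_mat_def)

lemma index_eval_mat:
  "M \<in> carrier_mat n m \<Longrightarrow> i < n \<Longrightarrow> j < m \<Longrightarrow> eval_mat M x $$ (i, j) = at_point (M $$ (i, j)) x"
  by (simp add: eval_mat_def)

lemma eval_mat_mult:
  assumes "M \<in> carrier_mat n m" "N \<in> carrier_mat m k"
  shows "eval_mat (M * N) x = eval_mat M x * eval_mat N x"
proof -
  interpret comm_ring_hom "\<lambda>f. at_point f x" by (rule comm_ring_hom_at_point)
  show ?thesis unfolding eval_mat_def using assms by (rule mat_hom_mult)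
qed

lemma eval_mat_one: "eval_mat (1\<^sub>m n) x = 1\<^sub>m n"
  by (intro eq_matI) (auto simp: eval_mat_def)

lemma det_eval_mat: "det (eval_mat M x) = at_point (det M) x"
proof -
  interpret comm_ring_hom "\<lambda>f. at_point f x" by (rule comm_ring_hom_at_point)
  show ?thesis unfolding eval_mat_def by simp
qed

lemma eval_mat_rotate:
  "eval_mat (map_mat (rotate_circle \<alpha>) M) x = eval_mat M (x + \<alpha>)"
  by (intro eq_matI) (auto simp: eval_mat_def)

lemma periodic_analytic_eval_mat:
  assumes "M \<in> carrier_mat d d"
  shows "periodic_analytic d (eval_mat M)"
  unfolding periodic_analytic_def
proof (intro conjI allI impI)
  show "eval_mat M x \<in> carrier_mat d d" for x using assms by simp
  show "eval_mat M (x + 1) = eval_mat M x" for x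
    by (intro eq_matI) (auto simp: eval_mat_def at_point_periodic)
  fix i j assume "i < d" "j < d"
  then have "(\<lambda>x. eval_mat M x $$ (i, j)) = at_point (M $$ (i, j))"
    using index_eval_mat[OF assms] by (intro ext) simp
  then show "real_analytic (\<lambda>x. eval_mat M x $$ (i, j))" by (simp add: real_analytic_at_point)
qed

lemma periodic_analytic_eq_eval_mat:
  assumes "periodic_analytic d A"
  obtains M where "M \<in> carrier_mat d d" "A = eval_mat M"
proof -
  define M where "M = mat d d (\<lambda>(i, j). Circle_Analytic (\<lambda>x. A x $$ (i, j)))"
  have A: "A x \<in> carrier_mat d d" "A (x + 1) = A x" for x using assms by (auto simp: periodic_analytic_def)
  have "at_point (Circle_Analytic (\<lambda>x. A x $$ (i, j))) = (\<lambda>x. A x $$ (i, j))" if "i < d" "j < d" for i j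
    using assms that A by (intro Circle_Analytic_inverse) (simp add: periodic_analytic_def)
  then have "A x = eval_mat M x" for x
    using A(1)[of x] by (intro eq_matI) (auto simp: eval_mat_def M_def)
  then have "A = eval_mat M" by (rule ext)
  moreover have "M \<in> carrier_mat d d" by (simp add: M_def)
  ultimately show thesis using that by blast
qed

lemma eval_mat_entries_bounded:
  fixes M :: "circle_analytic mat"
  obtains K where "K > 0" "\<And>i j x. i < d \<Longrightarrow> j < d \<Longrightarrow> cmod (at_point (M $$ (i, j)) x) \<le> K"
proof -
  have "\<forall>i j. \<exists>K. \<forall>x. cmod (at_point (M $$ (i, j)) x) \<le> K"
    using circle_analytic_bounded by blast
  then obtain k where k: "\<And>i j x. cmod (at_point (M $$ (i, j)) x) \<le> k i j" by metis
  define K where "K = 1 + (\<Sum>i<d. \<Sum>j<d. \<bar>k i j\<bar>)"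
  have "cmod (at_point (M $$ (i, j)) x) \<le> K" if ij: "i < d" "j < d" for i j x
  proof -
    have "cmod (at_point (M $$ (i, j)) x) \<le> \<bar>k i j\<bar>" using k[of i j x] by linarith
    also have "\<dots> \<le> (\<Sum>j<d. \<bar>k i j\<bar>)" using ij by (intro member_le_sum) auto
    also have "\<dots> \<le> (\<Sum>i<d. \<Sum>j<d. \<bar>k i j\<bar>)"
      using ij by (intro member_le_sum[of i "{..<d}" "\<lambda>i. \<Sum>j<d. \<bar>k i j\<bar>"]) (auto simp: sum_nonneg)
    finally show ?thesis by (simp add: K_def)
  qed
  moreover have "K > 0" by (simp add: K_def sum_nonneg add_pos_nonneg)
  ultimately show thesis using that by blast
qed

lemma eval_mat_norm1_bound:
  assumes M: "M \<in> carrier_mat d d"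
  obtains K where "K > 0" "\<And>x v. v \<in> carrier_vec d \<Longrightarrow> norm1 (eval_mat M x *\<^sub>v v) \<le> K * norm1 v"
proof -
  obtain k where k: "k > 0" "\<And>i j x. i < d \<Longrightarrow> j < d \<Longrightarrow> cmod (at_point (M $$ (i, j)) x) \<le> k"
    using eval_mat_entries_bounded[of d M] by blast
  have "norm1 (eval_mat M x *\<^sub>v v) \<le> (real d * k + 1) * norm1 v" if v: "v \<in> carrier_vec d" for x v
  proof -
    have Mx: "eval_mat M x \<in> carrier_mat d d" using M by simp
    have "norm1 (eval_mat M x *\<^sub>v v) = (\<Sum>i<d. cmod (\<Sum>j<d. eval_mat M x $$ (i, j) * v $ j))"
      unfolding norm1_def using Mx v
      by (intro sum.cong) (auto simp: index_mult_mat_vec_sum[OF Mx v] simp del: index_mult_mat_vec)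
    also have "\<dots> \<le> (\<Sum>i<d. \<Sum>j<d. k * cmod (v $ j))"
      using k by (intro sum_mono order_trans[OF norm_sum]) (auto simp: index_eval_mat[OF M] norm_mult mult_right_mono)
    also have "\<dots> = real d * k * norm1 v" using v by (simp add: norm1_def sum_distrib_left mult_ac)
    also have "\<dots> \<le> (real d * k + 1) * norm1 v" using norm1_nonneg by (simp add: distrib_right)
    finally show ?thesis .
  qed
  moreover have "real d * k + 1 > 0" using k(1) by (simp add: add_nonneg_pos)
  ultimately show thesis using that by blast
qed

text \<open>
  The pointwise form of a change of frame in which the triangular form is used from here on.
\<close>

lemma eval_mat_change_of_frame:
  assumes M: "M \<in> carrier_mat d d" and U: "U \<in> carrier_mat d d" and V: "V \<in> carrier_mat d d"
    and UV: "U * V = 1\<^sub>m d"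
  shows "eval_mat U x * eval_mat V x = 1\<^sub>m d" and "eval_mat V x * eval_mat U x = 1\<^sub>m d"
    and "eval_mat M x * eval_mat U x =
           eval_mat U (x + \<alpha>) * eval_mat (map_mat (rotate_circle \<alpha>) V * M * U) x"
proof -
  let ?V' = "map_mat (rotate_circle \<alpha>) V"
  have V': "?V' \<in> carrier_mat d d" using V by simp
  have c: "eval_mat M x \<in> carrier_mat d d" "eval_mat U x \<in> carrier_mat d d" "eval_mat V x \<in> carrier_mat d d" for x
    using M U V by simp_all
  have UVx: "eval_mat U x * eval_mat V x = 1\<^sub>m d" for x
    using eval_mat_mult[OF U V, of x] by (simp add: UV eval_mat_one)
  then show "eval_mat U x * eval_mat V x = 1\<^sub>m d" .
  show "eval_mat V x * eval_mat U x = 1\<^sub>m d"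
    using mat_mult_left_right_inverse[OF c(2,3) UVx] .
  have "eval_mat U (x + \<alpha>) * eval_mat (?V' * M * U) x =
      eval_mat U (x + \<alpha>) * (eval_mat V (x + \<alpha>) * (eval_mat M x * eval_mat U x))"
    using eval_mat_mult[OF mult_carrier_mat[OF V' M] U] eval_mat_mult[OF V' M]
      assoc_mult_mat[OF c(3) c(1) c(2), of "x + \<alpha>" x x] by (simp add: eval_mat_rotate)
  also have "\<dots> = (eval_mat U (x + \<alpha>) * eval_mat V (x + \<alpha>)) * (eval_mat M x * eval_mat U x)"
    by (rule assoc_mult_mat[OF c(2) c(3) mult_carrier_mat[OF c(1) c(2)], symmetric])
  finally show "eval_mat M x * eval_mat U x = eval_mat U (x + \<alpha>) * eval_mat (?V' * M * U) x"
    using left_mult_one_mat[OF mult_carrier_mat[OF c(1) c(2)]] by (simp add: UVx)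
qed

lemma cocycle_iter_carrier:
  assumes "\<And>x. A x \<in> carrier_mat d d"
  shows "cocycle_iter d \<alpha> A n x \<in> carrier_mat d d"
proof (induction n)
  case (Suc n)
  then show ?case using mult_carrier_mat[OF assms Suc] by simp
qed simp

lemma cocycle_iter_conjugation:
  assumes A: "\<And>x. A x \<in> carrier_mat d d" and U: "\<And>x. U x \<in> carrier_mat d d"
    and T: "\<And>x. T x \<in> carrier_mat d d"
    and conj: "\<And>x. A x * U x = U (x + \<alpha>) * T x"
  shows "cocycle_iter d \<alpha> A n x * U x = U (x + real n * \<alpha>) * cocycle_iter d \<alpha> T n x"
proof (induction n)
  case 0
  then show ?case using U[of x] by simp
next
  case (Suc n)
  note An = cocycle_iter_carrier[of A, OF A] and Tn = cocycle_iter_carrier[of T, OF T]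
  let ?y = "x + real n * \<alpha>"
  have y: "x + real (Suc n) * \<alpha> = ?y + \<alpha>" by (simp add: algebra_simps)
  have "cocycle_iter d \<alpha> A (Suc n) x * U x = A ?y * (cocycle_iter d \<alpha> A n x * U x)"
    using assoc_mult_mat[OF A An U] by simp
  also have "\<dots> = (A ?y * U ?y) * cocycle_iter d \<alpha> T n x"
    unfolding Suc using assoc_mult_mat[OF A U Tn] by simp
  also have "\<dots> = U (?y + \<alpha>) * cocycle_iter d \<alpha> T (Suc n) x"
    unfolding conj using assoc_mult_mat[OF U T Tn] by simp
  finally show ?case unfolding y .
qed

lemma cocycle_iter_apply:
  assumes A: "\<And>x. A x \<in> carrier_mat d d" and v: "v \<in> carrier_vec d"
  shows "cocycle_iter d \<alpha> A (Suc n) x *\<^sub>v v = A (x + real n * \<alpha>) *\<^sub>v (cocycle_iter d \<alpha> A n x *\<^sub>v v)"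
  using assoc_mult_mat_vec[OF A cocycle_iter_carrier[of A, OF A] v] by simp

lemma integral01_ge:
  assumes "(\<integral>\<^sup>+x\<in>{0..1}. e2ennreal (- f x) \<partial>lborel) \<le> ennreal c" "c \<ge> 0"
  shows "integral01 f \<ge> ereal (- c)"
proof -
  let ?P = "\<integral>\<^sup>+x\<in>{0..1}. e2ennreal (f x) \<partial>lborel" and ?N = "\<integral>\<^sup>+x\<in>{0..1}. e2ennreal (- f x) \<partial>lborel"
  have "enn2ereal ?N \<le> enn2ereal (ennreal c)" using assms(1) by (simp add: less_eq_ennreal.rep_eq)
  then have "enn2ereal ?N \<le> ereal c" using assms(2) by (simp add: enn2ereal_ennreal)
  moreover have "enn2ereal ?P \<ge> 0" by simp
  ultimately have "0 - ereal c \<le> enn2ereal ?P - enn2ereal ?N" by (intro ereal_minus_mono)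
  then show ?thesis by (simp add: integral01_def)
qed

lemma integral01_bounds:
  assumes "\<And>x. f x = ereal (g x)" and "\<And>x. lo \<le> g x" "\<And>x. g x \<le> hi"
  obtains I where "integral01 f = ereal I" "lo \<le> I" "I \<le> hi"
proof -
  let ?P = "\<integral>\<^sup>+x\<in>{0..1}. e2ennreal (f x) \<partial>lborel" and ?N = "\<integral>\<^sup>+x\<in>{0..1}. e2ennreal (- f x) \<partial>lborel"
  have const: "(\<integral>\<^sup>+x\<in>{0..1::real}. ennreal c \<partial>lborel) = ennreal c" for c
    by (simp add: nn_integral_cmult_indicator)
  have mono: "(\<integral>\<^sup>+x\<in>{0..1::real}. g' x \<partial>lborel) \<le> (\<integral>\<^sup>+x\<in>{0..1::real}. h' x \<partial>lborel)"
    if "\<And>x. g' x \<le> h' x" for g' h' :: "real \<Rightarrow> ennreal"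
    using that by (intro nn_integral_mono mult_right_mono) auto
  have fx: "e2ennreal (f x) = ennreal (g x)" "e2ennreal (- f x) = ennreal (- g x)" for x
    by (simp_all add: assms(1))
  have P: "ennreal lo \<le> ?P" "?P \<le> ennreal hi"
    using mono[of "\<lambda>_. ennreal lo" "\<lambda>x. ennreal (g x)"] mono[of "\<lambda>x. ennreal (g x)" "\<lambda>_. ennreal hi"]
      assms(2,3) by (simp_all add: const fx ennreal_leI)
  have N: "ennreal (- hi) \<le> ?N" "?N \<le> ennreal (- lo)"
    using mono[of "\<lambda>_. ennreal (- hi)" "\<lambda>x. ennreal (- g x)"]
      mono[of "\<lambda>x. ennreal (- g x)" "\<lambda>_. ennreal (- lo)"]
      assms(2,3) by (simp_all add: const fx ennreal_leI)
  obtain p where p: "p \<ge> 0" "?P = ennreal p" using P(2) by (cases ?P) (auto simp: top_unique)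
  obtain q where q: "q \<ge> 0" "?N = ennreal q" using N(2) by (cases ?N) (auto simp: top_unique)
  have "lo \<le> hi" using assms(2,3)[of 0] by linarith
  then have "lo \<le> p - q" "p - q \<le> hi"
    using P N p(1) q(1) unfolding p(2) q(2) by (auto simp: ennreal_le_iff2)
  moreover have "integral01 f = ereal (p - q)"
    using p q by (simp add: integral01_def enn2ereal_ennreal)
  ultimately show thesis using that by blast
qed

lemma integral01_minus_infinity: "integral01 (\<lambda>_. - \<infinity>) = - \<infinity>"
  by (simp add: integral01_def nn_integral_cmult_indicator enn2ereal_top zero_ennreal.rep_eq e2ennreal_neg)

section \<open>A nonsingular block keeps the top exponent finite\<close>
text \<open>
  Strict triangularity of the first \<open>m\<close> columns means that the coordinates from \<open>m\<close> on evolve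
  independently of the others; this seminorm sees only them.
\<close>

definition tail_norm :: "nat \<Rightarrow> complex vec \<Rightarrow> real" where
  "tail_norm m v = (\<Sum>i\<in>{m..<dim_vec v}. cmod (v $ i))"

lemma tail_norm_le_norm1: "tail_norm m v \<le> norm1 v"
  unfolding tail_norm_def norm1_def by (intro sum_mono2) auto

text \<open>
  The adjugate inverts the lower right block up to its determinant, and its entries are bounded.
\<close>

lemma tail_norm_expansion:
  assumes T: "T \<in> carrier_mat d d" and tri: "strictly_triangular_upto d m T"
  obtains K where "K > 0" "\<And>x v. v \<in> carrier_vec d \<Longrightarrow>
    cmod (at_point (det (identity_rows d m T)) x) * tail_norm m v \<le> K * tail_norm m (eval_mat T x *\<^sub>v v)"
proof -
  let ?H = "identity_rows d m T"
  have H: "?H \<in> carrier_mat d d" by (simp add: identity_rows_def)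
  define b where "b = det ?H"
  obtain K where K: "K > 0" "\<And>x v. v \<in> carrier_vec d \<Longrightarrow> norm1 (eval_mat (adj_mat ?H) x *\<^sub>v v) \<le> K * norm1 v"
    using eval_mat_norm1_bound[OF adj_mat(1)[OF H]] by blast
  have "cmod (at_point b x) * tail_norm m v \<le> K * tail_norm m (eval_mat T x *\<^sub>v v)"
    if v: "v \<in> carrier_vec d" for x v
  proof -
    define w where "w = vec d (\<lambda>i. if i < m then 0 else v $ i)"
    have w: "w \<in> carrier_vec d" by (simp add: w_def)
    have Tx: "eval_mat T x \<in> carrier_mat d d" and Hx: "eval_mat ?H x \<in> carrier_mat d d"
      and Ax: "eval_mat (adj_mat ?H) x \<in> carrier_mat d d"
      using T H adj_mat(1)[OF H] by simp_all
    have Hidx: "eval_mat ?H x $$ (i, j) =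
        (if i < m then (if i = j then 1 else 0) else at_point (T $$ (i, j)) x)" if "i < d" "j < d" for i j
      using that by (simp add: index_eval_mat[OF H]) (simp add: identity_rows_def)
    have Hw: "(eval_mat ?H x *\<^sub>v w) $ i = (if i < m then 0 else (eval_mat T x *\<^sub>v v) $ i)" if i: "i < d" for i
    proof (cases "i < m")
      case True
      have "(\<Sum>j<d. eval_mat ?H x $$ (i, j) * w $ j) = 0"
        using True i by (intro sum.neutral) (auto simp: Hidx w_def)
      then show ?thesis using True index_mult_mat_vec_sum[OF Hx w i] by simp
    next
      case False
      have "(\<Sum>j<d. eval_mat ?H x $$ (i, j) * w $ j) = (\<Sum>j<d. eval_mat T x $$ (i, j) * v $ j)"
        using False i tri
        by (intro sum.cong refl)
           (auto simp: Hidx index_eval_mat[OF T] w_def strictly_triangular_upto_def)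
      then show ?thesis
        using False index_mult_mat_vec_sum[OF Hx w i] index_mult_mat_vec_sum[OF Tx v i] by simp
    qed
    have norm_Hw: "norm1 (eval_mat ?H x *\<^sub>v w) = tail_norm m (eval_mat T x *\<^sub>v v)"
    proof -
      have "norm1 (eval_mat ?H x *\<^sub>v w) = (\<Sum>i<d. cmod ((eval_mat ?H x *\<^sub>v w) $ i))"
        using Hx by (simp add: norm1_def)
      also have "\<dots> = (\<Sum>i\<in>{m..<d}. cmod ((eval_mat T x *\<^sub>v v) $ i))"
        by (rule sum.mono_neutral_cong_right) (auto simp: Hw simp del: index_mult_mat_vec)
      finally show ?thesis using Tx by (simp add: tail_norm_def)
    qed
    have norm_w: "norm1 (at_point b x \<cdot>\<^sub>v w) = cmod (at_point b x) * tail_norm m v"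
    proof -
      have "norm1 (at_point b x \<cdot>\<^sub>v w) = (\<Sum>i<d. cmod (at_point b x) * cmod (w $ i))"
        using w by (simp add: norm1_def norm_mult)
      also have "\<dots> = (\<Sum>i\<in>{m..<d}. cmod (at_point b x) * cmod (v $ i))"
        by (rule sum.mono_neutral_cong_right) (auto simp: w_def)
      finally show ?thesis using v by (simp add: tail_norm_def sum_distrib_left)
    qed
    have "eval_mat (adj_mat ?H) x * eval_mat ?H x = eval_mat (b \<cdot>\<^sub>m 1\<^sub>m d) x"
      using eval_mat_mult[OF adj_mat(1)[OF H] H] adj_mat(3)[OF H] by (simp add: b_def)
    also have "\<dots> = at_point b x \<cdot>\<^sub>m 1\<^sub>m d" by (intro eq_matI) (auto simp: eval_mat_def)
    finally have "eval_mat (adj_mat ?H) x *\<^sub>v (eval_mat ?H x *\<^sub>v w) = (at_point b x \<cdot>\<^sub>m 1\<^sub>m d) *\<^sub>v w"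
      using assoc_mult_mat_vec[OF Ax Hx w] by simp
    also have "\<dots> = at_point b x \<cdot>\<^sub>v w"
    proof (rule eq_vecI)
      fix i assume "i < dim_vec (at_point b x \<cdot>\<^sub>v w)"
      then have i: "i < d" using w by simp
      have "((at_point b x \<cdot>\<^sub>m 1\<^sub>m d) *\<^sub>v w) $ i = (\<Sum>j<d. (at_point b x \<cdot>\<^sub>m 1\<^sub>m d) $$ (i, j) * w $ j)"
        by (rule index_mult_mat_vec_sum[OF _ w i]) simp
      also have "\<dots> = (\<Sum>j<d. if j = i then at_point b x * w $ j else 0)"
        using i by (intro sum.cong) auto
      finally show "((at_point b x \<cdot>\<^sub>m 1\<^sub>m d) *\<^sub>v w) $ i = (at_point b x \<cdot>\<^sub>v w) $ i"
        using i w by simp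
    qed (use w in simp)
    finally have "norm1 (at_point b x \<cdot>\<^sub>v w) \<le> K * norm1 (eval_mat ?H x *\<^sub>v w)"
      using K(2)[of "eval_mat ?H x *\<^sub>v w" x] Hx w by (metis mult_mat_vec_carrier)
    then show ?thesis unfolding norm_w norm_Hw .
  qed
  then show thesis using that[of K] K(1) unfolding b_def by blast
qed

lemma tail_norm_cocycle_expansion:
  assumes T: "\<And>x. T x \<in> carrier_mat d d" and v: "v \<in> carrier_vec d"
    and expand: "\<And>x v. v \<in> carrier_vec d \<Longrightarrow> \<beta> x * tail_norm m v \<le> tail_norm m (T x *\<^sub>v v)"
    and \<beta>: "\<And>x. \<beta> x \<ge> 0"
  shows "(\<Prod>j<n. \<beta> (x + real j * \<alpha>)) * tail_norm m v \<le> tail_norm m (cocycle_iter d \<alpha> T n x *\<^sub>v v)"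
proof (induction n)
  case 0
  then show ?case using v by simp
next
  case (Suc n)
  let ?y = "x + real n * \<alpha>"
  have Tv: "cocycle_iter d \<alpha> T n x *\<^sub>v v \<in> carrier_vec d"
    using cocycle_iter_carrier[of T, OF T] v by (rule mult_mat_vec_carrier)
  have "(\<Prod>j<Suc n. \<beta> (x + real j * \<alpha>)) * tail_norm m v = \<beta> ?y * ((\<Prod>j<n. \<beta> (x + real j * \<alpha>)) * tail_norm m v)"
    by (simp add: mult_ac)
  also have "\<dots> \<le> \<beta> ?y * tail_norm m (cocycle_iter d \<alpha> T n x *\<^sub>v v)"
    using Suc \<beta> by (rule mult_left_mono)
  also have "\<dots> \<le> tail_norm m (T ?y *\<^sub>v (cocycle_iter d \<alpha> T n x *\<^sub>v v))"
    by (rule expand[OF Tv])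
  finally show ?case using cocycle_iter_apply[of T, OF T v] by simp
qed

lemma e2ennreal_minus_eln_le:
  assumes \<kappa>: "\<kappa> > 0" and K: "K > 0"
    and le: "(\<Prod>j<n. cmod (at_point b (x + real j * \<alpha>)) / K) \<le> \<kappa> * s"
  shows "e2ennreal (- eln s) \<le> ennreal \<bar>ln \<kappa>\<bar> + (\<Sum>j<n. ennreal \<bar>ln K\<bar> + log_defect b (x + real j * \<alpha>))"
proof (cases "\<exists>j<n. at_point b (x + real j * \<alpha>) = 0")
  case True
  then obtain j where j: "j < n" "at_point b (x + real j * \<alpha>) = 0" by blast
  have "log_defect b (x + real j * \<alpha>) = \<infinity>" using j(2) by (simp add: log_defect_def eln_def)
  then have "\<infinity> = ennreal \<bar>ln K\<bar> + log_defect b (x + real j * \<alpha>)" by simp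
  also have "\<dots> \<le> (\<Sum>j<n. ennreal \<bar>ln K\<bar> + log_defect b (x + real j * \<alpha>))"
    using j(1) by (intro member_le_sum) auto
  finally have infinite: "(\<Sum>j<n. ennreal \<bar>ln K\<bar> + log_defect b (x + real j * \<alpha>)) = \<infinity>"
    by (simp add: top_unique)
  show ?thesis unfolding infinite by simp
next
  case False
  let ?b = "\<lambda>j. cmod (at_point b (x + real j * \<alpha>))"
  have b: "?b j > 0" if "j < n" for j using False that by simp
  have pos: "(\<Prod>j<n. ?b j / K) > 0" using b K by (intro prod_pos) auto
  then have s: "s > 0" using le \<kappa> by (metis less_le_trans zero_less_mult_pos)
  have "ln (\<Prod>j<n. ?b j / K) \<le> ln (\<kappa> * s)" using le pos by simp
  moreover have "ln (\<Prod>j<n. ?b j / K) = (\<Sum>j<n. ln (?b j) - ln K)"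
    using b K by (subst ln_prod) (auto simp: ln_div intro!: sum.cong)
  ultimately have "- ln s \<le> ln \<kappa> + (\<Sum>j<n. ln K - ln (?b j))"
    using s \<kappa> by (simp add: ln_mult sum_subtractf)
  also have "\<dots> \<le> \<bar>ln \<kappa>\<bar> + (\<Sum>j<n. \<bar>ln K\<bar> + max 0 (- ln (?b j)))"
    by (intro add_mono sum_mono) auto
  finally have "ennreal (- ln s) \<le> ennreal (\<bar>ln \<kappa>\<bar> + (\<Sum>j<n. \<bar>ln K\<bar> + max 0 (- ln (?b j))))"
    by (rule ennreal_leI)
  also have "\<dots> = ennreal \<bar>ln \<kappa>\<bar> + (\<Sum>j<n. ennreal (\<bar>ln K\<bar> + max 0 (- ln (?b j))))"
    by (subst ennreal_plus, simp, intro sum_nonneg, simp, subst sum_ennreal, simp, rule refl)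
  also have "\<dots> = ennreal \<bar>ln \<kappa>\<bar> + (\<Sum>j<n. ennreal \<bar>ln K\<bar> + ennreal (- ln (?b j)))"
  proof -
    have "ennreal (\<bar>ln K\<bar> + max 0 y) = ennreal \<bar>ln K\<bar> + ennreal y" for y
      by (cases "y \<ge> 0") (simp_all add: ennreal_plus ennreal_neg)
    then show ?thesis by simp
  qed
  also have "\<dots> = ennreal \<bar>ln \<kappa>\<bar> + (\<Sum>j<n. ennreal \<bar>ln K\<bar> + log_defect b (x + real j * \<alpha>))"
    using b by (intro arg_cong2[where f = "(+)"] sum.cong refl) (auto simp: log_defect_def eln_def)
  finally show ?thesis using s by (simp add: eln_def)
qed

text \<open>
  The lower bound decreases only linearly in \<open>n\<close>, since each factor costs at most the same constant,
  wherever it sits on the orbit.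
\<close>

lemma integral_log_top_singular_value_ge:
  assumes b: "b \<noteq> 0" and \<kappa>: "\<kappa> > 0" and K: "K > 0"
  obtains C where "C \<ge> 0" "\<And>n s. (\<And>x. (\<Prod>j<n. cmod (at_point b (x + real j * \<alpha>)) / K) \<le> \<kappa> * s x) \<Longrightarrow>
      integral01 (\<lambda>x. eln (s x)) \<ge> ereal (- (real (Suc n) * C))"
proof -
  obtain C0 where C0: "C0 \<ge> 0" "\<And>t. (\<integral>\<^sup>+x. log_defect b (x + t) * indicator {0..1} x \<partial>lborel) \<le> ennreal C0"
    using log_defect_uniformly_integrable[OF b] by blast
  define C where "C = \<bar>ln \<kappa>\<bar> + \<bar>ln K\<bar> + C0"
  have "integral01 (\<lambda>x. eln (s x)) \<ge> ereal (- (real (Suc n) * C))"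
    if le: "\<And>x. (\<Prod>j<n. cmod (at_point b (x + real j * \<alpha>)) / K) \<le> \<kappa> * s x" for n s
  proof (rule integral01_ge)
    let ?i = "indicator {0..1::real} :: real \<Rightarrow> ennreal"
    have "(\<integral>\<^sup>+x\<in>{0..1}. e2ennreal (- eln (s x)) \<partial>lborel) \<le>
      (\<integral>\<^sup>+x. (ennreal \<bar>ln \<kappa>\<bar> * ?i x + (\<Sum>j<n. ennreal \<bar>ln K\<bar> * ?i x + log_defect b (x + real j * \<alpha>) * ?i x)) \<partial>lborel)"
    proof (rule nn_integral_mono)
      fix x
      have "e2ennreal (- eln (s x)) * ?i x \<le>
        (ennreal \<bar>ln \<kappa>\<bar> + (\<Sum>j<n. ennreal \<bar>ln K\<bar> + log_defect b (x + real j * \<alpha>))) * ?i x"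
        by (intro mult_right_mono e2ennreal_minus_eln_le \<kappa> K le) auto
      then show "e2ennreal (- eln (s x)) * ?i x \<le>
        ennreal \<bar>ln \<kappa>\<bar> * ?i x + (\<Sum>j<n. ennreal \<bar>ln K\<bar> * ?i x + log_defect b (x + real j * \<alpha>) * ?i x)"
        by (simp only: distrib_right sum_distrib_right)
    qed
    also have "\<dots> = ennreal \<bar>ln \<kappa>\<bar> + (\<Sum>j<n. ennreal \<bar>ln K\<bar> + (\<integral>\<^sup>+x. log_defect b (x + real j * \<alpha>) * ?i x \<partial>lborel))"
      by (subst nn_integral_add, measurable, subst nn_integral_sum, measurable, subst nn_integral_add)
         (auto simp: nn_integral_cmult)
    also have "\<dots> \<le> ennreal \<bar>ln \<kappa>\<bar> + (\<Sum>j<n. ennreal \<bar>ln K\<bar> + ennreal C0)"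
      by (intro add_left_mono sum_mono C0(2))
    also have "\<dots> = ennreal (\<bar>ln \<kappa>\<bar> + real n * (\<bar>ln K\<bar> + C0))"
      using C0(1) by (simp add: ennreal_of_nat_eq_real_of_nat flip: ennreal_plus) (simp add: ennreal_mult)
    also have "\<dots> \<le> ennreal (real (Suc n) * C)"
      using C0(1) by (intro ennreal_leI) (simp add: C_def algebra_simps)
    finally show "(\<integral>\<^sup>+x\<in>{0..1}. e2ennreal (- eln (s x)) \<partial>lborel) \<le> ennreal (real (Suc n) * C)" .
    show "0 \<le> real (Suc n) * C" using C0 by (simp add: C_def)
  qed
  moreover have "C \<ge> 0" using C0 by (simp add: C_def)
  ultimately show thesis using that by blast
qed

lemma strictly_triangular_cocycle_vanishes:
  assumes T: "\<And>x. T x \<in> carrier_mat d d"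
    and tri: "\<And>x. strictly_triangular_upto d d (T x)" and n: "d \<le> n"
  shows "cocycle_iter d \<alpha> T n x = 0\<^sub>m d d"
proof -
  have zero: "cocycle_iter d \<alpha> T n x $$ (i, j) = 0" if "i < d" "j < d" "j < i + n" for i j n
    using that
  proof (induction n arbitrary: i)
    case (Suc n)
    note Tn = cocycle_iter_carrier[of T, OF T]
    have "cocycle_iter d \<alpha> T (Suc n) x $$ (i, j) =
      (\<Sum>l<d. T (x + real n * \<alpha>) $$ (i, l) * cocycle_iter d \<alpha> T n x $$ (l, j))"
      using index_mult_mat_sum[OF T Tn Suc.prems(1,2)] by simp
    also have "\<dots> = 0"
    proof (intro sum.neutral ballI)
      fix l assume l: "l \<in> {..<d}"
      show "T (x + real n * \<alpha>) $$ (i, l) * cocycle_iter d \<alpha> T n x $$ (l, j) = 0"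
      proof (cases "l \<le> i")
        case True
        then have "T (x + real n * \<alpha>) $$ (i, l) = 0"
          using tri Suc.prems l by (simp add: strictly_triangular_upto_def)
        then show ?thesis by simp
      next
        case False
        then show ?thesis using Suc l by simp
      qed
    qed
    finally show ?case .
  qed simp
  show ?thesis
    using zero n cocycle_iter_carrier[of T, OF T, of \<alpha> n x] by (intro eq_matI) auto
qed

lemma has_lyapunov_exponent_of_eventually_zero:
  assumes zero: "\<And>n x. N \<le> n \<Longrightarrow> cocycle_iter d \<alpha> A n x = 0\<^sub>m d d" and k: "k \<in> {1..d}"
  shows "has_lyapunov_exponent d \<alpha> A k (- \<infinity>)"
proof -
  have "ereal (1 / real n) * integral01 (\<lambda>x. eln (singular_value k (cocycle_iter d \<alpha> A n x))) = - \<infinity>"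
    if "n \<ge> Suc N" for n
  proof -
    have "(\<lambda>x. eln (singular_value k (cocycle_iter d \<alpha> A n x))) = (\<lambda>_. - \<infinity>)"
      using zero[of n] that k singular_value_0_mat[of k d] by (intro ext) (simp add: eln_def)
    then show ?thesis using that by (simp add: integral01_minus_infinity)
  qed
  then show ?thesis
    unfolding has_lyapunov_exponent_def
    by (intro tendsto_eventually eventually_sequentiallyI[of "Suc N"])
qed

text \<open>
  The basis vector with index \<open>m\<close> has tail norm 1 and is followed along the orbit.
\<close>

lemma top_exponent_finite_if_rank_survives:
  assumes M: "M \<in> carrier_mat d d" and U: "U \<in> carrier_mat d d" and V: "V \<in> carrier_mat d d"
    and UV: "U * V = 1\<^sub>m d" and m: "m < d"
    and tri: "strictly_triangular_upto d m (map_mat (rotate_circle \<alpha>) V * M * U)"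
    and det: "det (identity_rows d m (map_mat (rotate_circle \<alpha>) V * M * U)) \<noteq> 0"
  shows "\<not> has_lyapunov_exponent d \<alpha> (eval_mat M) 1 (- \<infinity>)"
proof
  assume lyap: "has_lyapunov_exponent d \<alpha> (eval_mat M) 1 (- \<infinity>)"
  let ?T = "map_mat (rotate_circle \<alpha>) V * M * U"
  have V': "map_mat (rotate_circle \<alpha>) V \<in> carrier_mat d d" using V by simp
  have T: "?T \<in> carrier_mat d d" by (rule mult_carrier_mat[OF mult_carrier_mat[OF V' M] U])
  define b where "b = det (identity_rows d m ?T)"
  obtain K where K: "K > 0" "\<And>x v. v \<in> carrier_vec d \<Longrightarrow>
    cmod (at_point b x) * tail_norm m v \<le> K * tail_norm m (eval_mat ?T x *\<^sub>v v)"
    using tail_norm_expansion[OF T tri] unfolding b_def by blast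
  obtain KU where KU: "KU > 0" "\<And>x v. v \<in> carrier_vec d \<Longrightarrow> norm1 (eval_mat U x *\<^sub>v v) \<le> KU * norm1 v"
    using eval_mat_norm1_bound[OF U] by blast
  obtain KV where KV: "KV > 0" "\<And>x v. v \<in> carrier_vec d \<Longrightarrow> norm1 (eval_mat V x *\<^sub>v v) \<le> KV * norm1 v"
    using eval_mat_norm1_bound[OF V] by blast
  have c: "eval_mat M x \<in> carrier_mat d d" "eval_mat U x \<in> carrier_mat d d"
    "eval_mat V x \<in> carrier_mat d d" "eval_mat ?T x \<in> carrier_mat d d" for x
    using M U V T by simp_all
  note VU = eval_mat_change_of_frame(2)[OF M U V UV]
    and conj = eval_mat_change_of_frame(3)[OF M U V UV, of _ \<alpha>]
  let ?A = "\<lambda>n x. cocycle_iter d \<alpha> (eval_mat M) n x"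
  let ?S = "\<lambda>n x. cocycle_iter d \<alpha> (eval_mat ?T) n x"
  have An: "?A n x \<in> carrier_mat d d" and Sn: "?S n x \<in> carrier_mat d d" for n x
    by (rule cocycle_iter_carrier; rule c)+
  let ?e = "unit_vec d m :: complex vec"
  have e: "?e \<in> carrier_vec d" by simp
  have "tail_norm m ?e = (\<Sum>i\<in>{m..<d}. if i = m then 1 else 0)"
    unfolding tail_norm_def by (intro sum.cong) (auto simp: unit_vec_def)
  then have e1: "tail_norm m ?e = 1" using m by simp
  have "norm1 ?e = (\<Sum>i<d. if i = m then 1 else 0)"
    unfolding norm1_def by (intro sum.cong) (auto simp: unit_vec_def)
  then have ne: "norm1 ?e = 1" using m by simp
  define \<kappa> where "\<kappa> = KV * real d * KU"
  have \<kappa>: "\<kappa> > 0" using KV(1) KU(1) m by (simp add: \<kappa>_def)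
  have le: "(\<Prod>j<n. cmod (at_point b (x + real j * \<alpha>)) / K) \<le> \<kappa> * singular_value 1 (?A n x)" for n x
  proof -
    have Ue: "eval_mat U x *\<^sub>v ?e \<in> carrier_vec d" using c(2) e by (rule mult_mat_vec_carrier)
    have Se: "?S n x *\<^sub>v ?e \<in> carrier_vec d" using Sn e by (rule mult_mat_vec_carrier)
    let ?y = "x + real n * \<alpha>"
    have "(\<Prod>j<n. cmod (at_point b (x + real j * \<alpha>)) / K) * tail_norm m ?e \<le> tail_norm m (?S n x *\<^sub>v ?e)"
      using K by (intro tail_norm_cocycle_expansion c e) (simp_all add: field_simps)
    also have "\<dots> \<le> norm1 (?S n x *\<^sub>v ?e)" by (rule tail_norm_le_norm1)
    also have "?S n x *\<^sub>v ?e = eval_mat V ?y *\<^sub>v (?A n x *\<^sub>v (eval_mat U x *\<^sub>v ?e))"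
    proof -
      have "?A n x *\<^sub>v (eval_mat U x *\<^sub>v ?e) = (?A n x * eval_mat U x) *\<^sub>v ?e"
        by (rule assoc_mult_mat_vec[OF An c(2) e, symmetric])
      also have "?A n x * eval_mat U x = eval_mat U ?y * ?S n x"
        by (rule cocycle_iter_conjugation[of "eval_mat M" d "eval_mat U" "eval_mat ?T" \<alpha> n x, OF c(1,2,4) conj])
      also have "\<dots> *\<^sub>v ?e = eval_mat U ?y *\<^sub>v (?S n x *\<^sub>v ?e)" by (rule assoc_mult_mat_vec[OF c(2) Sn e])
      finally have "eval_mat V ?y *\<^sub>v (?A n x *\<^sub>v (eval_mat U x *\<^sub>v ?e)) = (eval_mat V ?y * eval_mat U ?y) *\<^sub>v (?S n x *\<^sub>v ?e)"
        using assoc_mult_mat_vec[OF c(3) c(2) Se] by simp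
      then show ?thesis using Se by (simp add: VU)
    qed
    also have "norm1 \<dots> \<le> KV * norm1 (?A n x *\<^sub>v (eval_mat U x *\<^sub>v ?e))"
      by (rule KV(2)[OF mult_mat_vec_carrier[OF An Ue]])
    also have "\<dots> \<le> KV * (real d * singular_value 1 (?A n x) * norm1 (eval_mat U x *\<^sub>v ?e))"
      using KV(1) norm1_mult_le_top_singular_value[OF An _ Ue] m by (intro mult_left_mono) auto
    also have "\<dots> \<le> KV * (real d * singular_value 1 (?A n x) * (KU * norm1 ?e))"
      using KV(1) KU(2)[OF e, of x] singular_value_nonneg[OF An, of 1] m
      by (intro mult_left_mono) auto
    finally show ?thesis by (simp add: e1 ne \<kappa>_def mult_ac)
  qed
  have b: "b \<noteq> 0" using det by (simp add: b_def)
  obtain C where C: "C \<ge> 0" "\<And>n s. (\<And>x. (\<Prod>j<n. cmod (at_point b (x + real j * \<alpha>)) / K) \<le> \<kappa> * s x) \<Longrightarrow>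
      integral01 (\<lambda>x. eln (s x)) \<ge> ereal (- (real (Suc n) * C))"
    using integral_log_top_singular_value_ge[OF b \<kappa> K(1)] by blast
  let ?I = "\<lambda>n. integral01 (\<lambda>x. eln (singular_value 1 (?A n x)))"
  \<comment> \<open>The factor 2 absorbs \<open>(n + 1) / n\<close>.\<close>
  have "ereal (- (2 * C)) \<le> ereal (1 / real n) * ?I n" if n: "n \<ge> 1" for n
  proof -
    have "ereal (- (2 * C)) \<le> ereal (1 / real n) * ereal (- (real (Suc n) * C))"
      using n mult_left_mono[of 1 "real n" C] C(1) by (simp add: field_simps)
    also have "\<dots> \<le> ereal (1 / real n) * ?I n"
      using C(2)[OF le, of n] by (intro ereal_mult_left_mono) auto
    finally show ?thesis .
  qed
  then have "eventually (\<lambda>n. ereal (- (2 * C)) \<le> ereal (1 / real n) * ?I n) sequentially"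
    by (intro eventually_sequentiallyI[of 1])
  moreover have "eventually (\<lambda>n. ereal (1 / real n) * ?I n < ereal (- (2 * C))) sequentially"
    using lyap unfolding has_lyapunov_exponent_def by (rule order_tendstoD) simp
  ultimately have "eventually (\<lambda>n. False) sequentially" by eventually_elim auto
  then show False by simp
qed

section \<open>Expansion in weighted norms and exponents from two-sided bounds\<close>
text \<open>
  Large \<open>R\<close> amounts to conjugation with \<open>diag(1, R, R\<^sup>2, \<dots>)\<close>, which shrinks the entries above the
  diagonal of an upper triangular matrix.
\<close>

definition weighted_norm :: "real \<Rightarrow> complex vec \<Rightarrow> real" where
  "weighted_norm R v = (\<Sum>i<dim_vec v. R ^ i * cmod (v $ i))"

lemma norm1_le_weighted_norm: "R \<ge> 1 \<Longrightarrow> norm1 v \<le> weighted_norm R v"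
  unfolding norm1_def weighted_norm_def
  by (rule sum_mono) (metis mult_1 mult_right_mono norm_ge_zero one_le_power)

lemma weighted_norm_le_norm1:
  assumes "R \<ge> 1" "v \<in> carrier_vec d"
  shows "weighted_norm R v \<le> R ^ d * norm1 v"
  unfolding norm1_def weighted_norm_def sum_distrib_left
  using assms by (intro sum_mono mult_right_mono power_increasing) auto

lemma triangular_weighted_expansion:
  assumes S: "S \<in> carrier_mat d d" and upper: "\<And>i j. j < i \<Longrightarrow> i < d \<Longrightarrow> S $$ (i, j) = 0"
    and diag: "\<And>i. i < k \<Longrightarrow> \<rho> \<le> cmod (S $$ (i, i))"
    and B: "\<And>i j. i < j \<Longrightarrow> j < d \<Longrightarrow> cmod (S $$ (i, j)) \<le> B" "B \<ge> 0"
    and R: "R > 1" "B / (R - 1) \<le> \<eta>"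
    and c: "c \<in> carrier_vec d" "\<And>i. k \<le> i \<Longrightarrow> i < d \<Longrightarrow> c $ i = 0"
  shows "(\<rho> - \<eta>) * weighted_norm R c \<le> weighted_norm R (S *\<^sub>v c)"
proof -
  let ?c = "\<lambda>i. cmod (c $ i)"
  have entry: "\<rho> * ?c i - (\<Sum>j<d. if i < j then B * ?c j else 0) \<le> cmod ((S *\<^sub>v c) $ i)" if i: "i < d" for i
  proof -
    let ?r = "\<Sum>j<d. if i < j then S $$ (i, j) * c $ j else 0"
    have "(S *\<^sub>v c) $ i = (\<Sum>j<d. S $$ (i, j) * c $ j)" by (rule index_mult_mat_vec_sum[OF S c(1) i])
    also have "\<dots> = (\<Sum>j<d. (if j = i then S $$ (i, j) * c $ j else 0) + (if i < j then S $$ (i, j) * c $ j else 0))"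
    proof (intro sum.cong refl)
      fix j assume "j \<in> {..<d}"
      show "S $$ (i, j) * c $ j =
        (if j = i then S $$ (i, j) * c $ j else 0) + (if i < j then S $$ (i, j) * c $ j else 0)"
        using upper[of j i] i by (cases j i rule: linorder_cases) auto
    qed
    also have "\<dots> = S $$ (i, i) * c $ i + ?r" using i by (simp add: sum.distrib)
    finally have eq: "(S *\<^sub>v c) $ i = S $$ (i, i) * c $ i + ?r" .
    have "cmod ?r \<le> (\<Sum>j<d. if i < j then B * ?c j else 0)"
      using B by (intro order_trans[OF norm_sum] sum_mono) (auto simp: norm_mult mult_right_mono)
    moreover have "\<rho> * ?c i \<le> cmod (S $$ (i, i) * c $ i)"
      using diag[of i] c(2)[of i] i by (cases "i < k") (auto simp: norm_mult mult_right_mono)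
    moreover have "cmod (S $$ (i, i) * c $ i) - cmod ?r \<le> cmod (S $$ (i, i) * c $ i + ?r)"
      by (rule norm_diff_ineq)
    ultimately show ?thesis unfolding eq by linarith
  qed
  have geom: "(\<Sum>i<j. R ^ i) * B \<le> \<eta> * R ^ j" for j
  proof -
    have "(\<Sum>i<j. R ^ i) * B = (R ^ j - 1) * (B / (R - 1))"
      using R(1) by (simp add: sum_gp_strict field_simps)
    also have "\<dots> \<le> R ^ j * (B / (R - 1))" using R(1) B(2) by (intro mult_right_mono) auto
    also have "\<dots> \<le> R ^ j * \<eta>" using R by (intro mult_left_mono) auto
    finally show ?thesis by (simp add: mult.commute)
  qed
  have "(\<Sum>i<d. R ^ i * (\<Sum>j<d. if i < j then B * ?c j else 0)) = (\<Sum>i<d. \<Sum>j<d. if i < j then R ^ i * B * ?c j else 0)"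
    by (auto simp: sum_distrib_left mult.assoc intro!: sum.cong)
  also have "\<dots> = (\<Sum>j<d. \<Sum>i<d. if i < j then R ^ i * B * ?c j else 0)" by (rule sum.swap)
  also have "\<dots> = (\<Sum>j<d. (\<Sum>i<j. R ^ i) * B * ?c j)"
  proof (intro sum.cong refl)
    fix j assume j: "j \<in> {..<d}"
    have "(\<Sum>i<d. if i < j then R ^ i * B * ?c j else 0) = (\<Sum>i<j. R ^ i * B * ?c j)"
      using j by (intro sum.mono_neutral_cong_right) auto
    then show "(\<Sum>i<d. if i < j then R ^ i * B * ?c j else 0) = (\<Sum>i<j. R ^ i) * B * ?c j"
      by (simp add: sum_distrib_right)
  qed
  also have "\<dots> \<le> (\<Sum>j<d. \<eta> * R ^ j * ?c j)" using geom by (intro sum_mono mult_right_mono) auto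
  finally have off: "(\<Sum>i<d. R ^ i * (\<Sum>j<d. if i < j then B * ?c j else 0)) \<le> \<eta> * weighted_norm R c"
    using c(1) by (simp add: weighted_norm_def sum_distrib_left mult.assoc)
  have "(\<rho> - \<eta>) * weighted_norm R c \<le>
     \<rho> * weighted_norm R c - (\<Sum>i<d. R ^ i * (\<Sum>j<d. if i < j then B * ?c j else 0))"
    using off by (simp add: algebra_simps)
  also have "\<dots> = (\<Sum>i<d. R ^ i * (\<rho> * ?c i - (\<Sum>j<d. if i < j then B * ?c j else 0)))"
    using c(1) by (simp add: weighted_norm_def right_diff_distrib sum_subtractf sum_distrib_left mult_ac)
  also have "\<dots> \<le> (\<Sum>i<d. R ^ i * cmod ((S *\<^sub>v c) $ i))"
    using entry R(1) by (intro sum_mono mult_left_mono) auto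
  also have "\<dots> = weighted_norm R (S *\<^sub>v c)" using S by (simp add: weighted_norm_def)
  finally show ?thesis .
qed

lemma has_lyapunov_exponentI:
  assumes bounds: "\<And>\<theta>. \<theta> > 0 \<Longrightarrow> \<exists>C. \<forall>n x. singular_value k (cocycle_iter d \<alpha> A n x) > 0 \<and>
     \<bar>ln (singular_value k (cocycle_iter d \<alpha> A n x)) - real n * \<Lambda>\<bar> \<le> real n * \<theta> + C"
  shows "has_lyapunov_exponent d \<alpha> A k (ereal \<Lambda>)"
proof -
  let ?s = "\<lambda>n x. singular_value k (cocycle_iter d \<alpha> A n x)"
  let ?I = "\<lambda>n. integral01 (\<lambda>x. eln (?s n x))"
  have pos: "?s n x > 0" for n x using bounds[of 1] by force
  have finite_between: "\<exists>r. ?I n = ereal r \<and> lo \<le> r \<and> r \<le> hi"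
    if "\<And>x. lo \<le> ln (?s n x)" "\<And>x. ln (?s n x) \<le> hi" for n lo hi
  proof -
    have "eln (?s n x) = ereal (ln (?s n x))" for x using pos[of n x] by (simp add: eln_def)
    from integral01_bounds[of "\<lambda>x. eln (?s n x)" "\<lambda>x. ln (?s n x)", OF this that] show ?thesis by blast
  qed
  define J where "J n = real_of_ereal (?I n)" for n
  have J: "?I n = ereal (J n) \<and> \<bar>J n - real n * \<Lambda>\<bar> \<le> real n * \<theta> + C"
    if C: "\<And>x. \<bar>ln (?s n x) - real n * \<Lambda>\<bar> \<le> real n * \<theta> + C" for n \<theta> C
  proof -
    have "real n * \<Lambda> - (real n * \<theta> + C) \<le> ln (?s n x)" "ln (?s n x) \<le> real n * \<Lambda> + (real n * \<theta> + C)" for x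
      using C[of x] by linarith+
    from finite_between[OF this] obtain r where r: "?I n = ereal r"
      "real n * \<Lambda> - (real n * \<theta> + C) \<le> r" "r \<le> real n * \<Lambda> + (real n * \<theta> + C)" by blast
    then show ?thesis by (simp add: J_def abs_le_iff)
  qed
  obtain C1 where "\<And>n x. \<bar>ln (?s n x) - real n * \<Lambda>\<bar> \<le> real n * 1 + C1" using bounds[of 1] by auto
  then have IJ: "?I n = ereal (J n)" for n using J by blast
  have "(\<lambda>n. 1 / real n * J n) \<longlonglongrightarrow> \<Lambda>"
  proof (rule LIMSEQ_I)
    fix e :: real assume e: "e > 0"
    obtain C where "\<And>n x. \<bar>ln (?s n x) - real n * \<Lambda>\<bar> \<le> real n * (e / 2) + C" using bounds[of "e / 2"] e by auto
    then have C: "\<bar>J n - real n * \<Lambda>\<bar> \<le> real n * (e / 2) + C" for n using J by blast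
    obtain N :: nat where N: "real N > 2 * \<bar>C\<bar> / e" using reals_Archimedean2 by blast
    show "\<exists>no. \<forall>n\<ge>no. norm (1 / real n * J n - \<Lambda>) < e"
    proof (intro exI[of _ "Suc N"] allI impI)
      fix n assume n: "n \<ge> Suc N"
      then have "real n > 2 * \<bar>C\<bar> / e" using N by linarith
      then have "C < real n * (e / 2)" using e by (simp add: field_simps abs_if split: if_splits)
      then have "\<bar>J n - real n * \<Lambda>\<bar> < real n * e" using C[of n] by simp
      moreover have "J n - real n * \<Lambda> = real n * (1 / real n * J n - \<Lambda>)" using n by (simp add: field_simps)
      ultimately have "real n * \<bar>1 / real n * J n - \<Lambda>\<bar> < real n * e" by (simp only: abs_mult abs_of_nat)
      then show "norm (1 / real n * J n - \<Lambda>) < e" using n by simp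
    qed
  qed
  then have "(\<lambda>n. ereal (1 / real n * J n)) \<longlonglongrightarrow> ereal \<Lambda>" by simp
  then show ?thesis unfolding has_lyapunov_exponent_def IJ by simp
qed

text \<open>
  If the sum of the logarithms grows no faster than the sum of the lower bounds, no single one can
  exceed its lower bound. The error \<open>\<theta>\<close> is divided by \<open>d\<close> since the errors of the other \<open>d - 1\<close>
  indices add up in the upper bound for the remaining one.
\<close>

lemma exponents_from_lower_bounds_and_product:
  fixes s :: "nat \<Rightarrow> nat \<Rightarrow> real \<Rightarrow> real" and \<Lambda> :: "nat \<Rightarrow> real"
  assumes k: "k \<in> {1..d}"
    and lower: "\<And>l \<theta>. l \<in> {1..d} \<Longrightarrow> \<theta> > 0 \<Longrightarrow> \<exists>C. \<forall>n x. real n * (\<Lambda> l - \<theta>) - C \<le> ln (s l n x)"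
    and total: "\<And>n x. (\<Sum>l=1..d. ln (s l n x)) \<le> real n * (\<Sum>l=1..d. \<Lambda> l) + C0"
    and \<theta>: "\<theta> > 0"
  shows "\<exists>C. \<forall>n x. \<bar>ln (s k n x) - real n * \<Lambda> k\<bar> \<le> real n * \<theta> + C"
proof -
  define \<theta>' where "\<theta>' = \<theta> / real d"
  have d: "d \<ge> 1" using k by simp
  have \<theta>': "\<theta>' > 0" "\<theta>' \<le> \<theta>" using \<theta> d by (simp_all add: \<theta>'_def field_simps)
  have "\<forall>l. \<exists>C. l \<in> {1..d} \<longrightarrow> (\<forall>n x. real n * (\<Lambda> l - \<theta>') - C \<le> ln (s l n x))"
    using lower \<theta>'(1) by blast
  then obtain C where C: "\<And>l n x. l \<in> {1..d} \<Longrightarrow> real n * (\<Lambda> l - \<theta>') - C l \<le> ln (s l n x)" by metis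
  define D where "D = \<bar>C0\<bar> + (\<Sum>l=1..d. \<bar>C l\<bar>)"
  have "\<bar>ln (s k n x) - real n * \<Lambda> k\<bar> \<le> real n * \<theta> + D" for n x
  proof -
    have Ck: "\<bar>C k\<bar> \<le> (\<Sum>l=1..d. \<bar>C l\<bar>)" using k by (intro member_le_sum) auto
    have "real n * \<theta>' \<le> real n * \<theta>" using \<theta>' by (intro mult_left_mono) auto
    then have low: "real n * \<Lambda> k - (real n * \<theta> + D) \<le> ln (s k n x)"
      using C[OF k, of n x] Ck by (simp add: D_def algebra_simps)
    have "(\<Sum>l\<in>{1..d} - {k}. real n * (\<Lambda> l - \<theta>') - \<bar>C l\<bar>) \<le> (\<Sum>l\<in>{1..d} - {k}. ln (s l n x))"
    proof (rule sum_mono)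
      fix l assume "l \<in> {1..d} - {k}"
      then show "real n * (\<Lambda> l - \<theta>') - \<bar>C l\<bar> \<le> ln (s l n x)"
        using C[of l n x] by auto
    qed
    moreover have "(\<Sum>l=1..d. ln (s l n x)) = ln (s k n x) + (\<Sum>l\<in>{1..d} - {k}. ln (s l n x))"
      using k by (intro sum.remove) auto
    moreover have "(\<Sum>l=1..d. \<Lambda> l) = \<Lambda> k + (\<Sum>l\<in>{1..d} - {k}. \<Lambda> l)"
      using k by (intro sum.remove) auto
    moreover have "(\<Sum>l=1..d. \<bar>C l\<bar>) = \<bar>C k\<bar> + (\<Sum>l\<in>{1..d} - {k}. \<bar>C l\<bar>)"
      using k by (intro sum.remove) auto
    moreover have "(\<Sum>l\<in>{1..d} - {k}. real n * (\<Lambda> l - \<theta>') - \<bar>C l\<bar>)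
      = real n * (\<Sum>l\<in>{1..d} - {k}. \<Lambda> l) - real (d - 1) * (real n * \<theta>') - (\<Sum>l\<in>{1..d} - {k}. \<bar>C l\<bar>)"
      using k by (simp add: sum_subtractf sum_distrib_left right_diff_distrib)
    moreover have "real (d - 1) * (real n * \<theta>') \<le> real n * \<theta>"
    proof -
      have "real (d - 1) * \<theta>' \<le> real d * \<theta>'" using \<theta>' by (intro mult_right_mono) auto
      also have "\<dots> = \<theta>" using d by (simp add: \<theta>'_def)
      finally have "real n * (real (d - 1) * \<theta>') \<le> real n * \<theta>" by (intro mult_left_mono) auto
      then show ?thesis by (simp add: mult_ac)
    qed
    ultimately have "ln (s k n x) \<le> real n * \<Lambda> k + (real n * \<theta> + D)"
      using total[of n x] by (simp add: D_def algebra_simps)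
    with low show ?thesis by (simp add: abs_le_iff)
  qed
  then show ?thesis by blast
qed

section \<open>The spectrum of a triangularized cocycle\<close>
text \<open>
  The order of the diagonal makes the first \<open>k\<close> basis vectors span the space that realizes the \<open>k\<close>
  largest growth rates of \<open>S\<close>; the bounds on the frame transfer these rates to \<open>A\<close>.
\<close>

locale triangularized_cocycle =
  fixes d :: nat and \<alpha> :: real and A U V S :: "real \<Rightarrow> complex mat" and s :: "nat \<Rightarrow> complex"
    and KU KV D B :: real
  assumes A: "\<And>x. A x \<in> carrier_mat d d" and U: "\<And>x. U x \<in> carrier_mat d d"
    and V: "\<And>x. V x \<in> carrier_mat d d" and S: "\<And>x. S x \<in> carrier_mat d d"
    and conj: "\<And>x. A x * U x = U (x + \<alpha>) * S x" and VU: "\<And>x. V x * U x = 1\<^sub>m d"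
    and KU: "KU > 0" "\<And>x v. v \<in> carrier_vec d \<Longrightarrow> norm1 (U x *\<^sub>v v) \<le> KU * norm1 v"
    and KV: "KV > 0" "\<And>x v. v \<in> carrier_vec d \<Longrightarrow> norm1 (V x *\<^sub>v v) \<le> KV * norm1 v"
    and D: "\<And>x. cmod (det (U x)) \<le> D" "\<And>x. cmod (det (V x)) \<le> D"
    and upper: "\<And>x i j. j < i \<Longrightarrow> i < d \<Longrightarrow> S x $$ (i, j) = 0"
    and diag: "\<And>x i. i < d \<Longrightarrow> S x $$ (i, i) = s i" and nz: "\<And>i. i < d \<Longrightarrow> s i \<noteq> 0"
    and decreasing: "\<And>i j. i \<le> j \<Longrightarrow> j < d \<Longrightarrow> cmod (s j) \<le> cmod (s i)"
    and B: "\<And>x i j. i < j \<Longrightarrow> j < d \<Longrightarrow> cmod (S x $$ (i, j)) \<le> B" "B \<ge> 0"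
begin

lemma iterate_carrier: "cocycle_iter d \<alpha> A n x \<in> carrier_mat d d"
  and triangular_iterate_carrier: "cocycle_iter d \<alpha> S n x \<in> carrier_mat d d"
  by (rule cocycle_iter_carrier[of A, OF A], rule cocycle_iter_carrier[of S, OF S])

lemma iterate_conj: "cocycle_iter d \<alpha> A n x * U x = U (x + real n * \<alpha>) * cocycle_iter d \<alpha> S n x"
  by (rule cocycle_iter_conjugation[of A d U S, OF A U S conj])

text \<open>
  The span of the first \<open>k\<close> basis vectors is invariant, and on it every diagonal entry has at least the
  modulus of the \<open>k\<close>-th one.
\<close>

lemma weighted_expansion:
  assumes k: "1 \<le> k" "k \<le> d" and R: "R > 1" "B / (R - 1) \<le> \<eta>" and \<eta>: "\<eta> \<le> cmod (s (k - 1))"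
    and c: "c \<in> carrier_vec d" "\<And>i. k \<le> i \<Longrightarrow> i < d \<Longrightarrow> c $ i = 0"
  shows "(cmod (s (k - 1)) - \<eta>) ^ n * weighted_norm R c \<le> weighted_norm R (cocycle_iter d \<alpha> S n x *\<^sub>v c)"
proof -
  have Sc: "cocycle_iter d \<alpha> S n x *\<^sub>v c \<in> carrier_vec d" for n
    using triangular_iterate_carrier c(1) by (rule mult_mat_vec_carrier)
  have supp: "(cocycle_iter d \<alpha> S n x *\<^sub>v c) $ i = 0" if "k \<le> i" "i < d" for n i
    using that
  proof (induction n arbitrary: i)
    case (Suc n)
    have "(cocycle_iter d \<alpha> S (Suc n) x *\<^sub>v c) $ i =
      (\<Sum>j<d. S (x + real n * \<alpha>) $$ (i, j) * (cocycle_iter d \<alpha> S n x *\<^sub>v c) $ j)"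
      unfolding cocycle_iter_apply[of S, OF S c(1)]
      by (rule index_mult_mat_vec_sum[OF S Sc Suc.prems(2)])
    also have "\<dots> = 0"
    proof (intro sum.neutral ballI)
      fix j assume "j \<in> {..<d}"
      then show "S (x + real n * \<alpha>) $$ (i, j) * (cocycle_iter d \<alpha> S n x *\<^sub>v c) $ j = 0"
        using upper[of j i] Suc by (cases "j < i") auto
    qed
    finally show ?case .
  qed (use c in simp)
  have diag_k: "cmod (s (k - 1)) \<le> cmod (S x $$ (i, i))" if "i < k" for x i
    using decreasing[of i "k - 1"] diag[of i x] that k by simp
  show ?thesis
  proof (induction n)
    case 0
    then show ?case using c(1) by simp
  next
    case (Suc n)
    have "(cmod (s (k - 1)) - \<eta>) ^ Suc n * weighted_norm R c \<le> (cmod (s (k - 1)) - \<eta>) * weighted_norm R (cocycle_iter d \<alpha> S n x *\<^sub>v c)"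
      using Suc \<eta> by (simp add: mult.assoc mult_left_mono)
    also have "\<dots> \<le> weighted_norm R (S (x + real n * \<alpha>) *\<^sub>v (cocycle_iter d \<alpha> S n x *\<^sub>v c))"
      by (rule triangular_weighted_expansion[OF S upper diag_k B R Sc supp])
    finally show ?case unfolding cocycle_iter_apply[of S, OF S c(1)] .
  qed
qed

lemma singular_value_ge:
  assumes k: "1 \<le> k" "k \<le> d" and \<eta>: "0 < \<eta>" "\<eta> < cmod (s (k - 1))"
  obtains \<kappa> where "\<kappa> > 0"
    "\<And>n x. \<kappa> * (cmod (s (k - 1)) - \<eta>) ^ n \<le> singular_value k (cocycle_iter d \<alpha> A n x)"
proof -
  \<comment> \<open>This makes \<open>B / (R - 1) \<le> \<eta>\<close>, the cost of the entries above the diagonal.\<close>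
  define R where "R = 2 + B / \<eta>"
  have R1: "R > 1" using B(2) \<eta>(1) by (simp add: R_def add_pos_nonneg)
  have "B \<le> \<eta> * (R - 1)" using \<eta>(1) B(2) by (simp add: R_def field_simps)
  then have R: "R > 1" "B / (R - 1) \<le> \<eta>" using R1 by (simp_all add: divide_le_eq)
  define \<kappa> where "\<kappa> = 1 / (real d * KU * KV * R ^ d)"
  have d: "d \<ge> 1" using k by simp
  have \<kappa>: "\<kappa> > 0" using d KU(1) KV(1) R1 by (simp add: \<kappa>_def)
  have "\<kappa> * (cmod (s (k - 1)) - \<eta>) ^ n \<le> singular_value k (cocycle_iter d \<alpha> A n x)" for n x
  proof -
    let ?y = "x + real n * \<alpha>"
    let ?s = "(cmod (s (k - 1)) - \<eta>) ^ n / (KV * R ^ d)"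
    have "?s \<le> real d * KU * singular_value k (cocycle_iter d \<alpha> A n x)"
    proof (rule singular_value_lower_bound[OF iterate_carrier k U[of x]])
      fix c :: "complex vec"
      assume c: "c \<in> carrier_vec d"
      then show "norm1 (U x *\<^sub>v c) \<le> KU * norm1 c" by (rule KU(2))
    next
      fix c :: "complex vec"
      assume c: "c \<in> carrier_vec d" "\<And>i. k \<le> i \<Longrightarrow> i < d \<Longrightarrow> c $ i = 0"
      have Uc: "U x *\<^sub>v c \<in> carrier_vec d" using U c(1) by (rule mult_mat_vec_carrier)
      have Sc: "cocycle_iter d \<alpha> S n x *\<^sub>v c \<in> carrier_vec d" using triangular_iterate_carrier c(1) by (rule mult_mat_vec_carrier)
      have AUc: "cocycle_iter d \<alpha> A n x *\<^sub>v (U x *\<^sub>v c) \<in> carrier_vec d" using iterate_carrier Uc by (rule mult_mat_vec_carrier)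
      have "cocycle_iter d \<alpha> A n x *\<^sub>v (U x *\<^sub>v c) = (cocycle_iter d \<alpha> A n x * U x) *\<^sub>v c"
        by (rule assoc_mult_mat_vec[OF iterate_carrier U c(1), symmetric])
      also have "cocycle_iter d \<alpha> A n x * U x = U ?y * cocycle_iter d \<alpha> S n x"
        by (rule iterate_conj)
      also have "\<dots> *\<^sub>v c = U ?y *\<^sub>v (cocycle_iter d \<alpha> S n x *\<^sub>v c)"
        by (rule assoc_mult_mat_vec[OF U triangular_iterate_carrier c(1)])
      finally have "V ?y *\<^sub>v (cocycle_iter d \<alpha> A n x *\<^sub>v (U x *\<^sub>v c)) = cocycle_iter d \<alpha> S n x *\<^sub>v c"
        using assoc_mult_mat_vec[OF V U Sc, of ?y ?y] Sc by (simp add: VU)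
      then have 1: "norm1 (cocycle_iter d \<alpha> S n x *\<^sub>v c) \<le> KV * norm1 (cocycle_iter d \<alpha> A n x *\<^sub>v (U x *\<^sub>v c))"
        using KV(2)[OF AUc, of ?y] by simp
      have "(cmod (s (k - 1)) - \<eta>) ^ n * norm1 c \<le> (cmod (s (k - 1)) - \<eta>) ^ n * weighted_norm R c"
        using \<eta> norm1_le_weighted_norm[of R c] R1 by (intro mult_left_mono) auto
      also have "\<dots> \<le> weighted_norm R (cocycle_iter d \<alpha> S n x *\<^sub>v c)"
        using \<eta> by (intro weighted_expansion[OF k R _ c]) auto
      also have "\<dots> \<le> R ^ d * norm1 (cocycle_iter d \<alpha> S n x *\<^sub>v c)"
        using R1 Sc by (intro weighted_norm_le_norm1) auto
      also have "\<dots> \<le> R ^ d * (KV * norm1 (cocycle_iter d \<alpha> A n x *\<^sub>v (U x *\<^sub>v c)))"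
        using 1 R1 by (intro mult_left_mono) auto
      finally show "?s * norm1 c \<le> norm1 (cocycle_iter d \<alpha> A n x *\<^sub>v (U x *\<^sub>v c))"
        using KV(1) R1 by (simp add: field_simps)
    qed
    then show ?thesis using d KU(1) KV(1) R1 by (simp add: \<kappa>_def field_simps)
  qed
  with \<kappa> show thesis using that by blast
qed

lemma det_iterate:
  shows "det (cocycle_iter d \<alpha> S n x) = (\<Prod>i<d. s i) ^ n"
proof (induction n)
  case (Suc n)
  have "det (S y) = (\<Prod>i<d. s i)" for y
  proof -
    have "det (S y) = prod_list (diag_mat (S y))"
      using S upper by (intro det_upper_triangular[of _ d]) (auto simp: upper_triangular_def carrier_matD[OF S])
    also have "\<dots> = (\<Prod>i<d. s i)"
      using carrier_matD[OF S, of y] diag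
      by (simp add: prod_list_diag_prod lessThan_atLeast0)
    finally show ?thesis .
  qed
  then show ?case
    using det_mult[OF S triangular_iterate_carrier] Suc by simp
qed simp

text \<open>
  The lower bounds come from \<open>singular_value_ge\<close>; the matching upper bound for their sum comes from
  the determinant, which is multiplicative along the orbit.
\<close>

theorem has_exponents_of_diagonal:
  assumes k: "k \<in> {1..d}"
  shows "has_lyapunov_exponent d \<alpha> A k (ereal (ln (cmod (s (k - 1)))))"
proof -
  define sv where "sv l n x = singular_value l (cocycle_iter d \<alpha> A n x)" for l n x
  define \<Lambda> where "\<Lambda> l = ln (cmod (s (l - 1)))" for l
  have lower: "\<exists>C. \<forall>n x. sv l n x > 0 \<and> real n * (\<Lambda> l - \<theta>) - C \<le> ln (sv l n x)"
    if l: "l \<in> {1..d}" and \<theta>: "\<theta> > 0" for l \<theta>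
  proof -
    define \<rho> where "\<rho> = cmod (s (l - 1))"
    have l1: "l - 1 < d" using l by (simp only: atLeastAtMost_iff) linarith
    then have \<rho>: "\<rho> > 0" using nz[of "l - 1"] by (simp add: \<rho>_def)
    \<comment> \<open>An additive loss \<open>\<eta>\<close> in the rate is then a loss \<open>\<theta>\<close> in its logarithm.\<close>
    define \<eta> where "\<eta> = \<rho> * (1 - exp (- \<theta>))"
    have \<eta>: "0 < \<eta>" "\<eta> < \<rho>" using \<rho> \<theta> by (simp_all add: \<eta>_def)
    have "exp (\<Lambda> l) = \<rho>" using \<rho> unfolding \<Lambda>_def \<rho>_def by (rule exp_ln)
    then have \<rho>\<eta>: "\<rho> - \<eta> = exp (\<Lambda> l - \<theta>)"
      by (simp add: \<eta>_def exp_diff exp_minus algebra_simps inverse_eq_divide)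
    have l': "1 \<le> l" "l \<le> d" using l by auto
    obtain \<kappa> where \<kappa>: "\<kappa> > 0" "\<And>n x. \<kappa> * (\<rho> - \<eta>) ^ n \<le> sv l n x"
      using singular_value_ge[OF l' \<eta>[unfolded \<rho>_def]] unfolding sv_def \<rho>_def by blast
    have "sv l n x > 0 \<and> real n * (\<Lambda> l - \<theta>) - (- ln \<kappa>) \<le> ln (sv l n x)" for n x
    proof -
      have "0 < \<kappa> * (\<rho> - \<eta>) ^ n" using \<kappa>(1) by (simp add: \<rho>\<eta>)
      moreover from this have "0 < sv l n x" using \<kappa>(2)[of n x] by linarith
      ultimately have "ln (\<kappa> * (\<rho> - \<eta>) ^ n) \<le> ln (sv l n x)" using \<kappa>(2)[of n x] by simp
      then show ?thesis using \<kappa>(1) \<open>0 < sv l n x\<close> by (simp add: \<rho>\<eta> ln_mult ln_realpow)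
    qed
    then show ?thesis by blast
  qed
  have pos: "sv l n x > 0" if "l \<in> {1..d}" for l n x using lower[OF that, of 1] by auto
  have UVx: "U x * V x = 1\<^sub>m d" for x using mat_mult_left_right_inverse[OF V U VU] .
  have diag_pos: "(\<Prod>i<d. cmod (s i)) > 0" using nz by (intro prod_pos) auto
  have D0: "D > 0"
  proof -
    have "det (U 0) * det (V 0) = 1" using det_mult[OF U V, of 0 0] UVx by simp
    then have "det (U 0) \<noteq> 0" by auto
    then show ?thesis using D(1)[of 0] by (meson less_le_trans zero_less_norm_iff)
  qed
  have total: "(\<Sum>l=1..d. ln (sv l n x)) \<le> real n * (\<Sum>l=1..d. \<Lambda> l) + 2 * ln D" for n x
  proof -
    let ?y = "x + real n * \<alpha>"
    have "cocycle_iter d \<alpha> A n x = (cocycle_iter d \<alpha> A n x * U x) * V x"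
      using assoc_mult_mat[OF iterate_carrier U V, of n x x x] right_mult_one_mat[OF iterate_carrier] by (simp add: UVx)
    also have "\<dots> = U ?y * cocycle_iter d \<alpha> S n x * V x"
      by (simp only: iterate_conj)
    finally have "det (cocycle_iter d \<alpha> A n x)
      = det (U ?y) * (\<Prod>i<d. s i) ^ n * det (V x)"
      using det_mult[OF mult_carrier_mat[OF U triangular_iterate_carrier] V] det_mult[OF U triangular_iterate_carrier]
        det_iterate by simp
    then have "(\<Prod>l=1..d. sv l n x) = cmod (det (U ?y)) * (\<Prod>i<d. cmod (s i)) ^ n * cmod (det (V x))"
      unfolding sv_def prod_singular_values[OF iterate_carrier] by (simp add: norm_mult norm_power prod_norm)
    also have "\<dots> \<le> D * (\<Prod>i<d. cmod (s i)) ^ n * D"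
      using D(1)[of ?y] D(2)[of x] D0 diag_pos by (intro mult_mono) auto
    finally have "(\<Prod>l=1..d. sv l n x) \<le> D * (\<Prod>i<d. cmod (s i)) ^ n * D" .
    moreover have "(\<Prod>l=1..d. sv l n x) > 0" using pos by (intro prod_pos) auto
    ultimately have "ln (\<Prod>l=1..d. sv l n x) \<le> ln (D * (\<Prod>i<d. cmod (s i)) ^ n * D)" by simp
    also have "\<dots> = real n * ln (\<Prod>i<d. cmod (s i)) + 2 * ln D"
    proof -
      have "ln (D * p ^ n * D) = real n * ln p + 2 * ln D" if "p > 0" for p
        using D0 that by (simp add: ln_mult ln_realpow)
      then show ?thesis using diag_pos by blast
    qed
    also have "ln (\<Prod>i<d. cmod (s i)) = (\<Sum>i<d. ln (cmod (s i)))" using nz by (intro ln_prod) auto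
    also have "\<dots> = (\<Sum>l=1..d. \<Lambda> l)"
      unfolding \<Lambda>_def by (rule sum.reindex_bij_witness[of _ "\<lambda>l. l - 1" Suc]) auto
    also have "ln (\<Prod>l=1..d. sv l n x) = (\<Sum>l=1..d. ln (sv l n x))"
      by (intro ln_prod finite_atLeastAtMost less_imp_neq[THEN not_sym] pos)
    finally show ?thesis .
  qed
  show ?thesis
  proof (rule has_lyapunov_exponentI)
    fix \<theta> :: real assume \<theta>: "\<theta> > 0"
    have low: "\<exists>C. \<forall>n x. real n * (\<Lambda> l - \<theta>) - C \<le> ln (sv l n x)" if "l \<in> {1..d}" "\<theta> > 0" for l \<theta>
      using lower[OF that] by blast
    obtain C where "\<And>n x. \<bar>ln (sv k n x) - real n * \<Lambda> k\<bar> \<le> real n * \<theta> + C"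
      using exponents_from_lower_bounds_and_product[of k d \<Lambda> sv, OF k low total \<theta>] by blast
    then show "\<exists>C. \<forall>n x. singular_value k (cocycle_iter d \<alpha> A n x) > 0 \<and>
     \<bar>ln (singular_value k (cocycle_iter d \<alpha> A n x)) - real n * ln (cmod (s (k - 1)))\<bar> \<le> real n * \<theta> + C"
      using pos[OF k] unfolding sv_def \<Lambda>_def by blast
  qed
qed

end

section \<open>Simple spectrum after an arbitrarily small perturbation\<close>
text \<open>
  The width \<open>\<delta>\<close> depends on the matrix alone. This fixes one strip for all perturbations \<open>\<epsilon> A'\<close>, which
  are then made small on it by the choice of \<open>\<epsilon>\<close>.
\<close>

lemma uniform_strip_extension:
  assumes M: "M \<in> carrier_mat d d" and d: "d \<ge> 1"
  obtains \<delta> C G where "\<delta> > 0" "C > 0"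
    "\<And>i j. i < d \<Longrightarrow> j < d \<Longrightarrow> G i j holomorphic_on {z. \<bar>Im z\<bar> < \<delta>}"
    "\<And>i j z. i < d \<Longrightarrow> j < d \<Longrightarrow> \<bar>Im z\<bar> < \<delta> \<Longrightarrow> G i j (z + 1) = G i j z \<and> cmod (G i j z) < C"
    "\<And>i j x. i < d \<Longrightarrow> j < d \<Longrightarrow> G i j (of_real x) = at_point (M $$ (i, j)) x"
proof -
  define P where "P f \<delta> C F \<longleftrightarrow> \<delta> > 0 \<and> F holomorphic_on {z. \<bar>Im z\<bar> < \<delta>} \<and>
    (\<forall>z. \<bar>Im z\<bar> < \<delta> \<longrightarrow> F (z + 1) = F z \<and> cmod (F z) \<le> C) \<and> (\<forall>x. F (complex_of_real x) = at_point f x)"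
    for f and \<delta> C :: real and F
  have "\<exists>\<delta> C F. P f \<delta> C F" for f
  proof -
    obtain \<delta> C F where "\<delta> > 0" "F holomorphic_on {z. \<bar>Im z\<bar> < \<delta>}"
      "\<And>z. \<bar>Im z\<bar> < \<delta> \<Longrightarrow> F (z + 1) = F z" "\<And>z. \<bar>Im z\<bar> < \<delta> \<Longrightarrow> cmod (F z) \<le> C"
      "\<And>x. F (complex_of_real x) = at_point f x"
      by (rule circle_analytic_strip_extension[of f]) (rule that)
    then have "P f \<delta> C F" by (simp add: P_def)
    then show ?thesis by blast
  qed
  then obtain D C F where PDF: "\<And>f. P f (D f) (C f) (F f)" by metis
  let ?I = "{..<d} \<times> {..<d}"
  define \<delta> where "\<delta> = Min ((\<lambda>(i, j). D (M $$ (i, j))) ` ?I)"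
  define c where "c = 1 + (\<Sum>p\<in>?I. \<bar>C (M $$ p)\<bar>)"
  have ne: "?I \<noteq> {}" using d by (auto simp: lessThan_empty_iff)
  have \<delta>0: "\<delta> > 0" unfolding \<delta>_def using ne PDF by (subst Min_gr_iff) (auto simp: P_def)
  have \<delta>le: "\<delta> \<le> D (M $$ (i, j))" if "i < d" "j < d" for i j
    unfolding \<delta>_def using that by (intro Min_le) auto
  have cgt: "C (M $$ (i, j)) < c" if "i < d" "j < d" for i j
  proof -
    have "\<bar>C (M $$ (i, j))\<bar> \<le> (\<Sum>p\<in>?I. \<bar>C (M $$ p)\<bar>)" using that by (intro member_le_sum) auto
    then show ?thesis by (simp add: c_def)
  qed
  have c0: "c > 0" by (simp add: c_def add_pos_nonneg sum_nonneg)
  show thesis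
  proof (rule that[of \<delta> c "\<lambda>i j. F (M $$ (i, j))", OF \<delta>0 c0])
    fix i j assume ij: "i < d" "j < d"
    note p = PDF[of "M $$ (i, j)", unfolded P_def]
    show "F (M $$ (i, j)) holomorphic_on {z. \<bar>Im z\<bar> < \<delta>}"
      using p \<delta>le[OF ij] by (auto intro: holomorphic_on_subset)
    show "F (M $$ (i, j)) (of_real x) = at_point (M $$ (i, j)) x" for x using p by blast
    fix z assume "\<bar>Im z\<bar> < \<delta>"
    then have "\<bar>Im z\<bar> < D (M $$ (i, j))" using \<delta>le[OF ij] by linarith
    then show "F (M $$ (i, j)) (z + 1) = F (M $$ (i, j)) z \<and> cmod (F (M $$ (i, j)) z) < c"
      using p cgt[OF ij] by (meson le_less_trans)
  qed
qed

lemma small_on_strip_scaled_perturbation: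
  assumes M: "M \<in> carrier_mat d d" and d: "d \<ge> 1"
  obtains \<delta> where "\<delta> > 0" "\<And>\<eta>. \<eta> > 0 \<Longrightarrow> \<exists>\<epsilon>\<noteq>0. small_on_strip d \<delta> \<eta> (\<lambda>x. \<epsilon> \<cdot>\<^sub>m eval_mat M x)"
proof -
  obtain \<delta> C G where \<delta>: "\<delta> > 0" and C: "C > 0"
    and hol: "\<And>i j. i < d \<Longrightarrow> j < d \<Longrightarrow> G i j holomorphic_on {z. \<bar>Im z\<bar> < \<delta>}"
    and G: "\<And>i j z. i < d \<Longrightarrow> j < d \<Longrightarrow> \<bar>Im z\<bar> < \<delta> \<Longrightarrow> G i j (z + 1) = G i j z \<and> cmod (G i j z) < C"
    and real: "\<And>i j x. i < d \<Longrightarrow> j < d \<Longrightarrow> G i j (of_real x) = at_point (M $$ (i, j)) x"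
    by (rule uniform_strip_extension[OF M d]) (rule that)
  have "\<exists>\<epsilon>\<noteq>0. small_on_strip d \<delta> \<eta> (\<lambda>x. \<epsilon> \<cdot>\<^sub>m eval_mat M x)" if \<eta>: "\<eta> > 0" for \<eta>
  proof -
    define \<epsilon> where "\<epsilon> = complex_of_real (\<eta> / C)"
    have \<epsilon>: "\<epsilon> \<noteq> 0" using \<eta> C by (simp add: \<epsilon>_def)
    define F where "F z = mat d d (\<lambda>(i, j). \<epsilon> * G i j z)" for z
    have Fij: "F z $$ (i, j) = \<epsilon> * G i j z" if "i < d" "j < d" for i j z using that by (simp add: F_def)
    have "small_on_strip d \<delta> \<eta> (\<lambda>x. \<epsilon> \<cdot>\<^sub>m eval_mat M x)"
      unfolding small_on_strip_def
    proof (intro exI[of _ F] conjI allI impI)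
      fix x show "F (of_real x) = \<epsilon> \<cdot>\<^sub>m eval_mat M x"
        using M real by (intro eq_matI) (auto simp: Fij F_def index_eval_mat[OF M] eval_mat_def)
    next
      fix z :: complex assume z: "\<bar>Im z\<bar> < \<delta>"
      show "F z \<in> carrier_mat d d" by (simp add: F_def)
      show "F (z + 1) = F z" using G z by (intro eq_matI) (auto simp: F_def)
      fix i j assume ij: "i < d" "j < d"
      have "cmod (F z $$ (i, j)) = \<eta> / C * cmod (G i j z)"
        using \<eta> C by (simp add: Fij[OF ij] \<epsilon>_def norm_mult norm_divide)
      also have "\<dots> < \<eta> / C * C" using G[OF ij z] \<eta> C by (intro mult_strict_left_mono) auto
      finally show "cmod (F z $$ (i, j)) < \<eta>" using C by simp
    next
      fix i j assume ij: "i < d" "j < d"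
      show "(\<lambda>z. F z $$ (i, j)) holomorphic_on {z. \<bar>Im z\<bar> < \<delta>}"
        unfolding Fij[OF ij] by (intro holomorphic_on_mult holomorphic_on_const hol ij)
    qed
    with \<epsilon> show ?thesis by blast
  qed
  with \<delta> show thesis using that by blast
qed

text \<open>
  The diagonal \<open>d, \<dots>, 1\<close> is decreasing, so the exponents appear in their natural order, and its
  entries are positive and distinct, so multiplication by any \<open>\<epsilon> \<noteq> 0\<close> keeps the moduli distinct and
  nonzero.
\<close>

theorem nilpotent_cocycle_simple_perturbation:
  assumes M: "M \<in> carrier_mat d d" and d: "d \<ge> 1" and U: "U \<in> carrier_mat d d" and V: "V \<in> carrier_mat d d"
    and UV: "U * V = 1\<^sub>m d"
    and tri: "strictly_triangular_upto d d (map_mat (rotate_circle \<alpha>) V * M * U)"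
  shows "\<And>k. k \<in> {1..d} \<Longrightarrow> has_lyapunov_exponent d \<alpha> (eval_mat M) k (- \<infinity>)"
    and "\<exists>M' \<in> carrier_mat d d. \<forall>\<epsilon>. \<epsilon> \<noteq> 0 \<longrightarrow>
      simple_lyapunov_spectrum d \<alpha> (\<lambda>x. eval_mat M x + \<epsilon> \<cdot>\<^sub>m eval_mat M' x)"
proof -
  let ?V' = "map_mat (rotate_circle \<alpha>) V" and ?U' = "map_mat (rotate_circle \<alpha>) U"
  define T where "T = ?V' * M * U"
  have V': "?V' \<in> carrier_mat d d" and U': "?U' \<in> carrier_mat d d" using V U by simp_all
  have T: "T \<in> carrier_mat d d" unfolding T_def by (rule mult_carrier_mat[OF mult_carrier_mat[OF V' M] U])
  have c: "eval_mat M x \<in> carrier_mat d d" "eval_mat U x \<in> carrier_mat d d"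
    "eval_mat V x \<in> carrier_mat d d" "eval_mat T x \<in> carrier_mat d d" for x
    using M U V T by simp_all
  note UVx = eval_mat_change_of_frame(1)[OF M U V UV] and VU = eval_mat_change_of_frame(2)[OF M U V UV]
    and conj = eval_mat_change_of_frame(3)[OF M U V UV, of _ \<alpha>, folded T_def]
  have T0: "T $$ (i, j) = 0" if "j \<le> i" "i < d" for i j
    using tri that by (simp add: strictly_triangular_upto_def T_def)
  have trix: "strictly_triangular_upto d d (eval_mat T x)" for x
    using T0 by (auto simp: strictly_triangular_upto_def index_eval_mat[OF T])
  have "cocycle_iter d \<alpha> (eval_mat M) n x = 0\<^sub>m d d" if n: "d \<le> n" for n x
  proof -
    have An: "cocycle_iter d \<alpha> (eval_mat M) n x \<in> carrier_mat d d" for n x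
      by (rule cocycle_iter_carrier[of "eval_mat M", OF c(1)])
    have "cocycle_iter d \<alpha> (eval_mat M) n x * eval_mat U x = 0\<^sub>m d d"
      using cocycle_iter_conjugation[of "eval_mat M" d "eval_mat U" "eval_mat T", OF c(1,2,4) conj]
        strictly_triangular_cocycle_vanishes[of "eval_mat T", OF c(4) trix n] right_mult_zero_mat[OF c(2)] by simp
    then have "cocycle_iter d \<alpha> (eval_mat M) n x * (eval_mat U x * eval_mat V x) = 0\<^sub>m d d"
      using assoc_mult_mat[OF An c(2) c(3), of n x x x] left_mult_zero_mat[OF c(3)] by simp
    then show ?thesis using right_mult_one_mat[OF An] by (simp add: UVx)
  qed
  then show "has_lyapunov_exponent d \<alpha> (eval_mat M) k (- \<infinity>)" if "k \<in> {1..d}" for k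
    using that by (rule has_lyapunov_exponent_of_eventually_zero)
  define D :: "circle_analytic mat" where "D = mat d d (\<lambda>(i, j). if i = j then of_nat (d - i) else 0)"
  have D: "D \<in> carrier_mat d d" by (simp add: D_def)
  define M' where "M' = ?U' * D * V"
  have M': "M' \<in> carrier_mat d d" unfolding M'_def by (rule mult_carrier_mat[OF mult_carrier_mat[OF U' D] V])
  have at_of_nat: "at_point (of_nat n) x = of_nat n" for n x by (induction n) auto
  have Dx: "eval_mat D x \<in> carrier_mat d d" for x using D by simp
  have M'x: "eval_mat M' x = eval_mat U (x + \<alpha>) * eval_mat D x * eval_mat V x" for x
    unfolding M'_def using eval_mat_mult[OF mult_carrier_mat[OF U' D] V] eval_mat_mult[OF U' D] by (simp add: eval_mat_rotate)
  have M'c: "eval_mat M' x \<in> carrier_mat d d" for x using M' by simp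
  have UD: "eval_mat U (x + \<alpha>) * eval_mat D x \<in> carrier_mat d d" for x by (rule mult_carrier_mat[OF c(2) Dx])
  have M'conj: "eval_mat M' x * eval_mat U x = eval_mat U (x + \<alpha>) * eval_mat D x" for x
    unfolding M'x using assoc_mult_mat[OF UD c(3) c(2), of x x x] right_mult_one_mat[OF UD] by (simp add: VU)
  obtain KU where KU: "KU > 0" "\<And>x v. v \<in> carrier_vec d \<Longrightarrow> norm1 (eval_mat U x *\<^sub>v v) \<le> KU * norm1 v"
    using eval_mat_norm1_bound[OF U] by blast
  obtain KV where KV: "KV > 0" "\<And>x v. v \<in> carrier_vec d \<Longrightarrow> norm1 (eval_mat V x *\<^sub>v v) \<le> KV * norm1 v"
    using eval_mat_norm1_bound[OF V] by blast
  obtain D1 where D1: "\<And>x. cmod (det (eval_mat U x)) \<le> D1"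
    using circle_analytic_bounded[of "det U"] unfolding det_eval_mat by blast
  obtain D2 where D2: "\<And>x. cmod (det (eval_mat V x)) \<le> D2"
    using circle_analytic_bounded[of "det V"] unfolding det_eval_mat by blast
  obtain K0 where K0: "K0 > 0" "\<And>i j x. i < d \<Longrightarrow> j < d \<Longrightarrow> cmod (at_point (T $$ (i, j)) x) \<le> K0"
    using eval_mat_entries_bounded[of d T] by blast
  have "simple_lyapunov_spectrum d \<alpha> (\<lambda>x. eval_mat M x + \<epsilon> \<cdot>\<^sub>m eval_mat M' x)" if \<epsilon>: "\<epsilon> \<noteq> 0" for \<epsilon>
  proof -
    let ?A = "\<lambda>x. eval_mat M x + \<epsilon> \<cdot>\<^sub>m eval_mat M' x"
    define S where "S x = eval_mat T x + \<epsilon> \<cdot>\<^sub>m eval_mat D x" for x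
    define s where "s i = \<epsilon> * of_nat (d - i)" for i
    have A: "?A x \<in> carrier_mat d d" and S: "S x \<in> carrier_mat d d" for x
      using c M'c Dx by (auto simp: S_def)
    have conjA: "?A x * eval_mat U x = eval_mat U (x + \<alpha>) * S x" for x
    proof -
      have "?A x * eval_mat U x = eval_mat M x * eval_mat U x + (\<epsilon> \<cdot>\<^sub>m eval_mat M' x) * eval_mat U x"
        by (rule add_mult_distrib_mat[OF c(1) _ c(2)]) (simp add: M')
      also have "(\<epsilon> \<cdot>\<^sub>m eval_mat M' x) * eval_mat U x = \<epsilon> \<cdot>\<^sub>m (eval_mat M' x * eval_mat U x)"
        by (rule mult_smult_assoc_mat[OF M'c c(2)])
      also have "\<dots> = \<epsilon> \<cdot>\<^sub>m (eval_mat U (x + \<alpha>) * eval_mat D x)" unfolding M'conj ..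
      also have "\<dots> = eval_mat U (x + \<alpha>) * (\<epsilon> \<cdot>\<^sub>m eval_mat D x)"
        by (rule mult_smult_distrib[OF c(2) Dx, symmetric])
      also have "eval_mat M x * eval_mat U x + \<dots> = eval_mat U (x + \<alpha>) * S x"
        unfolding conj S_def by (rule mult_add_distrib_mat[OF c(2) c(4), symmetric]) (simp add: D)
      finally show ?thesis .
    qed
    have Sij: "S x $$ (i, j) = at_point (T $$ (i, j)) x + (if i = j then s i else 0)" if "i < d" "j < d" for x i j
      using that c(4)[of x] Dx[of x]
      by (simp add: S_def index_eval_mat[OF T] index_eval_mat[OF D]) (simp add: D_def s_def at_of_nat)
    have upper: "S x $$ (i, j) = 0" if "j < i" "i < d" for x i j
      using that Sij[of i j x] T0[of j i] by simp
    have diag: "S x $$ (i, i) = s i" if "i < d" for x i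
      using that Sij[of i i x] T0[of i i] by simp
    have nz: "s i \<noteq> 0" if "i < d" for i using \<epsilon> that by (simp add: s_def)
    have decr: "cmod (s j) \<le> cmod (s i)" if "i \<le> j" "j < d" for i j
      using that by (simp add: s_def norm_mult mult_left_mono del: of_nat_diff)
    have B: "cmod (S x $$ (i, j)) \<le> K0" if "i < j" "j < d" for x i j
      using that Sij[of i j x] K0(2)[of i j x] by simp
    interpret triangularized_cocycle d \<alpha> ?A "eval_mat U" "eval_mat V" S s KU KV "max D1 D2" K0
      by unfold_locales
        (use c A S conjA VU KU KV D1 D2 upper diag nz decr B K0(1) in \<open>auto simp: le_max_iff_disj\<close>)
    have "has_lyapunov_exponent d \<alpha> ?A k (ereal (ln (cmod (s (k - 1)))))" if "k \<in> {1..d}" for k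
      using that by (rule has_exponents_of_diagonal)
    moreover have "inj_on (\<lambda>k. ereal (ln (cmod (s (k - 1))))) {1..d}"
    proof (rule inj_onI)
      fix k l assume kl: "k \<in> {1..d}" "l \<in> {1..d}" "ereal (ln (cmod (s (k - 1)))) = ereal (ln (cmod (s (l - 1))))"
      have "k - 1 < d" "l - 1 < d" using kl(1,2) by (simp_all only: atLeastAtMost_iff) linarith+
      then have "cmod (s (k - 1)) = cmod (s (l - 1))" using kl(3) nz by simp
      then have "real (d - (k - 1)) = real (d - (l - 1))" using \<epsilon> by (simp add: s_def norm_mult)
      then show "k = l" using kl(1,2) by auto
    qed
    ultimately show ?thesis unfolding simple_lyapunov_spectrum_def
      by (intro exI[of _ "\<lambda>k. ereal (ln (cmod (s (k - 1))))"]) blast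
  qed
  then show "\<exists>M' \<in> carrier_mat d d. \<forall>\<epsilon>. \<epsilon> \<noteq> 0 \<longrightarrow>
      simple_lyapunov_spectrum d \<alpha> (\<lambda>x. eval_mat M x + \<epsilon> \<cdot>\<^sub>m eval_mat M' x)"
    using M' by blast
qed

theorem theorem3:
  fixes d :: nat and \<alpha> :: real and A :: "real \<Rightarrow> complex mat"
  assumes "d \<ge> 1"
    and "periodic_analytic d A"
    and "has_lyapunov_exponent d \<alpha> A 1 (- \<infinity>)"
  shows "(\<forall>k\<in>{1..d}. has_lyapunov_exponent d \<alpha> A k (- \<infinity>)) \<and>
    (\<exists>A'. periodic_analytic d A' \<and>
       (\<forall>\<epsilon>::complex. \<epsilon> \<noteq> 0 \<longrightarrow>
          simple_lyapunov_spectrum d \<alpha> (\<lambda>x. A x + \<epsilon> \<cdot>\<^sub>m A' x))) \<and>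
    (\<exists>\<delta>>0. \<forall>\<eta>>0. \<exists>B. periodic_analytic d B \<and>
       small_on_strip d \<delta> \<eta> (\<lambda>x. B x - A x) \<and>
       simple_lyapunov_spectrum d \<alpha> B)"
proof -
  obtain M where M: "M \<in> carrier_mat d d" and A: "A = eval_mat M"
    using periodic_analytic_eq_eval_mat[OF assms(2)] by blast
  interpret skew_bezout_domain "rotate_circle \<alpha>" by (rule skew_bezout_domain_rotate_circle)
  obtain m U V where mUV: "m \<le> d" "U \<in> carrier_mat d d" "V \<in> carrier_mat d d" "U * V = 1\<^sub>m d"
    and tri: "strictly_triangular_upto d m (map_mat (rotate_circle \<alpha>) V * M * U)"
    and alt: "m = d \<or> det (identity_rows d m (map_mat (rotate_circle \<alpha>) V * M * U)) \<noteq> 0"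
    by (rule cocycle_block_triangularization[OF M]) (rule that)
  have "m = d"
  proof (rule ccontr)
    assume "m \<noteq> d"
    then show False
      using top_exponent_finite_if_rank_survives[OF M mUV(2-4) _ tri] mUV(1) alt assms(3) A by simp
  qed
  note simple = nilpotent_cocycle_simple_perturbation[OF M assms(1) mUV(2-4) tri[unfolded \<open>m = d\<close>]]
  from simple(2) obtain M' where M': "M' \<in> carrier_mat d d"
    and spec: "\<And>\<epsilon>. \<epsilon> \<noteq> 0 \<Longrightarrow> simple_lyapunov_spectrum d \<alpha> (\<lambda>x. eval_mat M x + \<epsilon> \<cdot>\<^sub>m eval_mat M' x)"
    by blast
  obtain \<delta> where \<delta>: "\<delta> > 0"
    and small: "\<And>\<eta>. \<eta> > 0 \<Longrightarrow> \<exists>\<epsilon>\<noteq>0. small_on_strip d \<delta> \<eta> (\<lambda>x. \<epsilon> \<cdot>\<^sub>m eval_mat M' x)"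
    using small_on_strip_scaled_perturbation[OF M' assms(1)] by blast
  have "\<exists>B. periodic_analytic d B \<and> small_on_strip d \<delta> \<eta> (\<lambda>x. B x - A x) \<and> simple_lyapunov_spectrum d \<alpha> B"
    if \<eta>: "\<eta> > 0" for \<eta>
  proof -
    obtain \<epsilon> where \<epsilon>: "\<epsilon> \<noteq> 0" "small_on_strip d \<delta> \<eta> (\<lambda>x. \<epsilon> \<cdot>\<^sub>m eval_mat M' x)" using small[OF \<eta>] by blast
    let ?B = "\<lambda>x. eval_mat M x + \<epsilon> \<cdot>\<^sub>m eval_mat M' x"
    have "?B = eval_mat (M + constant_function \<epsilon> \<cdot>\<^sub>m M')"
      using M M' by (intro ext eq_matI) (auto simp: eval_mat_def)
    then have "periodic_analytic d ?B"
      using periodic_analytic_eval_mat[of "M + constant_function \<epsilon> \<cdot>\<^sub>m M'" d] M M' by simp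
    moreover have "?B x - A x = \<epsilon> \<cdot>\<^sub>m eval_mat M' x" for x
      unfolding A using M M' by (intro eq_matI) (auto simp: eval_mat_def)
    then have "small_on_strip d \<delta> \<eta> (\<lambda>x. ?B x - A x)" using \<epsilon>(2) by simp
    ultimately show ?thesis using spec[OF \<epsilon>(1)] by blast
  qed
  then show ?thesis
    using simple(1) spec \<delta> periodic_analytic_eval_mat[OF M'] unfolding A by blast
qed

end
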